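(* Let $d\ge2$. (1) Let $M>0$ be a constant such that $\mathbb E[\|T_\ell\|_\infty]\le M\sqrt{\log\ell}$ for all integers $\ell\ge2$. Then for all constants $\beta,\beta'$ with $0<\beta'<\beta$, $$\mu_\ell\Bigl\{\alpha_\ell : \|h_{\alpha,\ell}\|_\infty\ge\bigl(M+\sqrt{2\beta}\bigr)\sqrt{\log\ell}\Bigr\}=O\left(\frac1{\ell^{\beta'}}\right)\qquad(\ell\to\infty).$$ (2) For $0<K<\sqrt{d/(12d+2)}$ and $2K^2/d<\alpha<1/(6d+1)$, $$\mu_\ell\Bigl\{\alpha_\ell : \|h_{\alpha,\ell}\|_\infty\le K\sqrt{\log\ell}\Bigr\}=O\left(\frac{1}{\ell^{(1-(6d+1)\alpha)/2}\log\ell}\right)\qquad(\ell\to\infty).$$ (In (2) the real number $\alpha$ is unrelated to the coefficient vector $\alpha_\ell$.)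
   Context: Let $S^d\subset\mathbb R^{d+1}$ be the unit sphere with normalized (total mass one) Lebesgue measure. For $\ell\ge1$ let $\{Y_{\ell m}: 1\le m\le n_{\ell d}\}$ be a real orthonormal basis (in $L^2$ of the normalized measure) of the eigenspace $\{f:\Delta_{S^d}f=-\ell(\ell+d-1)f\}$ of the Laplace--Beltrami operator, where $n_{\ell d}=\frac{2\ell+d-1}{\ell}\binom{\ell+d-2}{\ell-1}$ is its dimension. For $\alpha_\ell=(\alpha_{\ell1},\dots,\alpha_{\ell n_{\ell d}})$ in the unit sphere $S^{n_{\ell d}-1}\subset\mathbb R^{n_{\ell d}}$ put $h_{\alpha,\ell}=\sum_{m=1}^{n_{\ell d}}\alpha_{\ell m}Y_{\ell m}$; $\mu_\ell$ is the normalized Lebesgue (uniform) probability measure on $S^{n_{\ell d}-1}$. $T_\ell=\sum_{m=1}^{n_{\ell d}}u_{\ell m}Y_{\ell m}$ where $(u_{\ell 1},\dots,u_{\ell n_{\ell d}})$ is a centered Gaussian vector with covariance matrix $n_{\ell d}^{-1}I_{n_{\ell d}}$ (a zero-mean, unit-variance Gaussian field on $S^d$). $\|\cdot\|_\infty$ is the supremum norm on $S^d$. *)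

theory Defs
  imports "HOL-Probability.Probability"
begin

text \<open>
  Throughout, the sphere \<open>S\<^sup>d\<close> is \<open>sphere 0 1\<close> in a Euclidean space \<open>'a\<close> with \<open>DIM('a) = d + 1\<close>.
  A function on the sphere is represented by a function on all of \<open>'a\<close>; the definitions below
  depend only on its values on the sphere. Recall that \<open>sgn y = y /\<^sub>R norm y\<close>.
\<close>

text \<open>Meaningful only for open \<open>S\<close>, since the derivatives are taken at full neighbourhoods.\<close>

fun Ck_on :: "nat \<Rightarrow> ('a::euclidean_space \<Rightarrow> real) \<Rightarrow> 'a set \<Rightarrow> bool" where
  "Ck_on 0 f S \<longleftrightarrow> continuous_on S f"
| "Ck_on (Suc k) f S \<longleftrightarrow> (\<forall>x\<in>S. f differentiable (at x)) \<and>
     (\<forall>v. Ck_on k (\<lambda>x. frechet_derivative f (at x) v) S)"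

definition radial_extension :: "('a::euclidean_space \<Rightarrow> real) \<Rightarrow> 'a \<Rightarrow> real" where
  "radial_extension f y = f (sgn y)"

text \<open>As \<open>sgn\<close> is a smooth retraction of \<open>- {0}\<close> onto the submanifold \<open>sphere 0 1\<close>, a function on
  the sphere is smooth iff its radial extension is smooth on \<open>- {0}\<close>.\<close>

definition smooth_on_sphere :: "('a::euclidean_space \<Rightarrow> real) \<Rightarrow> bool" where
  "smooth_on_sphere f \<longleftrightarrow> (\<forall>k. Ck_on k (radial_extension f) (- {0}))"

definition laplacian :: "('a::euclidean_space \<Rightarrow> real) \<Rightarrow> 'a \<Rightarrow> real" where
  "laplacian F x =
     (\<Sum>b\<in>Basis. frechet_derivative (\<lambda>y. frechet_derivative F (at y) b) (at x) b)"

text \<open>In polar coordinates, \<open>\<Delta> = \<partial>\<^sub>r\<^sup>2 + (d/r) \<partial>\<^sub>r + r\<^sup>-\<^sup>2 \<Delta>\<^sub>S\<close>; hence \<open>\<Delta>\<^sub>S f\<close> is the restriction to the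
  sphere of the Euclidean Laplacian of the extension of \<open>f\<close> that is constant along rays.\<close>

definition laplace_beltrami :: "('a::euclidean_space \<Rightarrow> real) \<Rightarrow> 'a \<Rightarrow> real" where
  "laplace_beltrami f x = laplacian (radial_extension f) x"

definition sphere_eigenspace :: "real \<Rightarrow> ('a::euclidean_space \<Rightarrow> real) set" where
  "sphere_eigenspace c =
     {f. smooth_on_sphere f \<and> (\<forall>x\<in>sphere 0 1. laplace_beltrami f x = c * f x)}"

text \<open>The normalized surface measure of \<open>A\<close> is the proportion of the unit ball occupied by the cone
  over \<open>A\<close>. The final restriction makes the sphere the underlying space, so that the behaviour of
  functions off the sphere does not affect measurability.\<close>

definition sphere_measure :: "'a::euclidean_space measure" where
  "sphere_measure =
     restrict_space (distr (uniform_measure lborel (cball 0 1)) borel sgn) (sphere 0 1)"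

definition sphere_norm :: "('a::euclidean_space \<Rightarrow> real) \<Rightarrow> real" where
  "sphere_norm f = (SUP x\<in>sphere 0 1. \<bar>f x\<bar>)"

text \<open>The dimension of the \<open>l\<close>-th eigenspace on \<open>S\<^sup>d\<close>; the division is exact by the lemma below.\<close>

definition eigenspace_dim :: "nat \<Rightarrow> nat \<Rightarrow> nat" where
  "eigenspace_dim d l = ((2 * l + d - 1) * ((l + d - 2) choose (l - 1))) div l"

lemma real_eigenspace_dim:
  assumes "d \<ge> 2" and "l \<ge> 1"
  shows "real (eigenspace_dim d l) =
    (2 * real l + real d - 1) / real l * real ((l + d - 2) choose (l - 1))"
proof -
  have "Suc (l + d - 2) * ((l + d - 2) choose (l - 1)) = (Suc (l + d - 2) choose l) * l"
    using Suc_times_binomial_eq[of "l + d - 2" "l - 1"] assms by simp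
  then have "l dvd l * ((l + d - 2) choose (l - 1)) +
      Suc (l + d - 2) * ((l + d - 2) choose (l - 1))"
    by simp
  moreover have "2 * l + d - 1 = l + Suc (l + d - 2)" using assms by simp
  ultimately have "l dvd (2 * l + d - 1) * ((l + d - 2) choose (l - 1))"
    by (metis distrib_right)
  then show ?thesis
    using assms by (simp add: eigenspace_dim_def real_of_nat_div of_nat_diff)
qed

definition orthonormal_basis_on_sphere ::
    "nat \<Rightarrow> (nat \<Rightarrow> 'a::euclidean_space \<Rightarrow> real) \<Rightarrow> ('a \<Rightarrow> real) set \<Rightarrow> bool" where
  "orthonormal_basis_on_sphere n Y V \<longleftrightarrow>
     (\<forall>m\<in>{1..n}. Y m \<in> V) \<and>
     (\<forall>i\<in>{1..n}. \<forall>j\<in>{1..n}.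
        (LINT x|sphere_measure. Y i x * Y j x) = (if i = j then 1 else 0)) \<and>
     (\<forall>f\<in>V. \<exists>c. \<forall>x\<in>sphere 0 1. f x = (\<Sum>m=1..n. c m * Y m x))"

text \<open>The space \<open>\<real>\<^sup>n\<close> of coefficient vectors is \<open>{1..n} \<rightarrow>\<^sub>E UNIV\<close> with the product Borel structure,
  because \<open>n\<close> varies with the eigenvalue. The measure is the same cone construction as above.\<close>

definition coeff_ball :: "nat \<Rightarrow> (nat \<Rightarrow> real) set" where
  "coeff_ball n = {a \<in> {1..n} \<rightarrow>\<^sub>E UNIV. (\<Sum>m=1..n. (a m)\<^sup>2) \<le> 1}"

definition coeff_sphere :: "nat \<Rightarrow> (nat \<Rightarrow> real) set" where
  "coeff_sphere n = {a \<in> {1..n} \<rightarrow>\<^sub>E UNIV. (\<Sum>m=1..n. (a m)\<^sup>2) = 1}"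

definition coeff_sphere_measure :: "nat \<Rightarrow> (nat \<Rightarrow> real) measure" where
  "coeff_sphere_measure n =
     restrict_space
       (distr (uniform_measure (\<Pi>\<^sub>M m\<in>{1..n}. lborel) (coeff_ball n)) (\<Pi>\<^sub>M m\<in>{1..n}. borel)
          (\<lambda>a. \<lambda>m\<in>{1..n}. a m / sqrt (\<Sum>k=1..n. (a k)\<^sup>2)))
       (coeff_sphere n)"

text \<open>Centered Gaussian vector in \<open>\<real>\<^sup>n\<close> with covariance matrix \<open>v\<close> times the identity (\<open>v > 0\<close>),
  given by its density \<open>(2\<pi>)\<^sup>-\<^sup>n\<^sup>/\<^sup>2 det(\<Sigma>)\<^sup>-\<^sup>1\<^sup>/\<^sup>2 exp(- \<langle>x, \<Sigma>\<^sup>-\<^sup>1 x\<rangle> / 2)\<close> with \<open>\<Sigma> = v I\<close>.\<close>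

definition centered_gaussian_vector ::
    "'w measure \<Rightarrow> nat \<Rightarrow> real \<Rightarrow> (nat \<Rightarrow> 'w \<Rightarrow> real) \<Rightarrow> bool" where
  "centered_gaussian_vector \<Omega> n v u \<longleftrightarrow>
     distributed \<Omega> (\<Pi>\<^sub>M m\<in>{1..n}. lborel) (\<lambda>\<omega>. \<lambda>m\<in>{1..n}. u m \<omega>)
       (\<lambda>x. ennreal ((2 * pi * v) powr (- real n / 2) * exp (- (\<Sum>m=1..n. (x m)\<^sup>2) / (2 * v))))"

end

theory Submission
  imports Defs
begin

text \<open>
  Write \<open>h\<close> for the function \<open>\<Sum>m. a m * Y m\<close> with coefficient vector \<open>a\<close>, \<open>N a\<close> for its sup norm on the
  sphere, and \<open>n\<close> for the dimension of the eigenspace. Besides orthonormality, the only property of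
  spherical harmonics that enters is the identity \<open>\<Sum>m. (Y m x)\<^sup>2 = n\<close> at every point \<open>x\<close> of the sphere
  (\<open>orthonormal_basis_sum_squares\<close>). It holds because the eigenspace and the surface measure are
  invariant under rotations, which makes the left-hand side constant, with mean \<open>n\<close>.

  Both estimates are proved for a centered Gaussian coefficient vector with covariance matrix \<open>1 / n\<close>
  times the identity and are then carried over to the sphere. The direction of such a vector is
  uniformly distributed and independent of its length (\<open>gaussian_product_polar\<close>), and for \<open>r < 1\<close> the
  length exceeds \<open>r\<close>, for \<open>r > 1\<close> it stays below \<open>r\<close>, with a probability bounded away from zero
  uniformly in \<open>n\<close> (\<open>gaussian_radius_concentration\<close>). As \<open>N\<close> is homogeneous, passing to the sphere costs
  a constant factor in the probability and an arbitrarily small change of the threshold.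

  Large values. By the identity, \<open>N\<close> is Lipschitz with constant \<open>sqrt n\<close>, so for variance \<open>1 / n\<close> the
  Gaussian concentration inequality bounds the probability of \<open>N \<ge> m + t\<close> by \<open>exp (- s * t\<^sup>2 / 2)\<close>, where
  \<open>m\<close> bounds the mean of \<open>N\<close> and \<open>s < 1\<close> is arbitrary. With \<open>m = M * sqrt (ln l)\<close> and
  \<open>t = sqrt (2 * \<beta> * ln l)\<close> this is \<open>l powr (- s * \<beta>)\<close>; the gap between \<open>\<beta>'\<close> and \<open>\<beta>\<close> pays for \<open>s\<close> and for
  the change of the threshold. The constant \<open>1 / 2\<close> in the exponent is essential here. It comes from
  the Prekopa-Leindler inequality (\<open>gaussian_lipschitz_exponential_moment\<close>).

  Small values. Let \<open>Z\<close> (\<open>cosh_mean\<close>) be the integral of \<open>cosh (\<lambda> * h)\<close> over the sphere. By the identity each value of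
  \<open>h\<close> is a standard normal variable, so \<open>Z\<close> has mean \<open>exp (\<lambda>\<^sup>2 / 2)\<close>. Because \<open>cosh\<close> is even, the
  correlation \<open>\<rho>\<close> of the field at two points enters the relative variance of \<open>Z\<close> only through \<open>\<rho>\<^sup>2\<close>: it is
  the double integral of \<open>cosh (\<lambda>\<^sup>2 * \<rho>) - 1 \<le> \<rho>\<^sup>2 * exp (\<lambda>\<^sup>2)\<close>, and \<open>\<rho>\<^sup>2\<close> has integral \<open>1 / n\<close> by
  orthonormality. If \<open>N a \<le> t\<close>, then \<open>Z a \<le> exp (\<lambda> * t)\<close>, which is at most half the mean of \<open>Z\<close> once \<open>\<lambda>\<close> is
  somewhat larger than \<open>2 * t\<close>. Chebyshev's inequality then bounds the probability by
  \<open>4 * exp (\<lambda>\<^sup>2) / n\<close> (\<open>gaussian_norm_lower_tail\<close>). Since \<open>n \<ge> l\<close> and \<open>K\<^sup>2 < 1 / 12\<close>, the choice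
  \<open>\<lambda>\<^sup>2 = ln l / 2\<close> gives the bound \<open>O(l powr (- 1 / 2))\<close>, and this suffices because \<open>\<alpha> > 0\<close>.
\<close>

section \<open>Rotation invariance of Lebesgue measure and of the eigenspaces\<close>

text \<open>Integrate \<open>indicator A x * indicator B (x + y)\<close> against \<open>M\<close> in \<open>x\<close> and Lebesgue measure in \<open>y\<close>, where \<open>A\<close> is the
  unit ball. Translating \<open>y\<close> gives \<open>M A * lborel B\<close>; translating \<open>x\<close> instead gives \<open>lborel A * M B\<close>,
  because \<open>A = - A\<close>.\<close>

lemma borel_measure_eq_lborel_if_translation_invariant:
  fixes M :: "'a::euclidean_space measure"
  assumes sets_M [simp]: "sets M = sets borel"
    and inv: "\<And>c. distr M borel ((+) c) = M"
    and sf: "sigma_finite_measure M"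
    and ball: "emeasure M (cball 0 1) = emeasure lborel (cball (0::'a) 1)"
  shows "M = lborel"
proof (rule measure_eqI)
  fix B assume B: "B \<in> sets M"
  then have [measurable]: "B \<in> sets borel" by simp
  note [measurable_cong] = sets_M
  interpret M: sigma_finite_measure M by (rule sf)
  interpret P: pair_sigma_finite M "lborel :: 'a measure" ..
  define A where "A = cball (0::'a) 1"
  have [measurable]: "A \<in> sets borel" by (simp add: A_def)
  have shiftM: "(\<integral>\<^sup>+x. f (c + x) \<partial>M) = (\<integral>\<^sup>+x. f x \<partial>M)" if [measurable]: "f \<in> borel_measurable borel"
    for f and c :: 'a
  proof -
    have "(\<integral>\<^sup>+x. f x \<partial>M) = (\<integral>\<^sup>+x. f x \<partial>distr M borel ((+) c))" by (simp only: inv)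
    also have "\<dots> = (\<integral>\<^sup>+x. f (c + x) \<partial>M)" by (subst nn_integral_distr) auto
    finally show ?thesis by simp
  qed
  have shiftL: "(\<integral>\<^sup>+x. f (c + x) \<partial>lborel) = (\<integral>\<^sup>+x. f x \<partial>lborel)" if [measurable]: "f \<in> borel_measurable borel"
    for f and c :: 'a
  proof -
    have "(\<integral>\<^sup>+x. f x \<partial>lborel) = (\<integral>\<^sup>+x. f x \<partial>distr lborel borel ((+) c))" by (simp only: lborel_distr_plus)
    also have "\<dots> = (\<integral>\<^sup>+x. f (c + x) \<partial>lborel)" by (subst nn_integral_distr) auto
    finally show ?thesis by simp
  qed
  have mA: "(\<lambda>p. indicator A (f p) :: ennreal) \<in> borel_measurable (M \<Otimes>\<^sub>M lborel)"
    if "f \<in> measurable (M \<Otimes>\<^sub>M lborel) borel" for f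
    by (rule measurable_compose[OF that borel_measurable_indicator]) simp
  have mB: "(\<lambda>p. indicator B (f p) :: ennreal) \<in> borel_measurable (M \<Otimes>\<^sub>M lborel)"
    if "f \<in> measurable (M \<Otimes>\<^sub>M lborel) borel" for f
    by (rule measurable_compose[OF that borel_measurable_indicator]) simp
  have fs: "fst \<in> measurable (M \<Otimes>\<^sub>M lborel) borel" "snd \<in> measurable (M \<Otimes>\<^sub>M lborel) borel"
    using measurable_fst[of M lborel] measurable_snd[of M lborel]
    by (simp_all add: measurable_cong_sets[OF refl sets_M] measurable_cong_sets[OF refl sets_lborel])
  have "emeasure M A * emeasure lborel B = (\<integral>\<^sup>+x. \<integral>\<^sup>+y. indicator A x * indicator B y \<partial>lborel \<partial>M)"
  proof -
    have "indicator A \<in> borel_measurable M" by (intro borel_measurable_indicator) simp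
    then have "(\<integral>\<^sup>+x. indicator A x * emeasure lborel B \<partial>M) = emeasure M A * emeasure lborel B"
      by (subst nn_integral_multc) auto
    then show ?thesis by (simp add: nn_integral_cmult)
  qed
  also have "\<dots> = (\<integral>\<^sup>+x. \<integral>\<^sup>+y. indicator A x * indicator B (x + y) \<partial>lborel \<partial>M)"
  proof (rule nn_integral_cong)
    fix x
    show "(\<integral>\<^sup>+y. indicator A x * indicator B y \<partial>lborel) = (\<integral>\<^sup>+y. indicator A x * indicator B (x + y) \<partial>lborel)"
      using shiftL[of "\<lambda>y. indicator A x * indicator B y" x] by simp
  qed
  also have "\<dots> = (\<integral>\<^sup>+y. \<integral>\<^sup>+x. indicator A x * indicator B (x + y) \<partial>M \<partial>lborel)"
    by (rule P.Fubini'[symmetric])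
       (unfold case_prod_beta', intro borel_measurable_times_ennreal mA mB borel_measurable_add fs)
  also have "\<dots> = (\<integral>\<^sup>+y. \<integral>\<^sup>+x. indicator A (- y + x) * indicator B x \<partial>M \<partial>lborel)"
  proof (rule nn_integral_cong)
    fix y :: 'a
    show "(\<integral>\<^sup>+x. indicator A x * indicator B (x + y) \<partial>M) = (\<integral>\<^sup>+x. indicator A (- y + x) * indicator B x \<partial>M)"
      using shiftM[of "\<lambda>x. indicator A (- y + x) * indicator B x" y] by (simp add: add.commute)
  qed
  also have "\<dots> = (\<integral>\<^sup>+x. \<integral>\<^sup>+y. indicator A (- y + x) * indicator B x \<partial>lborel \<partial>M)"
    by (rule P.Fubini')
       (unfold case_prod_beta', intro borel_measurable_times_ennreal mA mB borel_measurable_add borel_measurable_uminus fs)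
  also have "\<dots> = (\<integral>\<^sup>+x. \<integral>\<^sup>+y. indicator A (- x + y) * indicator B x \<partial>lborel \<partial>M)"
    by (intro nn_integral_cong) (auto simp: indicator_def A_def norm_minus_commute intro!: nn_integral_cong)
  also have "\<dots> = (\<integral>\<^sup>+x. \<integral>\<^sup>+y. indicator A y * indicator B x \<partial>lborel \<partial>M)"
  proof (rule nn_integral_cong)
    fix x
    show "(\<integral>\<^sup>+y. indicator A (- x + y) * indicator B x \<partial>lborel) = (\<integral>\<^sup>+y. indicator A y * indicator B x \<partial>lborel)"
      using shiftL[of "\<lambda>y. indicator A y * indicator B x" "- x"] by simp
  qed
  also have "\<dots> = emeasure lborel A * emeasure M B"
  proof -
    have "(\<integral>\<^sup>+x. emeasure lborel A * indicator B x \<partial>M) = emeasure lborel A * emeasure M B"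
      by (subst nn_integral_cmult) auto
    then show ?thesis by (simp add: nn_integral_multc)
  qed
  finally have "emeasure lborel A * emeasure lborel B = emeasure lborel A * emeasure M B"
    by (simp only: ball A_def)
  moreover have "emeasure lborel A \<noteq> \<infinity>" "emeasure lborel A \<noteq> 0"
    using content_cball_pos[of 1 "0::'a"] emeasure_lborel_cball_finite[of "0::'a" 1]
    by (auto simp: measure_def A_def)
  ultimately show "emeasure M B = emeasure lborel B"
    by (simp add: ennreal_mult_cancel_left)
qed simp

text \<open>The image measure is again translation invariant, since \<open>U\<close> is additive and onto, and it gives the
  unit ball, which \<open>U\<close> preserves, the same mass.\<close>

lemma lborel_distr_orthogonal:
  fixes U :: "'a::euclidean_space \<Rightarrow> 'a"
  assumes U: "orthogonal_transformation U"
  shows "distr lborel borel U = lborel"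
proof (rule borel_measure_eq_lborel_if_translation_invariant)
  have lin: "linear U" using U by (rule orthogonal_transformation_linear)
  have bij: "bij U" using U by (rule orthogonal_transformation_bij)
  have [measurable]: "U \<in> borel_measurable borel"
    by (intro borel_measurable_continuous_onI linear_continuous_on linear_conv_bounded_linear[THEN iffD1] lin)
  have "linear (inv U)" using orthogonal_transformation_inv[OF U] orthogonal_transformation_linear by blast
  then have Vm[measurable]: "inv U \<in> borel_measurable borel"
    by (intro borel_measurable_continuous_onI linear_continuous_on linear_conv_bounded_linear[THEN iffD1])
  have vU: "U -` cball 0 r = cball 0 r" for r
    using U by (auto simp: orthogonal_transformation_norm)
  show "emeasure (distr lborel borel U) (cball 0 1) = emeasure lborel (cball (0::'a) 1)"
    by (simp add: emeasure_distr vU)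
  show "sigma_finite_measure (distr lborel borel U)"
  proof
    show "\<exists>A. countable A \<and> A \<subseteq> sets (distr lborel borel U) \<and> \<Union> A = space (distr lborel borel U) \<and>
        (\<forall>a\<in>A. emeasure (distr lborel borel U) a \<noteq> \<infinity>)"
    proof (intro exI[of _ "range (\<lambda>n::nat. cball 0 (real n))"] conjI ballI)
      show "\<Union> (range (\<lambda>n::nat. cball (0::'a) (real n))) = space (distr lborel borel U)"
      proof -
        have "\<exists>n::nat. x \<in> cball 0 (real n)" for x :: 'a using real_arch_simple[of "norm x"] by auto
        then show ?thesis by auto
      qed
      fix a assume "a \<in> range (\<lambda>n::nat. cball (0::'a) (real n))"
      then obtain n :: nat where "a = cball 0 (real n)" by auto
      then show "emeasure (distr lborel borel U) a \<noteq> \<infinity>"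
        using emeasure_lborel_cball_finite[of "0::'a" "real n"] by (simp add: emeasure_distr vU)
    qed auto
  qed
  fix c :: 'a
  obtain b where b: "c = U b" using bij by (metis bij_pointE)
  have "distr (distr lborel borel U) borel ((+) c) = distr lborel borel (\<lambda>x. U (b + x))"
    by (subst distr_distr) (auto simp: comp_def b linear_add[OF lin])
  also have "\<dots> = distr (distr lborel borel ((+) b)) borel U"
    by (subst distr_distr) (auto simp: comp_def)
  also have "\<dots> = distr lborel borel U" by (simp only: lborel_distr_plus)
  finally show "distr (distr lborel borel U) borel ((+) c) = distr lborel borel U" .
qed simp

lemma reflection_swapping_unit_vectors:
  fixes x y :: "'a::euclidean_space"
  assumes "norm x = norm y"
  obtains U where "orthogonal_transformation U" "U x = y" "\<And>z. U (U z) = z"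
proof (cases "x = y")
  case True
  then show ?thesis using that[of "\<lambda>z. z"] by simp
next
  case False
  define w where "w = x - y"
  define U where "U z = z - (2 * (z \<bullet> w) / (w \<bullet> w)) *\<^sub>R w" for z
  have w: "w \<bullet> w \<noteq> 0" using False by (simp add: w_def)
  have "x \<bullet> x = y \<bullet> y" using assms by (simp add: norm_eq_sqrt_inner)
  then have xw: "2 * (x \<bullet> w) = w \<bullet> w" by (simp add: w_def inner_diff inner_commute)
  have lin: "linear U"
    by (rule linearI) (simp_all add: U_def inner_add_left add_divide_distrib scaleR_add_left algebra_simps)
  have "U z \<bullet> U v = z \<bullet> v" for z v
    using w by (simp add: U_def inner_diff_left inner_diff_right inner_commute field_simps)
  then have "orthogonal_transformation U" using lin by (simp add: orthogonal_transformation_def)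
  moreover have "U x = y" using w by (simp add: U_def xw w_def[symmetric]) (simp add: w_def)
  moreover have "U (U z) = z" for z
  proof -
    have "2 * (U z \<bullet> w) / (w \<bullet> w) = - (2 * (z \<bullet> w) / (w \<bullet> w))"
      using w by (simp add: U_def inner_diff_left)
    then have "U (U z) = U z + (2 * (z \<bullet> w) / (w \<bullet> w)) *\<^sub>R w" by (subst U_def) simp
    then show ?thesis by (simp add: U_def)
  qed
  ultimately show ?thesis by (rule that)
qed

text \<open>The predicate \<open>Ck_on\<close> also mentions the values of \<open>frechet_derivative\<close> at points where it need not be a
  derivative. On an open set these are irrelevant.\<close>

lemma Ck_on_cong:
  assumes "open S" "\<And>x. x \<in> S \<Longrightarrow> f x = g x"
  shows "Ck_on k f S \<Longrightarrow> Ck_on k g S"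
  using assms
proof (induction k arbitrary: f g)
  case 0
  then show ?case by (simp cong: continuous_on_cong)
next
  case (Suc k)
  have d: "f differentiable at x" if "x \<in> S" for x using Suc.prems(1) that by simp
  have d': "g differentiable at x" if "x \<in> S" for x
    using d[OF that] Suc.prems(2,3) that
    by (meson differentiable_def has_derivative_transform_within_open)
  moreover have "Ck_on k (\<lambda>x. frechet_derivative g (at x) v) S" for v
  proof (rule Suc.IH)
    show "Ck_on k (\<lambda>x. frechet_derivative f (at x) v) S" using Suc.prems(1) by simp
    show "frechet_derivative f (at x) v = frechet_derivative g (at x) v" if "x \<in> S" for x
      using frechet_derivative_transform_within_open[OF d[OF that] Suc.prems(2) that Suc.prems(3)] by simp
  qed (fact Suc.prems(2))
  ultimately show ?case by simp
qed

lemma has_derivative_linear_comp: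
  fixes U :: "'a::euclidean_space \<Rightarrow> 'a"
  assumes "linear U" "F differentiable at (U x)"
  shows "((\<lambda>y. F (U y)) has_derivative (\<lambda>v. frechet_derivative F (at (U x)) (U v))) (at x)"
proof -
  have "(U has_derivative U) (at x)"
    by (intro linear_imp_has_derivative assms)
  from has_derivative_compose[OF this frechet_derivative_works[THEN iffD1, OF assms(2)]]
  show ?thesis .
qed

lemma frechet_derivative_linear_comp:
  fixes U :: "'a::euclidean_space \<Rightarrow> 'a"
  assumes "linear U" "F differentiable at (U x)"
  shows "frechet_derivative (\<lambda>y. F (U y)) (at x) v = frechet_derivative F (at (U x)) (U v)"
  using frechet_derivative_at[OF has_derivative_linear_comp[where F=F and U=U and x=x, OF assms]]
  by (simp add: fun_eq_iff)

lemma Ck_on_linear_comp: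
  fixes U :: "'a::euclidean_space \<Rightarrow> 'a"
  assumes U: "linear U" and S: "open S" and US: "\<And>x. x \<in> S \<Longrightarrow> U x \<in> S"
  shows "Ck_on k F S \<Longrightarrow> Ck_on k (\<lambda>x. F (U x)) S"
proof (induction k arbitrary: F)
  case 0
  have "continuous_on S U" using U by (simp add: linear_continuous_on linear_conv_bounded_linear)
  moreover have "continuous_on S F" using 0 by simp
  moreover have "U ` S \<subseteq> S" using US by blast
  ultimately have "continuous_on S (\<lambda>x. F (U x))" by (metis continuous_on_compose2)
  then show ?case by simp
next
  case (Suc k)
  have d: "F differentiable at (U x)" if "x \<in> S" for x using Suc.prems US[OF that] by simp
  have "Ck_on k (\<lambda>x. frechet_derivative (\<lambda>y. F (U y)) (at x) v) S" for v
  proof (rule Ck_on_cong[OF S])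
    show "Ck_on k (\<lambda>x. frechet_derivative F (at (U x)) (U v)) S"
      by (rule Suc.IH) (use Suc.prems in simp)
  qed (simp add: frechet_derivative_linear_comp[OF U d])
  then show ?case using has_derivative_linear_comp[OF U d] by (auto simp: differentiable_def)
qed

text \<open>The trace of a bilinear form does not depend on the orthonormal basis: expand \<open>B (U b) (U b)\<close> in
  coordinates and use that the inverse of \<open>U\<close> preserves inner products.\<close>

lemma trace_orthogonal_invariant:
  fixes U :: "'a::euclidean_space \<Rightarrow> 'a" and B :: "'a \<Rightarrow> 'a \<Rightarrow> real"
  assumes U: "orthogonal_transformation U" and B: "bilinear B"
  shows "(\<Sum>b\<in>Basis. B (U b) (U b)) = (\<Sum>b\<in>Basis. B b b)"
proof -
  have l: "linear (\<lambda>y. B x y)" "linear (\<lambda>x. B x y)" for x y using B by (auto simp: bilinear_def)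
  have ex: "B v w = (\<Sum>c\<in>Basis. \<Sum>e\<in>Basis. (v \<bullet> c) * (w \<bullet> e) * B c e)" for v w
  proof -
    have "B v w = B (\<Sum>c\<in>Basis. (v \<bullet> c) *\<^sub>R c) (\<Sum>e\<in>Basis. (w \<bullet> e) *\<^sub>R e)"
      by (simp add: euclidean_representation)
    also have "\<dots> = (\<Sum>c\<in>Basis. \<Sum>e\<in>Basis. (v \<bullet> c) * (w \<bullet> e) * B c e)"
      by (simp add: linear_sum[OF l(1)] linear_sum[OF l(2)] linear_cmul[OF l(1)] linear_cmul[OF l(2)]
          sum_distrib_left mult_ac) (rule sum.swap)
    finally show ?thesis .
  qed
  let ?V = "inv U"
  have V: "orthogonal_transformation ?V" by (rule orthogonal_transformation_inv[OF U])
  have adj: "U b \<bullet> c = b \<bullet> ?V c" for b c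
  proof -
    have "U (?V c) = c" using U by (simp add: orthogonal_transformation_surj surj_f_inv_f)
    then show ?thesis using U by (metis orthogonal_transformation_def)
  qed
  have orth: "(\<Sum>b\<in>Basis. (U b \<bullet> c) * (U b \<bullet> e)) = c \<bullet> e" for c e
  proof -
    have "(\<Sum>b\<in>Basis. (U b \<bullet> c) * (U b \<bullet> e)) = ?V c \<bullet> ?V e"
      unfolding adj by (subst euclidean_inner[of "?V c" "?V e"]) (simp add: inner_commute)
    then show ?thesis using V by (simp add: orthogonal_transformation_def)
  qed
  have "(\<Sum>b\<in>Basis. B (U b) (U b)) =
     (\<Sum>b\<in>Basis. \<Sum>c\<in>Basis. \<Sum>e\<in>Basis. (U b \<bullet> c) * (U b \<bullet> e) * B c e)"
    by (intro sum.cong refl ex)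
  also have "\<dots> = (\<Sum>c\<in>Basis. \<Sum>e\<in>Basis. \<Sum>b\<in>Basis. (U b \<bullet> c) * (U b \<bullet> e) * B c e)"
  proof -
    have "(\<Sum>b\<in>Basis. \<Sum>e\<in>Basis. (U b \<bullet> c) * (U b \<bullet> e) * B c e) =
      (\<Sum>e\<in>Basis. \<Sum>b\<in>Basis. (U b \<bullet> c) * (U b \<bullet> e) * B c e)" for c
      by (rule sum.swap)
    then show ?thesis by (subst sum.swap) simp
  qed
  also have "\<dots> = (\<Sum>c\<in>Basis. \<Sum>e\<in>Basis. (c \<bullet> e) * B c e)"
    by (simp add: sum_distrib_right[symmetric] orth)
  also have "\<dots> = (\<Sum>c\<in>Basis. B c c)"
    by (intro sum.cong refl) (simp add: inner_Basis if_distrib[of "\<lambda>x. x * _"] cong: if_cong)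
  finally show ?thesis .
qed

lemma laplacian_orthogonal_comp:
  fixes U :: "'a::euclidean_space \<Rightarrow> 'a"
  assumes U: "orthogonal_transformation U" and S: "open S" and US: "\<And>x. x \<in> S \<Longrightarrow> U x \<in> S"
    and F: "Ck_on 2 F S" and x: "x \<in> S"
  shows "laplacian (\<lambda>y. F (U y)) x = laplacian F (U x)"
proof -
  have lin: "linear U" using U by (rule orthogonal_transformation_linear)
  have d1: "F differentiable at y" if "y \<in> S" for y using F that by (simp add: numeral_2_eq_2)
  have d2: "(\<lambda>y. frechet_derivative F (at y) v) differentiable at y" if "y \<in> S" for y v
    using F that by (simp add: numeral_2_eq_2)
  let ?D = "\<lambda>v w. frechet_derivative (\<lambda>y. frechet_derivative F (at y) v) (at (U x)) w"
  have Ux: "U x \<in> S" using US x by simp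
  have bil: "bilinear ?D"
    unfolding bilinear_def
  proof (intro conjI allI)
    show "linear (\<lambda>w. ?D v w)" for v by (rule linear_frechet_derivative[OF d2[OF Ux]])
    fix w
    show "linear (\<lambda>v. ?D v w)"
    proof (rule linearI)
      fix v v' and r :: real
      have add: "frechet_derivative F (at y) (v + v') = frechet_derivative F (at y) v + frechet_derivative F (at y) v'" if "y \<in> S" for y
        using linear_add[OF linear_frechet_derivative[OF d1[OF that]]] .
      have scl: "frechet_derivative F (at y) (r *\<^sub>R v) = r * frechet_derivative F (at y) v" if "y \<in> S" for y
        using linear_cmul[OF linear_frechet_derivative[OF d1[OF that]]] by simp
      have hd: "((\<lambda>y. frechet_derivative F (at y) v) has_derivative ?D v) (at (U x))" for v
        using d2[OF Ux] by (simp add: frechet_derivative_works)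
      have "((\<lambda>y. frechet_derivative F (at y) (v + v')) has_derivative (\<lambda>w. ?D v w + ?D v' w)) (at (U x))"
        by (rule has_derivative_transform_within_open[OF has_derivative_add[OF hd hd] S Ux]) (simp add: add)
      from fun_cong[OF frechet_derivative_at[OF this], of w] show "?D (v + v') w = ?D v w + ?D v' w" by (rule sym)
      have "((\<lambda>y. frechet_derivative F (at y) (r *\<^sub>R v)) has_derivative (\<lambda>w. r * ?D v w)) (at (U x))"
        by (rule has_derivative_transform_within_open[OF has_derivative_mult_right[OF hd] S Ux]) (simp add: scl)
      from fun_cong[OF frechet_derivative_at[OF this], of w] show "?D (r *\<^sub>R v) w = r *\<^sub>R ?D v w"
        unfolding real_scaleR_def by (rule sym)
    qed
  qed
  have "laplacian (\<lambda>y. F (U y)) x = (\<Sum>b\<in>Basis. ?D (U b) (U b))"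
    unfolding laplacian_def
  proof (rule sum.cong[OF refl])
    fix b
    have hd: "((\<lambda>y. frechet_derivative F (at (U y)) (U b)) has_derivative (\<lambda>v. ?D (U b) (U v))) (at x)"
      by (rule has_derivative_linear_comp[OF lin d2[OF Ux]])
    have "((\<lambda>y. frechet_derivative (\<lambda>z. F (U z)) (at y) b) has_derivative (\<lambda>v. ?D (U b) (U v))) (at x)"
      by (rule has_derivative_transform_within_open[OF hd S x])
        (simp add: frechet_derivative_linear_comp[OF lin d1[OF US]])
    from fun_cong[OF frechet_derivative_at[OF this], of b]
    show "frechet_derivative (\<lambda>y. frechet_derivative (\<lambda>z. F (U z)) (at y) b) (at x) b = ?D (U b) (U b)" by (rule sym)
  qed
  also have "\<dots> = laplacian F (U x)"
    unfolding laplacian_def by (rule trace_orthogonal_invariant[OF U bil])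
  finally show ?thesis .
qed

lemma sphere_eigenspace_orthogonal_comp:
  fixes U :: "'a::euclidean_space \<Rightarrow> 'a"
  assumes U: "orthogonal_transformation U" and f: "f \<in> sphere_eigenspace c"
  shows "(\<lambda>x. f (U x)) \<in> sphere_eigenspace c"
proof -
  have lin: "linear U" using U by (rule orthogonal_transformation_linear)
  have n: "norm (U x) = norm x" for x using U by (rule orthogonal_transformation_norm)
  have rad: "radial_extension (\<lambda>x. f (U x)) = (\<lambda>y. radial_extension f (U y))"
    by (simp add: radial_extension_def fun_eq_iff sgn_div_norm n linear_cmul[OF lin])
  have o: "open (- {0::'a})" by auto
  have US: "U x \<in> - {0}" if "x \<in> - {0}" for x using that n[of x] by auto
  have Ck: "Ck_on k (radial_extension f) (- {0})" for k
    using f by (simp add: sphere_eigenspace_def smooth_on_sphere_def)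
  have "smooth_on_sphere (\<lambda>x. f (U x))"
    unfolding smooth_on_sphere_def rad by (intro allI Ck_on_linear_comp[OF lin o US] Ck)
  moreover have "laplace_beltrami (\<lambda>x. f (U x)) x = c * f (U x)" if "x \<in> sphere 0 1" for x
  proof -
    have "x \<in> - {0}" "U x \<in> sphere 0 1" using that n[of x] by auto
    then show ?thesis
      using f laplacian_orthogonal_comp[OF U o US Ck]
      by (simp add: laplace_beltrami_def rad sphere_eigenspace_def)
  qed
  ultimately show ?thesis by (simp add: sphere_eigenspace_def)
qed

section \<open>The sum of squares of an orthonormal basis of an eigenspace\<close>

lemma space_sphere_measure: "space sphere_measure = sphere (0::'a::euclidean_space) 1"
  by (simp add: sphere_measure_def space_restrict_space)

lemma sets_sphere_measure:
  "sets (sphere_measure :: 'a::euclidean_space measure) = sets (restrict_space borel (sphere 0 1))"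
  by (simp add: sphere_measure_def sets_restrict_space)

lemma borel_measurable_sphere_measure:
  fixes f :: "'a::euclidean_space \<Rightarrow> real"
  assumes "continuous_on (sphere 0 1) f"
  shows "f \<in> borel_measurable sphere_measure"
  using borel_measurable_continuous_on_restrict[OF assms]
  by (simp add: measurable_cong_sets[OF sets_sphere_measure refl])

text \<open>Reduces every question about the surface measure to a question about Lebesgue measure of cones.\<close>

lemma emeasure_sphere_measure:
  fixes A :: "'a::euclidean_space set"
  assumes "A \<in> sets borel" "A \<subseteq> sphere 0 1"
  shows "emeasure sphere_measure A =
    emeasure lborel (cball 0 1 \<inter> sgn -` A) / emeasure lborel (cball (0::'a) 1)"
proof -
  have "emeasure sphere_measure A = emeasure (distr (uniform_measure lborel (cball 0 1)) borel sgn) A"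
    unfolding sphere_measure_def using assms by (intro emeasure_restrict_space) auto
  also have "\<dots> = emeasure (uniform_measure lborel (cball (0::'a) 1)) (sgn -` A)"
    using assms by (subst emeasure_distr) auto
  also have "\<dots> = emeasure lborel (cball 0 1 \<inter> sgn -` A) / emeasure lborel (cball (0::'a) 1)"
    using assms measurable_sets_borel[OF borel_measurable_sgn, of A] by (intro emeasure_uniform_measure) auto
  finally show ?thesis .
qed

lemma emeasure_lborel_unit_ball:
  "emeasure lborel (cball (0::'a::euclidean_space) 1) \<noteq> 0" "emeasure lborel (cball (0::'a) 1) \<noteq> \<infinity>"
  using content_cball_pos[of 1 "0::'a"] emeasure_lborel_cball_finite[of "0::'a" 1]
  by (auto simp: measure_def)

lemma prob_space_sphere_measure: "prob_space (sphere_measure :: 'a::euclidean_space measure)"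
proof
  have "emeasure sphere_measure (sphere (0::'a) 1) = emeasure lborel (cball (0::'a) 1 \<inter> sgn -` sphere 0 1) / emeasure lborel (cball (0::'a) 1)"
    by (rule emeasure_sphere_measure) auto
  also have "cball (0::'a) 1 \<inter> sgn -` sphere 0 1 = cball 0 1 - {0}"
    by (auto simp: norm_sgn split: if_splits)
  also have "emeasure lborel (cball (0::'a) 1 - {0}) = emeasure lborel (cball (0::'a) 1)"
    by (subst emeasure_Diff_null_set) (auto simp: null_sets_def)
  finally show "emeasure (sphere_measure :: 'a measure) (space sphere_measure) = 1"
    using emeasure_lborel_unit_ball[where 'a='a] by (simp add: space_sphere_measure ennreal_divide_self less_top)
qed

lemma integrable_sphere_measure:
  fixes f :: "'a::euclidean_space \<Rightarrow> real"
  assumes f: "continuous_on (sphere 0 1) f"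
  shows "integrable sphere_measure f"
proof -
  interpret prob_space "sphere_measure :: 'a measure" by (rule prob_space_sphere_measure)
  have "bounded (f ` sphere 0 1)" by (intro compact_imp_bounded compact_continuous_image f) auto
  then obtain B where "\<forall>x\<in>sphere 0 1. norm (f x) \<le> B" by (auto simp: bounded_iff)
  then show ?thesis
    by (intro integrable_const_bound[of f B] borel_measurable_sphere_measure f AE_I2) (simp add: space_sphere_measure)
qed

lemma sphere_measure_orthogonal_invariant:
  fixes U :: "'a::euclidean_space \<Rightarrow> 'a"
  assumes U: "orthogonal_transformation U"
  shows "U \<in> measurable sphere_measure sphere_measure" "distr sphere_measure sphere_measure U = sphere_measure"
proof -
  have lin: "linear U" using U by (rule orthogonal_transformation_linear)
  have n: "norm (U x) = norm x" for x using U by (rule orthogonal_transformation_norm)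
  have Um[measurable]: "U \<in> borel_measurable borel"
    by (intro borel_measurable_continuous_onI linear_continuous_on linear_conv_bounded_linear[THEN iffD1] lin)
  have sg: "sgn (U x) = U (sgn x)" for x by (simp add: sgn_div_norm n linear_cmul[OF lin])
  have "U \<in> measurable (restrict_space borel (sphere 0 1)) (restrict_space borel (sphere 0 1))"
    by (intro measurable_restrict_space3) (auto simp: n)
  then show m: "U \<in> measurable sphere_measure sphere_measure"
    by (simp add: measurable_cong_sets[OF sets_sphere_measure sets_sphere_measure])
  show "distr sphere_measure sphere_measure U = sphere_measure"
  proof (rule measure_eqI)
    fix A :: "'a set" assume "A \<in> sets (distr sphere_measure sphere_measure U)"
    then have A: "A \<in> sets sphere_measure" by simp
    then have Ab: "A \<in> sets borel" "A \<subseteq> sphere 0 1"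
      by (auto simp: sets_sphere_measure sets_restrict_space_iff)
    have pre: "U -` A \<in> sets borel" "U -` A \<subseteq> sphere 0 1"
      using Ab measurable_sets_borel[OF Um Ab(1)] n by (auto simp: subset_eq)
    have set: "cball 0 1 \<inter> sgn -` A \<in> sets borel"
      using measurable_sets_borel[OF borel_measurable_sgn Ab(1)] by auto
    have "emeasure (distr sphere_measure sphere_measure U) A = emeasure sphere_measure (U -` A \<inter> sphere 0 1)"
      using m A by (simp add: emeasure_distr space_sphere_measure)
    also have "U -` A \<inter> sphere 0 1 = U -` A" using pre by auto
    also have "emeasure sphere_measure (U -` A) = emeasure lborel (cball 0 1 \<inter> sgn -` (U -` A)) / emeasure lborel (cball (0::'a) 1)"
      by (rule emeasure_sphere_measure[OF pre])
    also have "cball 0 1 \<inter> sgn -` (U -` A) = U -` (cball 0 1 \<inter> sgn -` A)"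
      by (auto simp: sg n)
    also have "emeasure lborel (U -` (cball 0 1 \<inter> sgn -` A)) = emeasure (distr lborel borel U) (cball 0 1 \<inter> sgn -` A)"
      using set by (subst emeasure_distr) auto
    also have "\<dots> = emeasure lborel (cball 0 1 \<inter> sgn -` A)" by (simp only: lborel_distr_orthogonal[OF U])
    also have "\<dots> / emeasure lborel (cball (0::'a) 1) = emeasure sphere_measure A"
      by (rule emeasure_sphere_measure[OF Ab, symmetric])
    finally show "emeasure (distr sphere_measure sphere_measure U) A = emeasure sphere_measure A" .
  qed simp
qed

lemma sphere_eigenspace_continuous:
  assumes "f \<in> sphere_eigenspace c"
  shows "continuous_on (sphere 0 1) f"
proof -
  have "continuous_on (- {0}) (radial_extension f)"
    using assms by (auto simp: sphere_eigenspace_def smooth_on_sphere_def dest!: spec[of _ 0])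
  then have "continuous_on (sphere 0 1) (radial_extension f)"
    by (rule continuous_on_subset) auto
  then show ?thesis
    by (rule continuous_on_eq) (simp add: radial_extension_def sgn_div_norm)
qed

lemma orthonormal_basis_mem:
  "orthonormal_basis_on_sphere n Y V \<Longrightarrow> m \<in> {1..n} \<Longrightarrow> Y m \<in> V"
  unfolding orthonormal_basis_on_sphere_def by blast

lemma orthonormal_basis_expansion:
  assumes "orthonormal_basis_on_sphere n Y V" "f \<in> V"
  shows "\<exists>c. \<forall>x\<in>sphere 0 1. f x = (\<Sum>m=1..n. c m * Y m x)"
proof -
  have "\<forall>f\<in>V. \<exists>c. \<forall>x\<in>sphere 0 1. f x = (\<Sum>m=1..n. c m * Y m x)"
    using assms(1) unfolding orthonormal_basis_on_sphere_def by (elim conjE)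
  then show ?thesis using assms(2) by (rule bspec)
qed

lemma orthonormal_basis_continuous:
  assumes "orthonormal_basis_on_sphere n Y (sphere_eigenspace c)" "m \<in> {1..n}"
  shows "continuous_on (sphere 0 1) (Y m)"
  by (rule sphere_eigenspace_continuous[OF orthonormal_basis_mem[OF assms]])

lemma orthonormal_basis_integral_product:
  fixes Y :: "nat \<Rightarrow> 'a::euclidean_space \<Rightarrow> real"
  assumes Y: "orthonormal_basis_on_sphere n Y (sphere_eigenspace c)"
  shows "(\<integral>x. (\<Sum>m=1..n. a m * Y m x) * (\<Sum>m=1..n. b m * Y m x) \<partial>sphere_measure) = (\<Sum>m=1..n. a m * b m)"
proof -
  have int: "integrable sphere_measure (\<lambda>x. Y i x * Y j x)" if "i \<in> {1..n}" "j \<in> {1..n}" for i j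
    using that by (intro integrable_sphere_measure continuous_on_mult orthonormal_basis_continuous[OF Y])
  have "(\<integral>x. (\<Sum>m=1..n. a m * Y m x) * (\<Sum>m=1..n. b m * Y m x) \<partial>sphere_measure)
    = (\<integral>x. (\<Sum>i=1..n. \<Sum>j=1..n. (a i * b j) * (Y i x * Y j x)) \<partial>sphere_measure)"
    by (simp add: sum_product mult_ac)
  also have "\<dots> = (\<Sum>i=1..n. \<Sum>j=1..n. (a i * b j) * (\<integral>x. Y i x * Y j x \<partial>sphere_measure))"
    using int by (subst Bochner_Integration.integral_sum)
      (auto intro!: sum.cong Bochner_Integration.integrable_sum simp: Bochner_Integration.integral_sum simp del: mult_cancel_left)
  also have "\<dots> = (\<Sum>i=1..n. \<Sum>j=1..n. (a i * b j) * (if i = j then 1 else 0))"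
    using Y by (intro sum.cong) (auto simp: orthonormal_basis_on_sphere_def)
  also have "\<dots> = (\<Sum>m=1..n. a m * b m)"
    by (simp add: if_distrib[of "\<lambda>x. _ * x"] cong: if_cong)
  finally show ?thesis .
qed

text \<open>Up to normalization, the left-hand side \<open>K x\<close> is the largest value of \<open>(f x)\<^sup>2\<close> over unit vectors \<open>f\<close> of the
  eigenspace, attained by \<open>f = \<Sum>m. Y m x * Y m\<close>. Composing the maximizer at \<open>x\<close> with a reflection \<open>U\<close>
  produces a competitor of the same norm at \<open>U x\<close>, so \<open>K x \<le> K (U x)\<close>. As reflections act transitively,
  \<open>K\<close> is constant, and its integral is \<open>n\<close>.\<close>

lemma orthonormal_basis_sum_squares:
  fixes Y :: "nat \<Rightarrow> 'a::euclidean_space \<Rightarrow> real"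
  assumes Y: "orthonormal_basis_on_sphere n Y (sphere_eigenspace c)" and x: "x \<in> sphere 0 1"
  shows "(\<Sum>m=1..n. (Y m x)\<^sup>2) = real n"
proof -
  interpret prob_space "sphere_measure :: 'a measure" by (rule prob_space_sphere_measure)
  define K where "K x = (\<Sum>m=1..n. (Y m x)\<^sup>2)" for x
  have K0: "0 \<le> K x" for x by (simp add: K_def sum_nonneg)
  note cont = orthonormal_basis_continuous[OF Y]
  have le: "K x \<le> K (U x)" if x: "x \<in> sphere 0 1" and U: "orthogonal_transformation U" and UU: "\<And>z. U (U z) = z"
    for x and U :: "'a \<Rightarrow> 'a"
  proof (cases "K x = 0")
    case True
    then show ?thesis using K0 by simp
  next
    case False
    then have Kx: "0 < K x" using K0[of x] by linarith
    have n: "norm (U x) = norm x" for x using U by (rule orthogonal_transformation_norm)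
    \<comment> \<open>Expand the composition of \<open>U\<close> with the maximizer \<open>?f\<close> at \<open>x\<close> in the basis; its coefficients \<open>b\<close> have square
      sum \<open>K x\<close> by invariance of the measure.\<close>
    have "\<forall>m\<in>{1..n}. \<exists>b. \<forall>z\<in>sphere 0 1. Y m (U z) = (\<Sum>k=1..n. b k * Y k z)"
    proof
      fix m assume "m \<in> {1..n}"
      then have "(\<lambda>z. Y m (U z)) \<in> sphere_eigenspace c"
        by (intro sphere_eigenspace_orthogonal_comp[OF U, of "Y m"] orthonormal_basis_mem[OF Y])
      then show "\<exists>b. \<forall>z\<in>sphere 0 1. Y m (U z) = (\<Sum>k=1..n. b k * Y k z)"
        by (rule orthonormal_basis_expansion[OF Y])
    qed
    then obtain C where C: "\<And>m z. m \<in> {1..n} \<Longrightarrow> z \<in> sphere 0 1 \<Longrightarrow> Y m (U z) = (\<Sum>k=1..n. C m k * Y k z)"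
      by metis
    define b where "b k = (\<Sum>m=1..n. Y m x * C m k)" for k
    have exp: "(\<Sum>m=1..n. Y m x * Y m (U z)) = (\<Sum>k=1..n. b k * Y k z)" if "z \<in> sphere 0 1" for z
    proof -
      have "(\<Sum>m=1..n. Y m x * Y m (U z)) = (\<Sum>m=1..n. \<Sum>k=1..n. Y m x * C m k * Y k z)"
        using C that by (simp add: sum_distrib_left mult.assoc)
      also have "\<dots> = (\<Sum>k=1..n. \<Sum>m=1..n. Y m x * C m k * Y k z)" by (rule sum.swap)
      finally show ?thesis by (simp add: b_def sum_distrib_right)
    qed
    let ?f = "\<lambda>z. \<Sum>m=1..n. Y m x * Y m z"
    have fc: "continuous_on (sphere 0 1) (\<lambda>z. ?f z * ?f z)" by (intro continuous_intros cont)
    have "(\<Sum>k=1..n. (b k)\<^sup>2) = (\<integral>z. (\<Sum>k=1..n. b k * Y k z) * (\<Sum>k=1..n. b k * Y k z) \<partial>sphere_measure)"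
      unfolding orthonormal_basis_integral_product[OF Y] power2_eq_square ..
    also have "\<dots> = (\<integral>z. ?f (U z) * ?f (U z) \<partial>sphere_measure)"
      using exp by (intro Bochner_Integration.integral_cong) (auto simp: space_sphere_measure)
    also have "\<dots> = (\<integral>z. ?f z * ?f z \<partial>distr sphere_measure sphere_measure U)"
      by (rule integral_distr[symmetric]) (use sphere_measure_orthogonal_invariant[OF U] borel_measurable_sphere_measure[OF fc] in auto)
    also have "\<dots> = K x"
      unfolding sphere_measure_orthogonal_invariant(2)[OF U] orthonormal_basis_integral_product[OF Y] K_def power2_eq_square ..
    finally have b: "(\<Sum>k=1..n. (b k)\<^sup>2) = K x" .
    have "K x = (\<Sum>m=1..n. Y m x * Y m (U (U x)))" by (simp add: UU K_def power2_eq_square)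
    also have "\<dots> = (\<Sum>k=1..n. b k * Y k (U x))" using x by (intro exp) (simp add: n)
    finally have "(K x)\<^sup>2 = (\<Sum>k=1..n. b k * Y k (U x))\<^sup>2" by simp
    also have "\<dots> \<le> (\<Sum>k=1..n. (b k)\<^sup>2) * (\<Sum>k=1..n. (Y k (U x))\<^sup>2)" by (rule Cauchy_Schwarz_ineq_sum)
    also have "\<dots> = K x * K (U x)" by (simp only: b K_def)
    finally show ?thesis using Kx by (simp add: power2_eq_square)
  qed
  have const: "K y = K x" if y: "y \<in> sphere 0 1" for y
  proof -
    obtain U where U: "orthogonal_transformation U" "U x = y" "\<And>z. U (U z) = z"
      using reflection_swapping_unit_vectors[of x y] x y by auto
    have "U y = x" using U by metis
    then show ?thesis using le[OF x U(1,3)] le[OF y U(1,3)] U(2) by simp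
  qed
  have "(\<integral>y. K y \<partial>sphere_measure) = (\<integral>y. K x \<partial>(sphere_measure :: 'a measure))"
    by (rule Bochner_Integration.integral_cong[OF refl]) (simp add: const space_sphere_measure)
  also have "\<dots> = K x" by (simp add: prob_space)
  also have "(\<integral>y. K y \<partial>sphere_measure) = (\<Sum>m=1..n. \<integral>y. Y m y * Y m y \<partial>sphere_measure)"
    unfolding K_def power2_eq_square
    by (intro Bochner_Integration.integral_sum integrable_sphere_measure continuous_on_mult cont)
  also have "\<dots> = real n" using Y by (simp add: orthonormal_basis_on_sphere_def)
  finally show ?thesis by (simp add: K_def)
qed

section \<open>Prekopa-Leindler inequality and Gaussian concentration\<close>

text \<open>Choose \<open>a\<close> nearly maximal in \<open>A\<close> and \<open>b\<close> nearly minimal in \<open>B\<close>. The translates \<open>A + b\<close> and \<open>a + B\<close> both lie in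
  \<open>C\<close>, and they overlap in an interval of length at most \<open>e\<close>.\<close>

lemma one_dim_brunn_minkowski_bounded:
  fixes A B C :: "real set"
  assumes [measurable]: "A \<in> sets borel" "B \<in> sets borel" "C \<in> sets borel"
    and ne: "A \<noteq> {}" "B \<noteq> {}" and bd: "A \<subseteq> {-k..k}" "B \<subseteq> {-k..k}"
    and sub: "\<And>a b. a \<in> A \<Longrightarrow> b \<in> B \<Longrightarrow> a + b \<in> C"
  shows "emeasure lborel A + emeasure lborel B \<le> emeasure lborel C"
proof (rule ennreal_le_epsilon)
  fix e :: real assume e: "0 < e"
  have bA: "bdd_above A" and bB: "bdd_below B" using bd by (auto intro: bdd_above_mono bdd_below_mono)
  obtain a where a: "a \<in> A" "Sup A - e/2 < a"
    using less_cSup_iff[OF ne(1) bA, of "Sup A - e/2"] e by auto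
  obtain b where b: "b \<in> B" "b < Inf B + e/2"
    using cInf_less_iff[OF ne(2) bB, of "Inf B + e/2"] e by auto
  let ?A = "(\<lambda>x. x - b) -` A" and ?B = "(\<lambda>x. x - a) -` B"
  have shift: "emeasure lborel ((\<lambda>x. x - c) -` S) = emeasure lborel S" if [measurable]: "S \<in> sets borel" for c :: real and S
  proof -
    have "emeasure lborel S = emeasure (distr lborel borel (\<lambda>x. - c + x)) S"
      by (simp only: lborel_distr_plus)
    also have "\<dots> = emeasure lborel ((\<lambda>x. x - c) -` S)"
      by (subst emeasure_distr) (auto simp: vimage_def)
    finally show ?thesis by simp
  qed
  have m[measurable]: "?A \<in> sets lborel" "?B \<in> sets lborel"
    by (auto intro!: measurable_sets_borel[of _ borel])
  have "?A \<inter> ?B \<subseteq> {a + Inf B .. Sup A + b}"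
    using cInf_lower[OF _ bB] cSup_upper[OF _ bA] by force
  then have "emeasure lborel (?A \<inter> ?B) \<le> emeasure lborel {a + Inf B .. Sup A + b}"
    by (intro emeasure_mono) auto
  also have "\<dots> \<le> ennreal e" using a b e by (auto simp: emeasure_lborel_Icc_eq intro!: ennreal_leI)
  finally have i: "emeasure lborel (?A \<inter> ?B) \<le> ennreal e" .
  have "?A \<union> ?B \<subseteq> C"
  proof
    fix x assume "x \<in> ?A \<union> ?B"
    then show "x \<in> C" using sub[of "x - b" b] sub[of a "x - a"] a b by auto
  qed
  then have u: "emeasure lborel (?A \<union> ?B) \<le> emeasure lborel C"
    by (intro emeasure_mono) auto
  have "emeasure lborel A + emeasure lborel B = emeasure lborel ?A + emeasure lborel ?B"
    by (simp add: shift)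
  also have "\<dots> = emeasure lborel (?A \<union> ?B) + emeasure lborel (?A \<inter> ?B)"
    by (rule emeasure_Un_Int) (use m in auto)
  also have "\<dots> \<le> emeasure lborel C + ennreal e" using u i by (rule add_mono)
  finally show "emeasure lborel A + emeasure lborel B \<le> emeasure lborel C + ennreal e" .
qed

lemma one_dim_brunn_minkowski:
  fixes A B C :: "real set"
  assumes [measurable]: "A \<in> sets borel" "B \<in> sets borel" "C \<in> sets borel"
    and ne: "A \<noteq> {}" "B \<noteq> {}"
    and sub: "\<And>a b. a \<in> A \<Longrightarrow> b \<in> B \<Longrightarrow> a + b \<in> C"
  shows "emeasure lborel A + emeasure lborel B \<le> emeasure lborel C"
proof -
  obtain a b where ab: "a \<in> A" "b \<in> B" using ne by auto
  obtain k0 :: nat where k0: "max \<bar>a\<bar> \<bar>b\<bar> \<le> real k0" using real_arch_simple by blast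
  define I where "I j = {- real (k0 + j) .. real (k0 + j)}" for j
  have [measurable]: "I j \<in> sets borel" for j by (simp add: I_def)
  have UI: "(\<Union>j. S \<inter> I j) = S" for S
  proof -
    have "\<exists>j. x \<in> I j" for x
    proof -
      obtain j :: nat where "\<bar>x\<bar> \<le> real j" using real_arch_simple by blast
      then show ?thesis by (auto simp: I_def intro!: exI[of _ j])
    qed
    then show ?thesis by auto
  qed
  have inc: "incseq (\<lambda>j. S \<inter> I j)" for S by (auto simp: incseq_def I_def)
  have lim: "(\<lambda>j. emeasure lborel (S \<inter> I j)) \<longlonglongrightarrow> emeasure lborel S" if "S \<in> sets borel" for S
  proof -
    have "range (\<lambda>j. S \<inter> I j) \<subseteq> sets lborel" using that by auto
    from Lim_emeasure_incseq[OF this inc] show ?thesis by (simp only: UI)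
  qed
  have "emeasure lborel (A \<inter> I j) + emeasure lborel (B \<inter> I j) \<le> emeasure lborel C" for j
  proof (rule one_dim_brunn_minkowski_bounded[where k="real (k0 + j)"])
    have "a \<in> A \<inter> I j" "b \<in> B \<inter> I j" using ab k0 by (auto simp: I_def)
    then show "A \<inter> I j \<noteq> {}" "B \<inter> I j \<noteq> {}" by blast+
  qed (use sub in \<open>auto simp: I_def\<close>)
  moreover have "(\<lambda>j. emeasure lborel (A \<inter> I j) + emeasure lborel (B \<inter> I j)) \<longlonglongrightarrow>
      emeasure lborel A + emeasure lborel B"
    by (intro tendsto_add lim) auto
  ultimately show ?thesis by (intro LIMSEQ_le_const2) auto
qed

lemma one_dim_brunn_minkowski_convex:
  fixes A B C :: "real set" and s :: real
  assumes [measurable]: "A \<in> sets borel" "B \<in> sets borel" "C \<in> sets borel"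
    and s: "0 < s" "s < 1" and ne: "A \<noteq> {}" "B \<noteq> {}"
    and sub: "\<And>a b. a \<in> A \<Longrightarrow> b \<in> B \<Longrightarrow> (1 - s) * a + s * b \<in> C"
  shows "ennreal (1 - s) * emeasure lborel A + ennreal s * emeasure lborel B \<le> emeasure lborel C"
proof -
  have scale: "emeasure lborel ((\<lambda>x. x / c) -` S) = ennreal c * emeasure lborel S"
    if c: "0 < c" and [measurable]: "S \<in> sets borel" for c :: real and S
  proof -
    have "emeasure lborel S = emeasure (density (distr lborel borel (\<lambda>x. x / c)) (\<lambda>_. ennreal (1/c))) S"
      using arg_cong[OF lborel_real_affine[of "1/c" 0], of "\<lambda>M. emeasure M S"] c by simp
    also have "\<dots> = ennreal (1/c) * emeasure lborel ((\<lambda>x. x / c) -` S)"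
      using c by (simp add: emeasure_density_const emeasure_distr)
    finally show ?thesis using c by (simp add: ennreal_mult'[symmetric] mult.assoc[symmetric])
  qed
  have "emeasure lborel ((\<lambda>x. x / (1 - s)) -` A) + emeasure lborel ((\<lambda>x. x / s) -` B) \<le> emeasure lborel C"
  proof (rule one_dim_brunn_minkowski)
    show "(\<lambda>x. x / (1 - s)) -` A \<noteq> {}"
    proof -
      obtain a where "a \<in> A" using ne by auto
      then have "(1 - s) * a \<in> (\<lambda>x. x / (1 - s)) -` A" using s by auto
      then show ?thesis by blast
    qed
    show "(\<lambda>x. x / s) -` B \<noteq> {}"
    proof -
      obtain a where "a \<in> B" using ne by auto
      then have "s * a \<in> (\<lambda>x. x / s) -` B" using s by auto
      then show ?thesis by blast
    qed
    show "a + b \<in> C" if "a \<in> (\<lambda>x. x / (1 - s)) -` A" "b \<in> (\<lambda>x. x / s) -` B" for a b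
      using sub[of "a / (1 - s)" "b / s"] that s by simp
  qed (auto intro!: measurable_sets_borel[of _ borel])
  then show ?thesis using s by (simp add: scale)
qed

lemma nn_integral_layer_cake:
  fixes f :: "real \<Rightarrow> real"
  assumes [measurable]: "f \<in> borel_measurable borel" and "\<And>x. 0 \<le> f x"
  shows "(\<integral>\<^sup>+x. ennreal (f x) \<partial>lborel) = (\<integral>\<^sup>+t. indicator {0..} t * emeasure lborel {x. t < f x} \<partial>lborel)"
proof -
  have "(\<integral>\<^sup>+x. ennreal (f x) \<partial>lborel) = (\<integral>\<^sup>+x. \<integral>\<^sup>+t. indicator {0..<f x} t \<partial>lborel \<partial>lborel)"
    using assms by simp
  also have "\<dots> = (\<integral>\<^sup>+x. \<integral>\<^sup>+t. indicator {p. 0 \<le> snd p \<and> snd p < f (fst p)} (x, t) \<partial>lborel \<partial>lborel)"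
    by (intro nn_integral_cong) (auto simp: indicator_def)
  also have "\<dots> = (\<integral>\<^sup>+t. \<integral>\<^sup>+x. indicator {p. 0 \<le> snd p \<and> snd p < f (fst p)} (x, t) \<partial>lborel \<partial>lborel)"
    by (rule lborel_pair.Fubini'[symmetric]) measurable
  also have "\<dots> = (\<integral>\<^sup>+t. indicator {0..} t * emeasure lborel {x. t < f x} \<partial>lborel)"
  proof (intro nn_integral_cong)
    fix t
    have "(\<integral>\<^sup>+x. indicator {p. 0 \<le> snd p \<and> snd p < f (fst p)} (x, t) \<partial>lborel) =
       (\<integral>\<^sup>+x. indicator {0..} t * indicator {x. t < f x} x \<partial>lborel)"
      by (intro nn_integral_cong) (auto simp: indicator_def)
    also have "\<dots> = indicator {0..} t * emeasure lborel {x. t < f x}"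
      by (subst nn_integral_cmult) auto
    finally show "(\<integral>\<^sup>+x. indicator {p. 0 \<le> snd p \<and> snd p < f (fst p)} (x, t) \<partial>lborel) = \<dots>" .
  qed
  finally show ?thesis .
qed

text \<open>The suprema of \<open>f\<close> and \<open>g\<close> are both \<open>1\<close>, so for every \<open>t\<close> in \<open>{0..<1}\<close> the level sets \<open>{f > t}\<close> and
  \<open>{g > t}\<close> are nonempty. Their convex combination lies in \<open>{h > t}\<close>, and the claim follows by integrating
  the Brunn-Minkowski inequality for the level sets over \<open>t\<close>.\<close>

lemma prekopa_leindler_real_normalized:
  fixes f g h :: "real \<Rightarrow> real" and s :: real
  assumes [measurable]: "f \<in> borel_measurable borel" "g \<in> borel_measurable borel" "h \<in> borel_measurable borel"
    and s: "0 < s" "s < 1"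
    and nonneg: "\<And>x. 0 \<le> f x" "\<And>x. 0 \<le> g x" "\<And>x. 0 \<le> h x"
    and le1: "\<And>x. f x \<le> 1" "\<And>x. g x \<le> 1"
    and sup1: "\<And>t. t < 1 \<Longrightarrow> \<exists>x. t < f x" "\<And>t. t < 1 \<Longrightarrow> \<exists>x. t < g x"
    and le: "\<And>x y. f x powr (1 - s) * g y powr s \<le> h ((1 - s) * x + s * y)"
  shows "ennreal (1 - s) * (\<integral>\<^sup>+x. ennreal (f x) \<partial>lborel) + ennreal s * (\<integral>\<^sup>+x. ennreal (g x) \<partial>lborel)
    \<le> (\<integral>\<^sup>+x. ennreal (h x) \<partial>lborel)"
proof -
  have [measurable]: "(\<lambda>t. emeasure lborel {x. t < k x}) \<in> borel_measurable borel" 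
    if [measurable]: "k \<in> borel_measurable borel" for k :: "real \<Rightarrow> real"
  proof -
    have "(\<lambda>t. emeasure lborel (Pair t -` {p. fst p < k (snd p)})) \<in> borel_measurable borel"
    proof (rule lborel.measurable_emeasure_Pair)
      have "{p \<in> space (borel \<Otimes>\<^sub>M lborel). fst p < k (snd p)} \<in> sets (borel \<Otimes>\<^sub>M lborel)"
        by measurable
      then show "{p. fst p < k (snd p)} \<in> sets (borel \<Otimes>\<^sub>M lborel)"
        by (simp add: space_pair_measure)
    qed
    then show ?thesis by (simp add: vimage_def)
  qed
  have "ennreal (1 - s) * (\<integral>\<^sup>+x. ennreal (f x) \<partial>lborel) + ennreal s * (\<integral>\<^sup>+x. ennreal (g x) \<partial>lborel)
    = (\<integral>\<^sup>+t. ennreal (1 - s) * (indicator {0..} t * emeasure lborel {x. t < f x}) + 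
        ennreal s * (indicator {0..} t * emeasure lborel {x. t < g x}) \<partial>lborel)"
    using nonneg by (simp add: nn_integral_layer_cake nn_integral_cmult nn_integral_add)
  also have "\<dots> \<le> (\<integral>\<^sup>+t. indicator {0..} t * emeasure lborel {x. t < h x} \<partial>lborel)"
  proof (rule nn_integral_mono)
    fix t :: real
    show "ennreal (1 - s) * (indicator {0..} t * emeasure lborel {x. t < f x}) + 
        ennreal s * (indicator {0..} t * emeasure lborel {x. t < g x}) \<le> indicator {0..} t * emeasure lborel {x. t < h x}"
    proof (cases "0 \<le> t \<and> t < 1")
      case True
      have "(1 - s) * a + s * b \<in> {x. t < h x}" if "a \<in> {x. t < f x}" "b \<in> {x. t < g x}" for a b
      proof -
        have "t = t powr (1 - s) * t powr s" using True by (simp add: powr_add[symmetric])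
        also have "\<dots> < f a powr (1 - s) * g b powr s"
          using that True s by (intro mult_strict_mono powr_less_mono2) auto
        finally show ?thesis using le[of a b] by simp
      qed
      then show ?thesis
        using True sup1 s
        by (simp) (intro one_dim_brunn_minkowski_convex, auto)
    next
      case False
      then consider "t < 0" | "1 \<le> t" by linarith
      then show ?thesis
      proof cases
        case 2
        then have "{x. t < f x} = {}" "{x. t < g x} = {}" using le1 by (auto simp: not_less intro: order_trans)
        then show ?thesis by simp
      qed simp
    qed
  qed
  also have "\<dots> = (\<integral>\<^sup>+x. ennreal (h x) \<partial>lborel)"
    using nonneg by (simp add: nn_integral_layer_cake)
  finally show ?thesis .
qed

lemma weighted_am_gm:
  fixes a b s :: real
  assumes "0 \<le> a" "0 \<le> b" "0 < s" "s < 1"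
  shows "a powr (1 - s) * b powr s \<le> (1 - s) * a + s * b"
proof (cases "a = 0 \<or> b = 0")
  case True
  then show ?thesis using assms by auto
next
  case False
  then show ?thesis using assms by (intro Youngs_inequality_0) auto
qed

lemma prekopa_leindler_real:
  fixes f g h :: "real \<Rightarrow> real" and s :: real
  assumes int: "integrable lborel f" "integrable lborel g" "integrable lborel h"
    and s: "0 < s" "s < 1"
    and nonneg: "\<And>x. 0 \<le> f x" "\<And>x. 0 \<le> g x" "\<And>x. 0 \<le> h x"
    and bdd: "\<And>x. f x \<le> B" "\<And>x. g x \<le> B"
    and le: "\<And>x y. f x powr (1 - s) * g y powr s \<le> h ((1 - s) * x + s * y)"
  shows "(\<integral>x. f x \<partial>lborel) powr (1 - s) * (\<integral>x. g x \<partial>lborel) powr s \<le> (\<integral>x. h x \<partial>lborel)"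
proof -
  have [measurable]: "f \<in> borel_measurable borel" "g \<in> borel_measurable borel" "h \<in> borel_measurable borel"
    using int by auto
  define a where "a = (SUP x. f x)"
  define b where "b = (SUP x. g x)"
  have bd: "bdd_above (range f)" "bdd_above (range g)" using bdd by (auto intro!: bdd_aboveI)
  have fa: "f x \<le> a" and gb: "g x \<le> b" for x
    using bd by (auto simp: a_def b_def intro!: cSUP_upper)
  have a0: "0 \<le> a" and b0: "0 \<le> b" using order_trans[OF nonneg(1) fa] order_trans[OF nonneg(2) gb] by auto
  have h0: "0 \<le> (\<integral>x. h x \<partial>lborel)" using nonneg by simp
  \<comment> \<open>Dividing by the suprema \<open>a\<close> and \<open>b\<close> reduces to the normalized case, where the arithmetic mean
    that comes out dominates the geometric mean.\<close>
  show ?thesis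
  proof (cases "a = 0 \<or> b = 0")
    case True
    then have "(\<forall>x. f x = 0) \<or> (\<forall>x. g x = 0)"
      using fa gb nonneg by (metis antisym)
    then show ?thesis using h0 s by auto
  next
    case False
    then have ab: "0 < a" "0 < b" using a0 b0 by auto
    define c where "c = a powr (1 - s) * b powr s"
    have c: "0 < c" using ab by (simp add: c_def)
    have "ennreal (1 - s) * (\<integral>\<^sup>+x. ennreal (f x / a) \<partial>lborel) + ennreal s * (\<integral>\<^sup>+x. ennreal (g x / b) \<partial>lborel)
        \<le> (\<integral>\<^sup>+x. ennreal (h x / c) \<partial>lborel)"
    proof (rule prekopa_leindler_real_normalized)
      show "\<exists>x. t < f x / a" if "t < 1" for t
        using less_cSUP_iff[of UNIV f "t * a"] bd that ab by (auto simp: a_def[symmetric] pos_less_divide_eq)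
      show "\<exists>x. t < g x / b" if "t < 1" for t
        using less_cSUP_iff[of UNIV g "t * b"] bd that ab by (auto simp: b_def[symmetric] pos_less_divide_eq)
      show "(f x / a) powr (1 - s) * (g y / b) powr s \<le> h ((1 - s) * x + s * y) / c" for x y
        using le[of x y] c ab nonneg by (simp add: powr_divide c_def divide_right_mono)
    qed (use s nonneg ab c fa gb in auto)
    also have "(\<integral>\<^sup>+x. ennreal (f x / a) \<partial>lborel) = ennreal ((\<integral>x. f x \<partial>lborel) / a)"
      using int nonneg ab by (subst nn_integral_eq_integral) auto
    also have "(\<integral>\<^sup>+x. ennreal (g x / b) \<partial>lborel) = ennreal ((\<integral>x. g x \<partial>lborel) / b)"
      using int nonneg ab by (subst nn_integral_eq_integral) auto
    also have "(\<integral>\<^sup>+x. ennreal (h x / c) \<partial>lborel) = ennreal ((\<integral>x. h x \<partial>lborel) / c)"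
      using int nonneg c by (subst nn_integral_eq_integral) auto
    finally have *: "(1 - s) * ((\<integral>x. f x \<partial>lborel) / a) + s * ((\<integral>x. g x \<partial>lborel) / b) \<le> (\<integral>x. h x \<partial>lborel) / c"
      using s ab c h0 nonneg
      by (simp add: ennreal_mult'[symmetric] ennreal_plus[symmetric] del: ennreal_plus)
    have "((\<integral>x. f x \<partial>lborel) / a) powr (1 - s) * ((\<integral>x. g x \<partial>lborel) / b) powr s \<le> (\<integral>x. h x \<partial>lborel) / c"
      using * weighted_am_gm[of "(\<integral>x. f x \<partial>lborel) / a" "(\<integral>x. g x \<partial>lborel) / b" s] s ab nonneg by auto
    then show ?thesis
      using c ab nonneg by (simp add: powr_divide c_def[symmetric] divide_le_cancel)
  qed
qed


text \<open>The Gaussian density fails to be log-affine exactly by the factor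
  \<open>exp (s * (1 - s) * (x - y)\<^sup>2 / (2 * \<sigma>\<^sup>2))\<close>. Multiplying the three functions by the density therefore turns
  the hypothesis into that of the inequality for Lebesgue measure.\<close>

lemma prekopa_leindler_gaussian_real:
  fixes f g h :: "real \<Rightarrow> real" and s \<sigma> B :: real
  assumes [measurable]: "f \<in> borel_measurable borel" "g \<in> borel_measurable borel" "h \<in> borel_measurable borel"
    and s: "0 < s" "s < 1" and \<sigma>: "0 < \<sigma>"
    and nonneg: "\<And>x. 0 \<le> f x" "\<And>x. 0 \<le> g x" "\<And>x. 0 \<le> h x"
    and bdd: "\<And>x. f x \<le> B" "\<And>x. g x \<le> B" "\<And>x. h x \<le> B"
    and le: "\<And>x y. f x powr (1 - s) * g y powr s \<le>
      h ((1 - s) * x + s * y) * exp (s * (1 - s) * (x - y)\<^sup>2 / (2 * \<sigma>\<^sup>2))"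
  defines "G \<equiv> density lborel (normal_density 0 \<sigma>)"
  shows "(\<integral>x. f x \<partial>G) powr (1 - s) * (\<integral>x. g x \<partial>G) powr s \<le> (\<integral>x. h x \<partial>G)"
proof -
  let ?n = "normal_density 0 \<sigma>"
  have int: "integrable lborel (\<lambda>x. ?n x * k x)" 
    if [measurable]: "k \<in> borel_measurable borel" and "\<And>x. 0 \<le> k x" "\<And>x. k x \<le> B" for k
    by (rule Bochner_Integration.integrable_bound[of _ "\<lambda>x. B * ?n x"])
       (use that \<sigma> in \<open>auto intro!: AE_I2 mult_right_mono simp: abs_mult mult.commute intro: order_trans[OF _ abs_ge_self]\<close>)
  have eq: "(\<integral>x. k x \<partial>G) = (\<integral>x. ?n x * k x \<partial>lborel)" if "k \<in> borel_measurable borel" for k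
    unfolding G_def using that by (subst integral_real_density) auto
  define D where "D = 1 / sqrt (2 * pi * \<sigma>\<^sup>2)"
  have D: "0 < D" using \<sigma> by (simp add: D_def)
  have n: "?n x = D * exp (- x\<^sup>2 / (2 * \<sigma>\<^sup>2))" for x by (simp add: normal_density_def D_def)
  have nn: "?n x powr (1 - s) * ?n y powr s * exp (s * (1 - s) * (x - y)\<^sup>2 / (2 * \<sigma>\<^sup>2)) = ?n ((1 - s) * x + s * y)" for x y
  proof -
    have "(1 - s) * (- x\<^sup>2 / (2 * \<sigma>\<^sup>2)) + s * (- y\<^sup>2 / (2 * \<sigma>\<^sup>2)) + s * (1 - s) * (x - y)\<^sup>2 / (2 * \<sigma>\<^sup>2)
      = - ((1 - s) * x + s * y)\<^sup>2 / (2 * \<sigma>\<^sup>2)"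
      using \<sigma> by (simp add: field_simps power2_eq_square)
    moreover have "D powr (1 - s) * D powr s = D" using D by (simp add: powr_add[symmetric])
    ultimately have "(D powr (1 - s) * D powr s) * exp ((1 - s) * (- x\<^sup>2 / (2 * \<sigma>\<^sup>2)) + s * (- y\<^sup>2 / (2 * \<sigma>\<^sup>2))
        + s * (1 - s) * (x - y)\<^sup>2 / (2 * \<sigma>\<^sup>2)) = ?n ((1 - s) * x + s * y)"
      by (simp only: n)
    then show ?thesis
      unfolding n exp_add using D by (simp add: powr_mult exp_powr_real mult_ac del: mult_minus_right)
  qed
  have "(\<integral>x. ?n x * f x \<partial>lborel) powr (1 - s) * (\<integral>x. ?n x * g x \<partial>lborel) powr s \<le> (\<integral>x. ?n x * h x \<partial>lborel)"
  proof (rule prekopa_leindler_real[where B="D * B"])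
    fix x y
    have "(?n x * f x) powr (1 - s) * (?n y * g y) powr s =
       (?n x powr (1 - s) * ?n y powr s) * (f x powr (1 - s) * g y powr s)"
      using nonneg by (simp add: powr_mult)
    also have "\<dots> \<le> (?n x powr (1 - s) * ?n y powr s) * (h ((1 - s) * x + s * y) * exp (s * (1 - s) * (x - y)\<^sup>2 / (2 * \<sigma>\<^sup>2)))"
      by (intro mult_left_mono le) auto
    also have "\<dots> = ?n ((1 - s) * x + s * y) * h ((1 - s) * x + s * y)"
      unfolding nn[symmetric] by simp
    finally show "(?n x * f x) powr (1 - s) * (?n y * g y) powr s \<le> \<dots>" .
    have nD: "?n x \<le> D" for x using D by (simp add: n mult_left_le)
    show "?n x * f x \<le> D * B" "?n x * g x \<le> D * B"
      using nonneg bdd D nD by (auto intro!: mult_mono order_trans[OF nonneg(1) bdd(1)])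
  qed (use int nonneg bdd s in auto)
  then show ?thesis by (simp add: eq)
qed

definition gaussian_product :: "'i set \<Rightarrow> real \<Rightarrow> ('i \<Rightarrow> real) measure" where
  "gaussian_product I \<sigma> = (\<Pi>\<^sub>M i\<in>I. density lborel (normal_density 0 \<sigma>))"

lemma prob_space_normal: "0 < \<sigma> \<Longrightarrow> prob_space (density lborel (normal_density \<mu> \<sigma>))"
  by (rule prob_space_normal_density)

lemma sets_gaussian_product [measurable_cong]: "sets (gaussian_product I \<sigma>) = sets (\<Pi>\<^sub>M i\<in>I. borel)"
  unfolding gaussian_product_def by (intro sets_PiM_cong) auto

lemma space_gaussian_product: "space (gaussian_product I \<sigma>) = I \<rightarrow>\<^sub>E UNIV"
  by (simp add: gaussian_product_def space_PiM)

lemma prob_space_gaussian_product: "0 < \<sigma> \<Longrightarrow> prob_space (gaussian_product I \<sigma>)"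
  unfolding gaussian_product_def by (intro prob_space_PiM prob_space_normal)

text \<open>Induction on the coordinates. For fixed values of the old coordinates, the one-dimensional
  inequality in the new coordinate shows that the partial integrals again satisfy the hypothesis; the
  quadratic cost is additive over coordinates, so the part belonging to the old coordinates is just a
  constant factor of \<open>h\<close>.\<close>

lemma prekopa_leindler_gaussian:
  fixes f g h :: "('i \<Rightarrow> real) \<Rightarrow> real" and s \<sigma> B :: real
  assumes "finite I" and s: "0 < s" "s < 1" and \<sigma>: "0 < \<sigma>"
    and "f \<in> borel_measurable (\<Pi>\<^sub>M i\<in>I. borel)" "g \<in> borel_measurable (\<Pi>\<^sub>M i\<in>I. borel)"
      "h \<in> borel_measurable (\<Pi>\<^sub>M i\<in>I. borel)"
    and "\<And>x. x \<in> I \<rightarrow>\<^sub>E UNIV \<Longrightarrow> 0 \<le> f x \<and> f x \<le> B"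
    and "\<And>x. x \<in> I \<rightarrow>\<^sub>E UNIV \<Longrightarrow> 0 \<le> g x \<and> g x \<le> B"
    and "\<And>x. x \<in> I \<rightarrow>\<^sub>E UNIV \<Longrightarrow> 0 \<le> h x \<and> h x \<le> B"
    and "\<And>x y. x \<in> I \<rightarrow>\<^sub>E UNIV \<Longrightarrow> y \<in> I \<rightarrow>\<^sub>E UNIV \<Longrightarrow> f x powr (1 - s) * g y powr s \<le>
      h (\<lambda>i\<in>I. (1 - s) * x i + s * y i) * exp (s * (1 - s) * (\<Sum>i\<in>I. (x i - y i)\<^sup>2) / (2 * \<sigma>\<^sup>2))"
  shows "(\<integral>x. f x \<partial>gaussian_product I \<sigma>) powr (1 - s) * (\<integral>x. g x \<partial>gaussian_product I \<sigma>) powr s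
    \<le> (\<integral>x. h x \<partial>gaussian_product I \<sigma>)"
  using assms(1,5-)
proof (induction I arbitrary: f g h rule: finite_induct)
  case empty
  have "(\<integral>x. k x \<partial>gaussian_product {} \<sigma>) = k (\<lambda>_. undefined)" for k :: "('i \<Rightarrow> real) \<Rightarrow> real"
    by (simp add: gaussian_product_def PiM_empty lebesgue_integral_count_space_finite)
  then show ?case using empty(7)[of "\<lambda>_. undefined" "\<lambda>_. undefined"] by (simp add: restrict_def)
next
  case (insert i I)
  note [measurable] = insert.prems(1-3)
  let ?G = "density lborel (normal_density 0 \<sigma>)"
  interpret G: prob_space ?G using \<sigma> by (rule prob_space_normal)
  interpret product_sigma_finite "\<lambda>_::'i. ?G" by standard
  interpret P: prob_space "gaussian_product (insert i I) \<sigma>" by (rule prob_space_gaussian_product[OF \<sigma>])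
  have upd[simp]: "x(i := t) \<in> insert i I \<rightarrow>\<^sub>E UNIV" if "x \<in> I \<rightarrow>\<^sub>E UNIV" for x :: "'i \<Rightarrow> real" and t
    using that by (auto simp: PiE_iff extensional_def)
  let ?in = "\<lambda>k x. \<integral>t. k (x(i := t)) \<partial>?G"
  have fold: "(\<integral>x. k x \<partial>gaussian_product (insert i I) \<sigma>) = (\<integral>x. ?in k x \<partial>gaussian_product I \<sigma>)"
    if [measurable]: "k \<in> borel_measurable (\<Pi>\<^sub>M i\<in>insert i I. borel)"
      and b: "\<And>x. x \<in> insert i I \<rightarrow>\<^sub>E UNIV \<Longrightarrow> 0 \<le> k x \<and> k x \<le> B" for k :: "('i \<Rightarrow> real) \<Rightarrow> real"
  proof -
    have "integrable (gaussian_product (insert i I) \<sigma>) k"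
    proof (rule P.integrable_const_bound[where B=B])
      show "AE x in gaussian_product (insert i I) \<sigma>. norm (k x) \<le> B"
        using b by (auto intro!: AE_I2 simp: space_gaussian_product)
    qed measurable
    then show ?thesis using insert.hyps
      unfolding gaussian_product_def by (subst product_integral_insert) auto
  qed
  have slice: "(\<lambda>t. k (x(i := t))) \<in> borel_measurable borel"
    if [measurable]: "k \<in> borel_measurable (\<Pi>\<^sub>M i\<in>insert i I. borel)" and x: "x \<in> I \<rightarrow>\<^sub>E UNIV"
    for k :: "('i \<Rightarrow> real) \<Rightarrow> real" and x
  proof -
    have "(\<lambda>t. x(i := t)) \<in> measurable borel (\<Pi>\<^sub>M i\<in>insert i I. borel)"
      using x insert.hyps by (intro measurable_component_update) (auto simp: space_PiM)
    from measurable_compose[OF this that(1)] show ?thesis .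
  qed
  have inm: "?in k \<in> borel_measurable (\<Pi>\<^sub>M i\<in>I. borel)"
    if [measurable]: "k \<in> borel_measurable (\<Pi>\<^sub>M i\<in>insert i I. borel)" for k :: "('i \<Rightarrow> real) \<Rightarrow> real"
  proof -
    have "(\<lambda>p. (fst p)(i := snd p)) \<in> measurable ((\<Pi>\<^sub>M i\<in>I. borel) \<Otimes>\<^sub>M ?G) (\<Pi>\<^sub>M i\<in>insert i I. borel :: real measure)"
      by (rule measurable_fun_upd[where J=I]) auto
    from measurable_compose[OF this that] show ?thesis
      by (intro G.borel_measurable_lebesgue_integral) (simp add: case_prod_beta')
  qed
  have inb: "0 \<le> ?in k x \<and> ?in k x \<le> B"
    if k: "k \<in> borel_measurable (\<Pi>\<^sub>M i\<in>insert i I. borel)"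
      and b: "\<And>x. x \<in> insert i I \<rightarrow>\<^sub>E UNIV \<Longrightarrow> 0 \<le> k x \<and> k x \<le> B" and x: "x \<in> I \<rightarrow>\<^sub>E UNIV"
    for k :: "('i \<Rightarrow> real) \<Rightarrow> real" and x
  proof -
    have [measurable]: "(\<lambda>t. k (x(i := t))) \<in> borel_measurable borel" using slice[OF k x] .
    have "integrable ?G (\<lambda>t. k (x(i := t)))"
      by (rule G.integrable_const_bound[where B=B]) (use b x in \<open>auto intro!: AE_I2\<close>)
    then have "?in k x \<le> B" by (rule G.integral_le_const) (use b x in \<open>auto intro!: AE_I2\<close>)
    moreover have "0 \<le> ?in k x" using b x by (intro integral_nonneg_AE AE_I2) auto
    ultimately show ?thesis by simp
  qed
  have "(\<integral>x. ?in f x \<partial>gaussian_product I \<sigma>) powr (1 - s) * (\<integral>x. ?in g x \<partial>gaussian_product I \<sigma>) powr s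
    \<le> (\<integral>x. ?in h x \<partial>gaussian_product I \<sigma>)"
  proof (rule insert.IH)
    fix x y :: "'i \<Rightarrow> real" assume xy: "x \<in> I \<rightarrow>\<^sub>E UNIV" "y \<in> I \<rightarrow>\<^sub>E UNIV"
    let ?z = "\<lambda>i\<in>I. (1 - s) * x i + s * y i"
    let ?e = "exp (s * (1 - s) * (\<Sum>i\<in>I. (x i - y i)\<^sup>2) / (2 * \<sigma>\<^sup>2))"
    have z: "?z \<in> I \<rightarrow>\<^sub>E UNIV" by auto
    have B0: "0 \<le> B" using insert.prems(4)[OF upd[OF xy(1)]] by force
    have e1: "1 \<le> ?e" using s by (auto intro!: divide_nonneg_nonneg mult_nonneg_nonneg sum_nonneg)
    have "?in f x powr (1 - s) * ?in g y powr s \<le> (\<integral>t. h (?z(i := t)) * ?e \<partial>?G)"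
    proof (rule prekopa_leindler_gaussian_real[OF _ _ _ s \<sigma>, where B="B * ?e"])
      fix a b :: real
      have zz: "(\<lambda>j\<in>insert i I. (1 - s) * (x(i := a)) j + s * (y(i := b)) j) = ?z(i := (1 - s) * a + s * b)"
        using insert.hyps by (auto simp: fun_eq_iff)
      have ss: "(\<Sum>j\<in>insert i I. ((x(i := a)) j - (y(i := b)) j)\<^sup>2) = (a - b)\<^sup>2 + (\<Sum>i\<in>I. (x i - y i)\<^sup>2)"
        using insert.hyps by (simp, intro sum.cong) auto
      show "f (x(i := a)) powr (1 - s) * g (y(i := b)) powr s
        \<le> h (?z(i := (1 - s) * a + s * b)) * ?e * exp (s * (1 - s) * (a - b)\<^sup>2 / (2 * \<sigma>\<^sup>2))"
        using insert.prems(7)[OF upd[OF xy(1), of a] upd[OF xy(2), of b]]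
        unfolding zz ss by (simp add: distrib_left add_divide_distrib exp_add mult_ac del: fun_upd_apply)
      have *: "k \<le> B * ?e" if "k \<le> B" for k using that e1 B0
        by (smt (verit) mult_left_le mult_le_cancel_left1)
      show "f (x(i := a)) \<le> B * ?e" "g (y(i := a)) \<le> B * ?e"
        by (rule *, rule conjunct2[OF insert.prems(4)], rule upd[OF xy(1)])
           (rule *, rule conjunct2[OF insert.prems(5)], rule upd[OF xy(2)])
      show "h (?z(i := a)) * ?e \<le> B * ?e"
        by (rule mult_right_mono[OF conjunct2[OF insert.prems(6)[OF upd[OF z]]] exp_ge_zero])
      show "0 \<le> f (x(i := a))" by (rule conjunct1[OF insert.prems(4)[OF upd[OF xy(1)]]])
      show "0 \<le> g (y(i := a))" by (rule conjunct1[OF insert.prems(5)[OF upd[OF xy(2)]]])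
      show "0 \<le> h (?z(i := a)) * ?e"
        by (rule mult_nonneg_nonneg[OF conjunct1[OF insert.prems(6)[OF upd[OF z]]] exp_ge_zero])
    next
      show "(\<lambda>t. f (x(i := t))) \<in> borel_measurable borel" by (rule slice[OF insert.prems(1) xy(1)])
      show "(\<lambda>t. g (y(i := t))) \<in> borel_measurable borel" by (rule slice[OF insert.prems(2) xy(2)])
      show "(\<lambda>t. h (?z(i := t)) * ?e) \<in> borel_measurable borel"
        by (intro borel_measurable_times slice[OF insert.prems(3) z] borel_measurable_const)
    qed
    then show "?in f x powr (1 - s) * ?in g y powr s \<le> ?in h ?z * ?e" by simp
  next
    show "?in f \<in> borel_measurable (\<Pi>\<^sub>M i\<in>I. borel)" "?in g \<in> borel_measurable (\<Pi>\<^sub>M i\<in>I. borel)"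
      "?in h \<in> borel_measurable (\<Pi>\<^sub>M i\<in>I. borel)"
      by (rule inm, fact)+
    fix x :: "'i \<Rightarrow> real" assume "x \<in> I \<rightarrow>\<^sub>E UNIV"
    then show "0 \<le> ?in f x \<and> ?in f x \<le> B" "0 \<le> ?in g x \<and> ?in g x \<le> B" "0 \<le> ?in h x \<and> ?in h x \<le> B"
      using inb[OF insert.prems(1,4)] inb[OF insert.prems(2,5)] inb[OF insert.prems(3,6)] by blast+
  qed
  then show ?case
    by (simp only: fold[OF insert.prems(1,4)] fold[OF insert.prems(2,5)] fold[OF insert.prems(3,6)])
qed

text \<open>Apply the Prekopa-Leindler inequality to \<open>exp (t * F - c)\<close>, \<open>exp (- k * F)\<close> with \<open>k = t * (1 - s) / s\<close>, and the
  constant \<open>1\<close>. The exponents are balanced so that only \<open>F x - F y\<close> occurs in the hypothesis, which then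
  follows from the Lipschitz condition by completing a square. Jensen's inequality bounds the factor
  that contains \<open>- k * F\<close> from below by its value at the mean.\<close>

lemma gaussian_lipschitz_exponential_moment:
  fixes F :: "('i \<Rightarrow> real) \<Rightarrow> real"
  assumes I: "finite I" and s: "0 < s" "s < 1" and \<sigma>: "0 < \<sigma>" and t: "0 < t"
    and [measurable]: "F \<in> borel_measurable (\<Pi>\<^sub>M i\<in>I. borel)"
    and bdd: "\<And>x. x \<in> I \<rightarrow>\<^sub>E UNIV \<Longrightarrow> 0 \<le> F x \<and> F x \<le> B"
    and lip: "\<And>x y. x \<in> I \<rightarrow>\<^sub>E UNIV \<Longrightarrow> y \<in> I \<rightarrow>\<^sub>E UNIV \<Longrightarrow> F x - F y \<le> L * sqrt (\<Sum>i\<in>I. (x i - y i)\<^sup>2)"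
  shows "(\<integral>x. exp (t * F x) \<partial>gaussian_product I \<sigma>)
    \<le> exp (t * (\<integral>x. F x \<partial>gaussian_product I \<sigma>) + t\<^sup>2 * L\<^sup>2 * \<sigma>\<^sup>2 / (2 * s))"
proof -
  let ?P = "gaussian_product I \<sigma>"
  interpret P: prob_space ?P by (rule prob_space_gaussian_product[OF \<sigma>])
  define c where "c = t\<^sup>2 * L\<^sup>2 * \<sigma>\<^sup>2 / (2 * s)"
  define m where "m = (\<integral>x. F x \<partial>?P)"
  define k where "k = (1 - s) / s * t"
  have k: "0 < k" using s t by (simp add: k_def)
  have c0: "0 \<le> c" using s by (simp add: c_def)
  have Fb: "x \<in> space ?P \<Longrightarrow> 0 \<le> F x \<and> F x \<le> B" for x using bdd by (simp add: space_gaussian_product)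
  have intF: "integrable ?P F"
    by (rule P.integrable_const_bound[where B=B]) (use Fb in \<open>auto intro!: AE_I2\<close>)
  have intg: "integrable ?P (\<lambda>x. exp (- k * F x))"
    by (rule P.integrable_const_bound[where B=1]) (use Fb k in \<open>auto intro!: AE_I2\<close>)
  have pl: "(\<integral>x. exp (t * F x - c) \<partial>?P) powr (1 - s) * (\<integral>x. exp (- k * F x) \<partial>?P) powr s \<le> (\<integral>x. 1 \<partial>?P)"
  proof (rule prekopa_leindler_gaussian[OF I s \<sigma>, where B="exp (t * B) + 1"])
    fix x assume "x \<in> I \<rightarrow>\<^sub>E (UNIV :: real set)"
    note b = bdd[OF this]
    have "exp (t * F x - c) \<le> exp (t * B)" using b c0 t by (auto intro: add_increasing2 simp: mult_left_mono diff_le_eq)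
    then show "0 \<le> exp (t * F x - c) \<and> exp (t * F x - c) \<le> exp (t * B) + 1"
      by (smt (verit) exp_ge_zero)
    have "exp (- k * F x) \<le> 1" using b k by simp
    then show "0 \<le> exp (- k * F x) \<and> exp (- k * F x) \<le> exp (t * B) + 1" by (simp add: add_increasing)
    show "(0::real) \<le> 1 \<and> 1 \<le> exp (t * B) + 1" by simp
  next
    fix x y assume xy: "x \<in> I \<rightarrow>\<^sub>E (UNIV :: real set)" "y \<in> I \<rightarrow>\<^sub>E (UNIV :: real set)"
    define r where "r = sqrt (\<Sum>i\<in>I. (x i - y i)\<^sup>2)"
    have r2: "(\<Sum>i\<in>I. (x i - y i)\<^sup>2) = r\<^sup>2" by (simp add: r_def sum_nonneg)
    \<comment> \<open>Young's inequality \<open>t * L * r \<le> s * r\<^sup>2 / (2 * \<sigma>\<^sup>2) + c\<close>, which is what fixes \<open>c\<close>\<close>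
    have "0 \<le> (s * r - t * L * \<sigma>\<^sup>2)\<^sup>2 / (2 * s * \<sigma>\<^sup>2)" using s by simp
    also have "\<dots> = s * r\<^sup>2 / (2 * \<sigma>\<^sup>2) - t * L * r + c"
      using s \<sigma> by (simp add: c_def field_simps power2_eq_square)
    finally have "t * (L * r) - c \<le> s * r\<^sup>2 / (2 * \<sigma>\<^sup>2)" by simp
    moreover have "t * (F x - F y) \<le> t * (L * r)"
      using lip[OF xy] t unfolding r_def by (intro mult_left_mono) auto
    ultimately have "(1 - s) * (t * (F x - F y) - c) \<le> (1 - s) * (s * r\<^sup>2 / (2 * \<sigma>\<^sup>2))"
      using s by (intro mult_left_mono) auto
    moreover have "(1 - s) * (t * (F x - F y) - c) = (1 - s) * (t * F x - c) + s * (- k * F y)"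
      using s by (simp add: k_def field_simps)
    ultimately show "exp (t * F x - c) powr (1 - s) * exp (- k * F y) powr s \<le>
       1 * exp (s * (1 - s) * (\<Sum>i\<in>I. (x i - y i)\<^sup>2) / (2 * \<sigma>\<^sup>2))"
      by (simp add: exp_powr_real exp_add[symmetric] r2 algebra_simps)
  qed auto
  have jensen: "exp (- k * m) \<le> (\<integral>x. exp (- k * F x) \<partial>?P)"
  proof -
    have "(\<integral>x. exp (- k * m) * (1 - k * (F x - m)) \<partial>?P) \<le> (\<integral>x. exp (- k * F x) \<partial>?P)"
    proof (rule integral_mono)
      fix x
      have "exp (- k * m) * (1 - k * (F x - m)) \<le> exp (- k * m) * exp (- k * (F x - m))"
        using exp_ge_add_one_self[of "- k * (F x - m)"] by (intro mult_left_mono) auto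
      also have "\<dots> = exp (- k * F x)" by (simp add: exp_add[symmetric] algebra_simps)
      finally show "exp (- k * m) * (1 - k * (F x - m)) \<le> exp (- k * F x)" .
    qed (use intF intg in auto)
    moreover have "(\<integral>x. exp (- k * m) * (1 - k * (F x - m)) \<partial>?P) = exp (- k * m)"
      using intF by (simp add: m_def P.prob_space)
    ultimately show ?thesis by simp
  qed
  define X where "X = (\<integral>x. exp (t * F x - c) \<partial>?P)"
  have X: "0 \<le> X" by (simp add: X_def)
  have "X powr (1 - s) * exp (- k * m) powr s \<le> X powr (1 - s) * (\<integral>x. exp (- k * F x) \<partial>?P) powr s"
    using s by (intro mult_left_mono powr_mono2 jensen) auto
  also have "\<dots> \<le> 1" using pl by (simp add: X_def P.prob_space)
  also have "X powr (1 - s) * exp (- k * m) powr s = (X * exp (- t * m)) powr (1 - s)"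
    using s X by (simp add: powr_mult exp_powr_real k_def)
  finally have "(X * exp (- t * m)) powr (1 - s) \<le> 1" .
  then have "X * exp (- t * m) \<le> 1"
    using s powr_less_mono2[of "1 - s" 1 "X * exp (- t * m)"] by (auto simp: not_less[symmetric])
  then have "(\<integral>x. exp (t * F x - c) \<partial>?P) * exp (- t * m) \<le> 1" by (simp add: X_def)
  moreover have "(\<integral>x. exp (t * F x - c) \<partial>?P) = (\<integral>x. exp (t * F x) \<partial>?P) * exp (- c)"
  proof -
    have "exp (t * F x - c) = exp (t * F x) * exp (- c)" for x by (simp add: exp_add[symmetric])
    then show ?thesis by simp
  qed
  ultimately have "(\<integral>x. exp (t * F x) \<partial>?P) * exp (- c) * exp (- t * m) \<le> 1" by simp
  then have "(\<integral>x. exp (t * F x) \<partial>?P) * (exp (- c) * exp (- t * m)) * exp (t * m + c) \<le> 1 * exp (t * m + c)"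
    by (intro mult_right_mono) (auto simp: mult.assoc)
  then have "(\<integral>x. exp (t * F x) \<partial>?P) \<le> exp (t * m + c)"
    by (simp add: mult.assoc exp_add[symmetric])
  then show ?thesis by (simp add: m_def c_def)
qed

text \<open>Truncating \<open>F\<close> at \<open>m + t\<close> makes it bounded, keeps the Lipschitz constant, does not increase the mean and
  does not change the event.\<close>

lemma gaussian_lipschitz_tail:
  fixes F :: "('i \<Rightarrow> real) \<Rightarrow> real"
  assumes I: "finite I" and s: "0 < s" "s < 1" and \<sigma>: "0 < \<sigma>" and L: "0 < L" and t: "0 < t"
    and Fm [measurable]: "F \<in> borel_measurable (\<Pi>\<^sub>M i\<in>I. borel)"
    and int: "integrable (gaussian_product I \<sigma>) F"
    and nonneg: "\<And>x. x \<in> I \<rightarrow>\<^sub>E UNIV \<Longrightarrow> 0 \<le> F x"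
    and lip: "\<And>x y. x \<in> I \<rightarrow>\<^sub>E UNIV \<Longrightarrow> y \<in> I \<rightarrow>\<^sub>E UNIV \<Longrightarrow> F x - F y \<le> L * sqrt (\<Sum>i\<in>I. (x i - y i)\<^sup>2)"
    and mean: "(\<integral>x. F x \<partial>gaussian_product I \<sigma>) \<le> m"
  shows "measure (gaussian_product I \<sigma>) {x \<in> I \<rightarrow>\<^sub>E UNIV. m + t \<le> F x} \<le> exp (- (s * t\<^sup>2 / (2 * L\<^sup>2 * \<sigma>\<^sup>2)))"
proof -
  let ?P = "gaussian_product I \<sigma>"
  interpret P: prob_space ?P by (rule prob_space_gaussian_product[OF \<sigma>])
  \<comment> \<open>\<open>u\<close> minimizes the exponent \<open>- u * t + u\<^sup>2 * L\<^sup>2 * \<sigma>\<^sup>2 / (2 * s)\<close>.\<close>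
  define u where "u = s * t / (L\<^sup>2 * \<sigma>\<^sup>2)"
  have u: "0 < u" using s t L \<sigma> by (simp add: u_def)
  define E where "E x = min (F x) (m + t)" for x
  have [measurable]: "E \<in> borel_measurable (\<Pi>\<^sub>M i\<in>I. borel)" unfolding E_def by measurable
  have m0: "0 \<le> m" using nonneg mean
    by (intro order_trans[OF integral_nonneg_AE mean]) (auto intro!: AE_I2 simp: space_gaussian_product)
  have bE: "0 \<le> E x \<and> E x \<le> m + t" if "x \<in> I \<rightarrow>\<^sub>E UNIV" for x using nonneg[OF that] m0 t by (auto simp: E_def)
  have intE: "integrable ?P E"
    by (rule P.integrable_const_bound[where B="m + t"]) (use bE in \<open>auto intro!: AE_I2 simp: space_gaussian_product\<close>)
  have mE: "(\<integral>x. E x \<partial>?P) \<le> m"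
    by (rule order_trans[OF integral_mono[OF intE int] mean]) (auto simp: E_def)
  have "(\<integral>x. exp (u * E x) \<partial>?P) \<le> exp (u * (\<integral>x. E x \<partial>?P) + u\<^sup>2 * L\<^sup>2 * \<sigma>\<^sup>2 / (2 * s))"
  proof (rule gaussian_lipschitz_exponential_moment[OF I s \<sigma> u _ bE])
    fix x y assume xy: "x \<in> I \<rightarrow>\<^sub>E (UNIV::real set)" "y \<in> I \<rightarrow>\<^sub>E (UNIV::real set)"
    have "0 \<le> L * sqrt (\<Sum>i\<in>I. (x i - y i)\<^sup>2)" using L by (simp add: sum_nonneg)
    then show "E x - E y \<le> L * sqrt (\<Sum>i\<in>I. (x i - y i)\<^sup>2)" using lip[OF xy] by (auto simp: E_def)
  qed auto
  also have "\<dots> \<le> exp (u * m + u\<^sup>2 * L\<^sup>2 * \<sigma>\<^sup>2 / (2 * s))" using mE u by simp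
  finally have le: "(\<integral>x. exp (u * E x) \<partial>?P) \<le> exp (u * m + u\<^sup>2 * L\<^sup>2 * \<sigma>\<^sup>2 / (2 * s))" .
  have intx: "integrable ?P (\<lambda>x. exp (u * E x))"
    by (rule P.integrable_const_bound[where B="exp (u * (m + t))"]) (use bE u in \<open>auto intro!: AE_I2 simp: space_gaussian_product\<close>)
  have "measure ?P {x \<in> I \<rightarrow>\<^sub>E UNIV. m + t \<le> F x} \<le> P.prob {x \<in> space ?P. exp (u * (m + t)) \<le> exp (u * E x)}"
  proof (rule P.finite_measure_mono)
    show "{x \<in> I \<rightarrow>\<^sub>E UNIV. m + t \<le> F x} \<subseteq> {x \<in> space ?P. exp (u * (m + t)) \<le> exp (u * E x)}"
      using u by (auto simp: space_gaussian_product E_def)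
  qed measurable
  also have "\<dots> \<le> (\<integral>x. exp (u * E x) \<partial>?P) / exp (u * (m + t))"
    by (rule integral_Markov_inequality_measure[OF intx, where A="{}"]) (auto intro!: AE_I2)
  also have "\<dots> \<le> exp (u * m + u\<^sup>2 * L\<^sup>2 * \<sigma>\<^sup>2 / (2 * s)) / exp (u * (m + t))"
    using le by (intro divide_right_mono) auto
  also have "\<dots> = exp (- (s * t\<^sup>2 / (2 * L\<^sup>2 * \<sigma>\<^sup>2)))"
    using s L \<sigma> by (simp add: exp_diff[symmetric] u_def field_simps power2_eq_square)
  finally show ?thesis .
qed

section \<open>Gaussian vectors in polar coordinates\<close>

lemma gaussian_product_eq_density:
  assumes I: "finite I" and \<sigma>: "0 < \<sigma>"
  shows "gaussian_product I \<sigma> = density (\<Pi>\<^sub>M i\<in>I. lborel)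
    (\<lambda>x. ennreal ((2 * pi * \<sigma>\<^sup>2) powr (- real (card I) / 2) * exp (- (\<Sum>i\<in>I. (x i)\<^sup>2) / (2 * \<sigma>\<^sup>2))))"
    (is "_ = density ?L ?f")
proof -
  let ?n = "normal_density 0 \<sigma>"
  let ?G = "density lborel ?n"
  interpret G: prob_space ?G using \<sigma> by (rule prob_space_normal)
  interpret product_sigma_finite "\<lambda>_. ?G" by standard
  interpret L: product_sigma_finite "\<lambda>_. lborel :: real measure" by standard
  have f: "?f x = (\<Prod>i\<in>I. ennreal (?n (x i)))" for x
  proof -
    define D where "D = 2 * pi * \<sigma>\<^sup>2"
    have D: "0 < D" using \<sigma> by (simp add: D_def)
    have "(\<Prod>i\<in>I. ?n (x i)) = (1 / sqrt D) ^ card I * exp (\<Sum>i\<in>I. - (x i)\<^sup>2 / (2 * \<sigma>\<^sup>2))"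
      by (simp add: normal_density_def D_def prod.distrib exp_sum[OF I] power_one_over del: real_sqrt_mult)
         (simp add: prod_dividef prod.distrib divide_simps)
    also have "(1 / sqrt D) ^ card I = D powr (- real (card I) / 2)"
    proof -
      have "1 / sqrt D = D powr (- (1/2))" using D by (simp add: powr_minus powr_half_sqrt field_simps)
      then show ?thesis using D by (simp add: powr_realpow[symmetric] powr_powr)
    qed
    finally show ?thesis
      using I by (simp add: prod_ennreal D_def sum_negf sum_divide_distrib)
  qed
  have "density ?L ?f = (\<Pi>\<^sub>M i\<in>I. ?G)"
  proof (rule PiM_eqI[OF I])
    show "sets (density ?L ?f) = sets (\<Pi>\<^sub>M i\<in>I. ?G)" by (simp cong: sets_PiM_cong)
    fix A assume A: "\<And>i. i \<in> I \<Longrightarrow> A i \<in> sets ?G"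
    then have A': "\<And>i. i \<in> I \<Longrightarrow> A i \<in> sets borel" by simp
    have "emeasure (density ?L ?f) (Pi\<^sub>E I A) = (\<integral>\<^sup>+x. ?f x * indicator (Pi\<^sub>E I A) x \<partial>?L)"
      using A' I by (intro emeasure_density sets_PiM_I_finite) auto
    also have "\<dots> = (\<integral>\<^sup>+x. (\<Prod>i\<in>I. ennreal (?n (x i)) * indicator (A i) (x i)) \<partial>?L)"
    proof (rule nn_integral_cong)
      fix x assume "x \<in> space ?L"
      then have "indicator (Pi\<^sub>E I A) x = (\<Prod>i\<in>I. indicator (A i) (x i) :: ennreal)"
        using I by (auto simp: indicator_def space_PiM PiE_iff prod_zero_iff)
      then show "?f x * indicator (Pi\<^sub>E I A) x = (\<Prod>i\<in>I. ennreal (?n (x i)) * indicator (A i) (x i))"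
        by (simp only: f prod.distrib)
    qed
    also have "\<dots> = (\<Prod>i\<in>I. \<integral>\<^sup>+x. ennreal (?n x) * indicator (A i) x \<partial>lborel)"
      using A' I by (intro L.product_nn_integral_prod) auto
    also have "\<dots> = (\<Prod>i\<in>I. emeasure ?G (A i))"
      using A' by (intro prod.cong refl emeasure_density[symmetric]) auto
    finally show "emeasure (density ?L ?f) (Pi\<^sub>E I A) = (\<Prod>i\<in>I. emeasure ?G (A i))" .
  qed
  then show ?thesis by (simp add: gaussian_product_def)
qed

text \<open>Dilation by \<open>c\<close> multiplies the volume by \<open>c ^ card I\<close>; it suffices to check this on boxes.\<close>

lemma emeasure_PiM_lborel_scale:
  assumes I: "finite I" and c: "0 < c" and S: "S \<in> sets (\<Pi>\<^sub>M i\<in>I. lborel :: real measure)"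
  shows "emeasure (\<Pi>\<^sub>M i\<in>I. lborel) S =
    ennreal (c ^ card I) * emeasure (\<Pi>\<^sub>M i\<in>I. lborel) {a \<in> I \<rightarrow>\<^sub>E UNIV. (\<lambda>i\<in>I. c * a i) \<in> S}"
proof -
  interpret product_sigma_finite "\<lambda>_. lborel :: real measure" by standard
  let ?L = "\<Pi>\<^sub>M i\<in>I. lborel :: real measure"
  let ?s = "\<lambda>a. \<lambda>i\<in>I. c * a i"
  have m[measurable]: "?s \<in> measurable ?L ?L" by (intro measurable_restrict) measurable
  have pre: "?s -` X \<inter> space ?L = {a \<in> I \<rightarrow>\<^sub>E UNIV. ?s a \<in> X}" for X by (auto simp: space_PiM)
  have "density (distr ?L ?L ?s) (\<lambda>_. ennreal (c ^ card I)) = ?L"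
  proof (rule PiM_eqI[OF I])
    fix A assume "\<And>i. i \<in> I \<Longrightarrow> A i \<in> sets (lborel :: real measure)"
    then have A: "\<And>i. i \<in> I \<Longrightarrow> A i \<in> sets borel" by simp
    have PA: "Pi\<^sub>E I A \<in> sets ?L" using A I by (intro sets_PiM_I_finite) auto
    have one: "emeasure lborel X = ennreal c * emeasure lborel ((\<lambda>x. c * x) -` X)" if "X \<in> sets borel" for X
      using arg_cong[OF lborel_real_affine[of c 0], of "\<lambda>M. emeasure M X"] c that
      by (simp add: emeasure_density_const emeasure_distr)
    have "emeasure (density (distr ?L ?L ?s) (\<lambda>_. ennreal (c ^ card I))) (Pi\<^sub>E I A)
      = ennreal (c ^ card I) * emeasure ?L (?s -` (Pi\<^sub>E I A) \<inter> space ?L)"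
      using PA m by (simp add: emeasure_density_const emeasure_distr)
    also have "?s -` (Pi\<^sub>E I A) \<inter> space ?L = Pi\<^sub>E I (\<lambda>i. (\<lambda>x. c * x) -` A i)"
      by (auto simp: space_PiM PiE_iff)
    also have "emeasure ?L (Pi\<^sub>E I (\<lambda>i. (\<lambda>x. c * x) -` A i)) = (\<Prod>i\<in>I. emeasure lborel ((\<lambda>x. c * x) -` A i))"
      using A by (intro emeasure_PiM I) (auto intro: measurable_sets_borel[of _ borel])
    also have "ennreal (c ^ card I) * \<dots> = (\<Prod>i\<in>I. ennreal c * emeasure lborel ((\<lambda>x. c * x) -` A i))"
      using c by (simp add: prod.distrib ennreal_power)
    also have "\<dots> = (\<Prod>i\<in>I. emeasure lborel (A i))" using A by (intro prod.cong refl one[symmetric])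
    finally show "emeasure (density (distr ?L ?L ?s) (\<lambda>_. ennreal (c ^ card I))) (Pi\<^sub>E I A) = (\<Prod>i\<in>I. emeasure lborel (A i))" .
  qed simp
  then have "emeasure ?L S = emeasure (density (distr ?L ?L ?s) (\<lambda>_. ennreal (c ^ card I))) S" by simp
  also have "\<dots> = ennreal (c ^ card I) * emeasure ?L (?s -` S \<inter> space ?L)"
    using S m by (simp add: emeasure_density_const emeasure_distr)
  finally show ?thesis unfolding pre .
qed

definition radius :: "'i set \<Rightarrow> ('i \<Rightarrow> real) \<Rightarrow> real" where
  "radius I a = sqrt (\<Sum>i\<in>I. (a i)\<^sup>2)"

lemma radius_nonneg [simp]: "0 \<le> radius I a"
  by (simp add: radius_def sum_nonneg)

lemma radius_scale: "0 \<le> c \<Longrightarrow> radius I (\<lambda>i\<in>I. c * a i) = c * radius I a"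
  by (simp add: radius_def power_mult_distrib sum_distrib_left[symmetric] real_sqrt_mult)

lemma borel_measurable_radius [measurable]: "radius I \<in> borel_measurable (\<Pi>\<^sub>M i\<in>I. borel)"
  unfolding radius_def by measurable

lemma sets_PiM_lborel: "sets (\<Pi>\<^sub>M i\<in>I. lborel :: real measure) = sets (\<Pi>\<^sub>M i\<in>I. borel)"
  by (intro sets_PiM_cong) auto

lemma borel_measurable_radius_lborel [measurable]: "radius I \<in> borel_measurable (\<Pi>\<^sub>M i\<in>I. lborel)"
  using borel_measurable_radius by (simp add: measurable_cong_sets[OF sets_PiM_lborel refl])

lemma emeasure_PiM_lborel_unit_ball:
  assumes I: "finite I"
  shows "emeasure (\<Pi>\<^sub>M i\<in>I. lborel) {a \<in> I \<rightarrow>\<^sub>E UNIV. radius I a \<le> 1} \<noteq> 0"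
    and "emeasure (\<Pi>\<^sub>M i\<in>I. lborel) {a \<in> I \<rightarrow>\<^sub>E UNIV. radius I a \<le> 1} \<noteq> \<infinity>"
proof -
  interpret product_sigma_finite "\<lambda>_. lborel :: real measure" by standard
  let ?L = "\<Pi>\<^sub>M i\<in>I. lborel :: real measure"
  let ?B = "{a \<in> I \<rightarrow>\<^sub>E UNIV. radius I a \<le> 1}"
  have "?B = {a \<in> space ?L. radius I a \<le> 1}" by (simp add: space_PiM)
  then have B: "?B \<in> sets ?L" by simp
  have "Pi\<^sub>E I (\<lambda>_. {0..1 / (real (card I) + 1)}) \<subseteq> ?B"
  proof
    fix a assume a: "a \<in> Pi\<^sub>E I (\<lambda>_. {0..1 / (real (card I) + 1)})"
    have "(a i)\<^sup>2 \<le> 1 / (real (card I) + 1)" if "i \<in> I" for i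
    proof -
      have "0 \<le> a i" "a i \<le> 1 / (real (card I) + 1)" using a that by (auto simp: PiE_iff)
      moreover have "1 / (real (card I) + 1) \<le> 1" by simp
      ultimately show ?thesis
        using mult_left_le[of "a i" "a i"] unfolding power2_eq_square by linarith
    qed
    then have "(\<Sum>i\<in>I. (a i)\<^sup>2) \<le> real (card I) * (1 / (real (card I) + 1))"
      by (rule sum_bounded_above)
    also have "\<dots> \<le> 1" by (simp add: field_simps)
    finally show "a \<in> ?B" using a by (auto simp: radius_def PiE_iff)
  qed
  then have "emeasure ?L (Pi\<^sub>E I (\<lambda>_. {0..1 / (real (card I) + 1)})) \<le> emeasure ?L ?B"
    using B by (rule emeasure_mono)
  moreover have "emeasure ?L (Pi\<^sub>E I (\<lambda>_. {0..1 / (real (card I) + 1)})) > 0"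
    using I by (subst emeasure_PiM) (auto simp: less_le prod_zero_iff)
  ultimately show "emeasure ?L ?B \<noteq> 0" by auto
  have fin2: "(2::ennreal) ^ card I < \<infinity>" by (simp add: power_less_top_ennreal)
  have "?B \<subseteq> Pi\<^sub>E I (\<lambda>_. {-1..1})"
  proof
    fix a assume a: "a \<in> ?B"
    have "\<bar>a i\<bar> \<le> 1" if "i \<in> I" for i
    proof -
      have "(a i)\<^sup>2 \<le> (\<Sum>i\<in>I. (a i)\<^sup>2)" using I that by (intro member_le_sum) auto
      also have "\<dots> \<le> 1" using a by (auto simp: radius_def)
      finally show ?thesis by (simp add: abs_square_le_1)
    qed
    then show "a \<in> Pi\<^sub>E I (\<lambda>_. {-1..1})" using a by (auto simp: PiE_iff abs_le_iff)
  qed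
  then have "emeasure ?L ?B \<le> emeasure ?L (Pi\<^sub>E I (\<lambda>_. {-1..1}))"
    using I by (intro emeasure_mono sets_PiM_I_finite) auto
  also have "\<dots> < \<infinity>" using I fin2 by (subst emeasure_PiM) auto
  finally show "emeasure ?L ?B \<noteq> \<infinity>" by simp
qed

text \<open>By scaling, the volume of the part of \<open>C\<close> within radius \<open>r\<close> is, for every \<open>r\<close>, the same fraction of the volume
  of the ball of radius \<open>r\<close>. So the images under \<open>radius\<close> of Lebesgue measure on \<open>C\<close> and of the corresponding
  multiple of Lebesgue measure agree on half-lines, hence are equal.\<close>

lemma radial_integral_cone:
  fixes C :: "('i \<Rightarrow> real) set"
  assumes I: "finite I" "I \<noteq> {}"
    and C: "C \<in> sets (\<Pi>\<^sub>M i\<in>I. lborel)"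
    and cone: "\<And>a c. a \<in> I \<rightarrow>\<^sub>E UNIV \<Longrightarrow> 0 < c \<Longrightarrow> (\<lambda>i\<in>I. c * a i) \<in> C \<longleftrightarrow> a \<in> C"
    and g [measurable]: "g \<in> borel_measurable borel"
  defines "B \<equiv> {a \<in> I \<rightarrow>\<^sub>E UNIV. radius I a \<le> 1}" and "L \<equiv> \<Pi>\<^sub>M i\<in>I. lborel"
  shows "(\<integral>\<^sup>+a. indicator C a * g (radius I a) \<partial>L) =
    emeasure L (C \<inter> B) / emeasure L B * (\<integral>\<^sup>+a. g (radius I a) \<partial>L)"
proof -
  interpret product_sigma_finite "\<lambda>_. lborel :: real measure" by standard
  note [measurable] = C
  have radm [measurable]: "radius I \<in> borel_measurable L" unfolding L_def by measurable
  have spL: "space L = I \<rightarrow>\<^sub>E UNIV" by (simp add: L_def space_PiM)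
  have CL[measurable]: "C \<in> sets L" using C by (simp add: L_def)
  have Csub: "C \<subseteq> I \<rightarrow>\<^sub>E UNIV" using sets.sets_into_space[OF CL] by (simp add: spL)
  have sp: "I \<rightarrow>\<^sub>E UNIV \<in> sets L" using sets.top[of L] by (simp only: spL)
  define Bl where "Bl r = {a \<in> I \<rightarrow>\<^sub>E UNIV. radius I a \<le> r}" for r
  have Bl[measurable]: "Bl r \<in> sets L" for r
  proof -
    have "Bl r = {a \<in> space L. radius I a \<le> r}" by (simp add: Bl_def spL)
    then show ?thesis by simp
  qed
  have BBl: "B = Bl 1" by (simp add: B_def Bl_def)
  have B0: "emeasure L B \<noteq> 0" and Bf: "emeasure L B \<noteq> \<infinity>"
    using emeasure_PiM_lborel_unit_ball[OF I(1)] by (simp_all add: L_def B_def)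
  have scale: "emeasure L (K \<inter> Bl r) = ennreal (r ^ card I) * emeasure L (K \<inter> B)"
    if r: "0 < r" and K: "K \<in> sets L" and
      Kc: "\<And>a c. a \<in> I \<rightarrow>\<^sub>E UNIV \<Longrightarrow> 0 < c \<Longrightarrow> (\<lambda>i\<in>I. c * a i) \<in> K \<longleftrightarrow> a \<in> K" for r K
  proof -
    have "K \<inter> Bl r \<in> sets L" using K by simp
    then have "emeasure L (K \<inter> Bl r) = ennreal (r ^ card I) * emeasure L {a \<in> I \<rightarrow>\<^sub>E UNIV. (\<lambda>i\<in>I. r * a i) \<in> K \<inter> Bl r}"
      unfolding L_def by (intro emeasure_PiM_lborel_scale I r)
    also have "{a \<in> I \<rightarrow>\<^sub>E UNIV. (\<lambda>i\<in>I. r * a i) \<in> K \<inter> Bl r} = K \<inter> B"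
      using r Kc sets.sets_into_space[OF K]
      by (auto simp: Bl_def BBl radius_scale spL)
    finally show ?thesis .
  qed
  \<comment> \<open>Half-lines with nonpositive endpoint are not reached by scaling; there the ball is at most a point,
    a null set as \<open>I\<close> is nonempty.\<close>
  have zero: "emeasure L (Bl r) = 0" if "r \<le> 0" for r
  proof -
    have "Bl r \<subseteq> Pi\<^sub>E I (\<lambda>_. {0})"
    proof
      fix a assume a: "a \<in> Bl r"
      then have "radius I a = 0" using that radius_nonneg[of I a] unfolding Bl_def by (auto simp del: radius_nonneg)
      then have "\<forall>i\<in>I. (a i)\<^sup>2 = 0" using I by (simp add: radius_def sum_nonneg_eq_0_iff)
      then have "\<forall>i\<in>I. a i \<in> {0}" by simp
      moreover have "a \<in> extensional I" using a by (auto simp: Bl_def PiE_iff)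
      ultimately show "a \<in> Pi\<^sub>E I (\<lambda>_. {0})" unfolding PiE_iff by blast
    qed
    then have "emeasure L (Bl r) \<le> emeasure L (Pi\<^sub>E I (\<lambda>_. {0}))"
      unfolding L_def using I by (intro emeasure_mono sets_PiM_I_finite) auto
    also have "\<dots> = 0" using I unfolding L_def by (subst emeasure_PiM) (auto simp: prod_zero_iff)
    finally show ?thesis by simp
  qed
  define k where "k = emeasure L (C \<inter> B) / emeasure L B"
  have kB: "k * emeasure L B = emeasure L (C \<inter> B)"
    using B0 Bf by (simp add: k_def ennreal_divide_times) (simp add: ennreal_divide_self less_top)
  have kf: "k \<noteq> \<infinity>"
  proof -
    have "emeasure L (C \<inter> B) \<le> emeasure L B" using Bl BBl by (intro emeasure_mono) auto
    then show ?thesis using B0 Bf unfolding k_def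
      by (auto simp: ennreal_divide_eq_top_iff top.extremum_unique)
  qed
  have Blc: "emeasure L (C \<inter> Bl r) = k * emeasure L (Bl r)" for r
  proof (cases "0 < r")
    case True
    have "emeasure L (space L \<inter> Bl r) = ennreal (r ^ card I) * emeasure L (space L \<inter> B)"
      by (rule scale[OF True]) (use sp in \<open>auto simp: spL\<close>)
    moreover have "space L \<inter> Bl r = Bl r" "space L \<inter> B = B" by (auto simp: spL Bl_def B_def)
    moreover have "emeasure L (C \<inter> Bl r) = ennreal (r ^ card I) * emeasure L (C \<inter> B)"
      by (rule scale[OF True CL cone])
    ultimately show ?thesis by (simp add: kB[symmetric] mult_ac)
  next
    case False
    then have "emeasure L (Bl r) = 0" using zero by simp
    moreover have "emeasure L (C \<inter> Bl r) \<le> emeasure L (Bl r)" by (intro emeasure_mono) auto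
    ultimately show ?thesis by simp
  qed
  let ?M = "distr (density L (indicator C)) borel (radius I)"
  let ?N = "distr (density L (\<lambda>_. k)) borel (radius I)"
  have "?M = ?N"
  proof (rule measure_eqI_generator_eq[where E="range (\<lambda>r::real. {..r})" and \<Omega>=UNIV and A="\<lambda>i. {..real i}"])
    have pre: "radius I -` {..r} \<inter> space L = Bl r" for r by (auto simp: Bl_def spL)
    have M: "emeasure ?M {..r} = emeasure L (C \<inter> Bl r)" for r
    proof -
      have "emeasure ?M {..r} = emeasure (density L (indicator C)) (Bl r)"
        by (simp add: emeasure_distr pre)
      also have "\<dots> = (\<integral>\<^sup>+a. indicator (C \<inter> Bl r) a \<partial>L)"
        by (simp add: emeasure_density indicator_inter_arith)
      also have "\<dots> = emeasure L (C \<inter> Bl r)" by (rule nn_integral_indicator) simp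
      finally show ?thesis .
    qed
    have N: "emeasure ?N {..r} = k * emeasure L (Bl r)" for r
      by (simp add: emeasure_distr pre emeasure_density_const)
    show "emeasure ?M X = emeasure ?N X" if "X \<in> range (\<lambda>r::real. {..r})" for X
      using that M N Blc by auto
    show "emeasure ?M {..real i} \<noteq> \<infinity>" for i
    proof -
      have "emeasure L (Bl (real i)) \<noteq> \<infinity>"
      proof (cases "i = 0")
        case True then show ?thesis using zero[of "real i"] by simp
      next
        case False
        have "emeasure L (space L \<inter> Bl (real i)) = ennreal (real i ^ card I) * emeasure L (space L \<inter> B)"
          by (rule scale) (use False sp in \<open>auto simp: spL\<close>)
        moreover have "space L \<inter> Bl (real i) = Bl (real i)" "space L \<inter> B = B" by (auto simp: spL Bl_def B_def)
        ultimately show ?thesis using Bf by (simp add: ennreal_mult_eq_top_iff)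
      qed
      then show ?thesis using kf unfolding M Blc by (simp add: ennreal_mult_eq_top_iff)
    qed
    show "Int_stable (range (\<lambda>r::real. {..r}))" by (auto simp: Int_stable_def)
    show "sets ?M = sigma_sets UNIV (range atMost)" "sets ?N = sigma_sets UNIV (range atMost)"
      by (simp_all add: borel_eq_atMost)
    show "(\<Union>i. {..real i}) = UNIV" using real_arch_simple by auto
  qed auto
  then have "(\<integral>\<^sup>+t. g t \<partial>?M) = (\<integral>\<^sup>+t. g t \<partial>?N)" by simp
  then show ?thesis
    by (simp add: nn_integral_distr nn_integral_density nn_integral_cmult k_def)
qed

lemma sum_squares_eq_radius: "(\<Sum>i\<in>I. (a i)\<^sup>2) = (radius I a)\<^sup>2"
  by (simp add: radius_def sum_nonneg)

lemma coeff_ball_eq: "coeff_ball n = {a \<in> {1..n} \<rightarrow>\<^sub>E UNIV. radius {1..n} a \<le> 1}"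
  by (simp add: coeff_ball_def radius_def)

text \<open>Direction and length of a Gaussian vector are independent, and the direction is uniformly distributed:
  the density is a function of the radius, and the vectors whose direction lies in \<open>T\<close> form a cone.\<close>

lemma gaussian_product_polar:
  fixes T :: "(nat \<Rightarrow> real) set"
  assumes n: "1 \<le> n" and \<sigma>: "0 < \<sigma>"
    and T: "T \<in> sets (\<Pi>\<^sub>M m\<in>{1..n}. borel)" "T \<subseteq> coeff_sphere n" and S: "S \<in> sets borel"
  shows "measure (gaussian_product {1..n} \<sigma>)
      {a \<in> {1..n} \<rightarrow>\<^sub>E UNIV. (\<lambda>m\<in>{1..n}. a m / radius {1..n} a) \<in> T \<and> radius {1..n} a \<in> S} =
    measure (coeff_sphere_measure n) T *
    measure (gaussian_product {1..n} \<sigma>) {a \<in> {1..n} \<rightarrow>\<^sub>E UNIV. radius {1..n} a \<in> S}"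
proof -
  define I where "I = {1..n}"
  have finI: "finite I" and neI: "I \<noteq> {}" using n by (auto simp: I_def)
  let ?L = "\<Pi>\<^sub>M m\<in>I. lborel :: real measure"
  let ?b = "\<Pi>\<^sub>M m\<in>I. borel :: real measure"
  let ?u = "\<lambda>a. \<lambda>m\<in>I. a m / radius I a"
  let ?G = "gaussian_product I \<sigma>"
  interpret G: prob_space ?G by (rule prob_space_gaussian_product[OF \<sigma>])
  note [measurable_cong] = sets_PiM_lborel
  have [measurable]: "T \<in> sets ?b" "S \<in> sets borel" using T(1) S by (auto simp: I_def)
  have um[measurable]: "?u \<in> measurable ?L ?b" by measurable
  have spL: "space ?L = I \<rightarrow>\<^sub>E UNIV" by (simp add: space_PiM)
  define C where "C = {a \<in> I \<rightarrow>\<^sub>E UNIV. ?u a \<in> T}"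
  have Cpre: "C = ?u -` T \<inter> space ?L" by (auto simp: C_def spL)
  have C[measurable]: "C \<in> sets ?L" unfolding Cpre by measurable
  define D where "D = (2 * pi * \<sigma>\<^sup>2) powr (- real (card I) / 2)"
  define g where "g t = ennreal (D * exp (- t\<^sup>2 / (2 * \<sigma>\<^sup>2))) * indicator S t" for t
  have [measurable]: "g \<in> borel_measurable borel" unfolding g_def by measurable
  have cone: "(\<lambda>i\<in>I. c * a i) \<in> C \<longleftrightarrow> a \<in> C" if "a \<in> I \<rightarrow>\<^sub>E UNIV" "0 < c" for a c
  proof -
    have "?u (\<lambda>i\<in>I. c * a i) = ?u a"
      using that by (intro restrict_ext) (simp add: radius_scale)
    then show ?thesis using that by (simp add: C_def)
  qed
  let ?B = "{a \<in> I \<rightarrow>\<^sub>E UNIV. radius I a \<le> 1}"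
  have Bm: "?B \<in> sets ?L"
  proof -
    have "?B = {a \<in> space ?L. radius I a \<le> 1}" by (simp add: spL)
    then show ?thesis by simp
  qed
  have Gd: "emeasure ?G A = (\<integral>\<^sup>+a. ennreal (D * exp (- (radius I a)\<^sup>2 / (2 * \<sigma>\<^sup>2))) * indicator A a \<partial>?L)"
    if "A \<in> sets ?L" for A
    unfolding gaussian_product_eq_density[OF finI \<sigma>] sum_squares_eq_radius D_def[symmetric]
  proof (rule emeasure_density)
    show "(\<lambda>a. ennreal (D * exp (- (radius I a)\<^sup>2 / (2 * \<sigma>\<^sup>2)))) \<in> borel_measurable ?L" by measurable
  qed (rule that)
  have Sm: "{a \<in> I \<rightarrow>\<^sub>E UNIV. radius I a \<in> S} \<in> sets ?L"
  proof -
    have "{a \<in> I \<rightarrow>\<^sub>E UNIV. radius I a \<in> S} = {a \<in> space ?L. radius I a \<in> S}" by (simp add: spL)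
    then show ?thesis by simp
  qed
  have set: "{a \<in> I \<rightarrow>\<^sub>E UNIV. ?u a \<in> T \<and> radius I a \<in> S} = C \<inter> {a \<in> I \<rightarrow>\<^sub>E UNIV. radius I a \<in> S}"
    by (auto simp: C_def)
  have "emeasure ?G {a \<in> I \<rightarrow>\<^sub>E UNIV. ?u a \<in> T \<and> radius I a \<in> S} = (\<integral>\<^sup>+a. indicator C a * g (radius I a) \<partial>?L)"
    unfolding set using C Sm
    by (subst Gd) (auto intro!: nn_integral_cong simp: g_def indicator_def spL)
  also have "\<dots> = emeasure ?L (C \<inter> ?B) / emeasure ?L ?B * (\<integral>\<^sup>+a. g (radius I a) \<partial>?L)"
    by (intro radial_integral_cone cone C finI neI) auto
  also have "(\<integral>\<^sup>+a. g (radius I a) \<partial>?L) = emeasure ?G {a \<in> I \<rightarrow>\<^sub>E UNIV. radius I a \<in> S}"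
    using Sm by (subst Gd) (auto intro!: nn_integral_cong simp: g_def indicator_def spL)
  also have "emeasure ?L (C \<inter> ?B) / emeasure ?L ?B = emeasure (coeff_sphere_measure n) T"
  proof -
    have cs: "coeff_sphere n \<in> sets ?b"
    proof -
      have "coeff_sphere n = {a \<in> space ?b. (\<Sum>m\<in>I. (a m)\<^sup>2) = 1}"
        by (simp only: coeff_sphere_def space_PiM I_def space_borel)
      also have "\<dots> \<in> sets ?b" by measurable
      finally show ?thesis .
    qed
    have "emeasure (coeff_sphere_measure n) T = emeasure (distr (uniform_measure ?L ?B) ?b ?u) T"
      unfolding coeff_sphere_measure_def coeff_ball_eq radius_def I_def
      using T cs[unfolded I_def] by (intro emeasure_restrict_space) auto
    also have "\<dots> = emeasure (uniform_measure ?L ?B) C"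
      unfolding Cpre by (subst emeasure_distr) auto
    also have "\<dots> = emeasure ?L (C \<inter> ?B) / emeasure ?L ?B"
      using C Bm by (subst emeasure_uniform_measure) (auto simp: Int_commute)
    finally show ?thesis by simp
  qed
  finally show ?thesis by (simp only: measure_def enn2real_mult I_def)
qed

lemma normal_exponential_moment:
  assumes "0 < \<sigma>"
  shows "integrable (density lborel (normal_density 0 \<sigma>)) (\<lambda>x. exp (c * x))"
    and "(\<integral>x. exp (c * x) \<partial>density lborel (normal_density 0 \<sigma>)) = exp (\<sigma>\<^sup>2 * c\<^sup>2 / 2)"
proof -
  have eq: "normal_density 0 \<sigma> x * exp (c * x) = exp (\<sigma>\<^sup>2 * c\<^sup>2 / 2) * normal_density (\<sigma>\<^sup>2 * c) \<sigma> x" for x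
  proof -
    have "- x\<^sup>2 / (2 * \<sigma>\<^sup>2) + c * x = \<sigma>\<^sup>2 * c\<^sup>2 / 2 + - (x - \<sigma>\<^sup>2 * c)\<^sup>2 / (2 * \<sigma>\<^sup>2)"
      using assms by (simp add: field_simps power2_eq_square)
    then have "exp (- x\<^sup>2 / (2 * \<sigma>\<^sup>2)) * exp (c * x) = exp (\<sigma>\<^sup>2 * c\<^sup>2 / 2) * exp (- (x - \<sigma>\<^sup>2 * c)\<^sup>2 / (2 * \<sigma>\<^sup>2))"
      by (simp only: exp_add[symmetric])
    then show ?thesis by (simp add: normal_density_def)
  qed
  show "integrable (density lborel (normal_density 0 \<sigma>)) (\<lambda>x. exp (c * x))"
    using assms by (subst integrable_real_density) (auto simp: eq)
  show "(\<integral>x. exp (c * x) \<partial>density lborel (normal_density 0 \<sigma>)) = exp (\<sigma>\<^sup>2 * c\<^sup>2 / 2)"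
    using assms by (subst integral_real_density) (auto simp: eq)
qed

lemma gaussian_product_exponential_moment:
  assumes I: "finite I" and \<sigma>: "0 < \<sigma>"
  shows "integrable (gaussian_product I \<sigma>) (\<lambda>a. exp (\<Sum>i\<in>I. c i * a i))"
    and "(\<integral>a. exp (\<Sum>i\<in>I. c i * a i) \<partial>gaussian_product I \<sigma>) = exp (\<sigma>\<^sup>2 * (\<Sum>i\<in>I. (c i)\<^sup>2) / 2)"
proof -
  let ?G = "density lborel (normal_density 0 \<sigma>)"
  interpret G: prob_space ?G using \<sigma> by (rule prob_space_normal)
  interpret product_sigma_finite "\<lambda>_. ?G" by standard
  show "integrable (gaussian_product I \<sigma>) (\<lambda>a. exp (\<Sum>i\<in>I. c i * a i))"
    unfolding gaussian_product_def exp_sum[OF I]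
    by (rule product_integrable_prod[OF I]) (rule normal_exponential_moment(1)[OF \<sigma>])
  have "(\<integral>a. (\<Prod>i\<in>I. exp (c i * a i)) \<partial>(\<Pi>\<^sub>M i\<in>I. ?G)) = (\<Prod>i\<in>I. \<integral>x. exp (c i * x) \<partial>?G)"
    by (rule product_integral_prod[OF I]) (rule normal_exponential_moment(1)[OF \<sigma>])
  also have "\<dots> = exp (\<sigma>\<^sup>2 * (\<Sum>i\<in>I. (c i)\<^sup>2) / 2)"
    using I by (simp add: normal_exponential_moment(2)[OF \<sigma>] exp_sum[symmetric] sum_distrib_left sum_divide_distrib)
  finally show "(\<integral>a. exp (\<Sum>i\<in>I. c i * a i) \<partial>gaussian_product I \<sigma>) = exp (\<sigma>\<^sup>2 * (\<Sum>i\<in>I. (c i)\<^sup>2) / 2)"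
    by (simp add: gaussian_product_def exp_sum[OF I])
qed

lemma normal_square_exponential_moment:
  assumes \<sigma>: "0 < \<sigma>" and s: "- 1 / 2 < s"
  shows "integrable (density lborel (normal_density 0 \<sigma>)) (\<lambda>x. exp (- s * x\<^sup>2 / \<sigma>\<^sup>2))"
    and "(\<integral>x. exp (- s * x\<^sup>2 / \<sigma>\<^sup>2) \<partial>density lborel (normal_density 0 \<sigma>)) = 1 / sqrt (1 + 2 * s)"
proof -
  define r where "r = sqrt (1 + 2 * s)"
  have r: "0 < r" and r2: "r\<^sup>2 = 1 + 2 * s" using s by (auto simp: r_def)
  have eq: "normal_density 0 \<sigma> x * exp (- s * x\<^sup>2 / \<sigma>\<^sup>2) = 1 / r * normal_density 0 (\<sigma> / r) x" for x
  proof -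
    have "- x\<^sup>2 / (2 * \<sigma>\<^sup>2) + - s * x\<^sup>2 / \<sigma>\<^sup>2 = - x\<^sup>2 / (2 * (\<sigma> / r)\<^sup>2)"
      using \<sigma> r by (simp add: power_divide r2 field_simps)
    then have e: "exp (- x\<^sup>2 / (2 * \<sigma>\<^sup>2)) * exp (- s * x\<^sup>2 / \<sigma>\<^sup>2) = exp (- x\<^sup>2 / (2 * (\<sigma> / r)\<^sup>2))"
      by (simp only: exp_add[symmetric])
    have "1 / sqrt (2 * pi * \<sigma>\<^sup>2) = 1 / r * (1 / sqrt (2 * pi * (\<sigma> / r)\<^sup>2))"
      using \<sigma> r by (simp add: real_sqrt_mult real_sqrt_divide power_divide)
    then show ?thesis unfolding normal_density_def using e by simp
  qed
  have \<sigma>r: "0 < \<sigma> / r" using \<sigma> r by simp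
  show "integrable (density lborel (normal_density 0 \<sigma>)) (\<lambda>x. exp (- s * x\<^sup>2 / \<sigma>\<^sup>2))"
    using \<sigma> \<sigma>r by (subst integrable_real_density) (auto simp only: eq intro!: integrable_mult_right integrable_normal_density, auto)
  have "(\<integral>x. exp (- s * x\<^sup>2 / \<sigma>\<^sup>2) \<partial>density lborel (normal_density 0 \<sigma>)) = (\<integral>x. 1 / r * normal_density 0 (\<sigma> / r) x \<partial>lborel)"
    using \<sigma> by (subst integral_real_density) (simp_all only: eq, auto)
  also have "\<dots> = 1 / r" using integral_normal_density[OF \<sigma>r] by simp
  finally show "(\<integral>x. exp (- s * x\<^sup>2 / \<sigma>\<^sup>2) \<partial>density lborel (normal_density 0 \<sigma>)) = 1 / sqrt (1 + 2 * s)"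
    by (simp add: r_def)
qed

lemma gaussian_product_radius_exponential_moment:
  assumes I: "finite I" and \<sigma>: "0 < \<sigma>" and s: "- 1 / 2 < s"
  shows "integrable (gaussian_product I \<sigma>) (\<lambda>a. exp (- s * (radius I a)\<^sup>2 / \<sigma>\<^sup>2))"
    and "(\<integral>a. exp (- s * (radius I a)\<^sup>2 / \<sigma>\<^sup>2) \<partial>gaussian_product I \<sigma>) = (1 / sqrt (1 + 2 * s)) ^ card I"
proof -
  let ?G = "density lborel (normal_density 0 \<sigma>)"
  let ?P = "gaussian_product I \<sigma>"
  interpret G: prob_space ?G using \<sigma> by (rule prob_space_normal)
  interpret product_sigma_finite "\<lambda>_. ?G" by standard
  have ex: "exp (- s * (radius I a)\<^sup>2 / \<sigma>\<^sup>2) = (\<Prod>i\<in>I. exp (- s * (a i)\<^sup>2 / \<sigma>\<^sup>2))" for a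
    by (simp only: exp_sum[OF I, symmetric] sum_squares_eq_radius[symmetric] sum_distrib_left sum_divide_distrib)
  show "integrable ?P (\<lambda>a. exp (- s * (radius I a)\<^sup>2 / \<sigma>\<^sup>2))"
    unfolding ex gaussian_product_def
    by (rule product_integrable_prod[OF I]) (rule normal_square_exponential_moment(1)[OF \<sigma> s])
  have "(\<integral>a. exp (- s * (radius I a)\<^sup>2 / \<sigma>\<^sup>2) \<partial>?P) = (\<Prod>i\<in>I. \<integral>x. exp (- s * x\<^sup>2 / \<sigma>\<^sup>2) \<partial>?G)"
    unfolding ex gaussian_product_def
    by (rule product_integral_prod[OF I]) (rule normal_square_exponential_moment(1)[OF \<sigma> s])
  also have "\<dots> = (1 / sqrt (1 + 2 * s)) ^ card I"
    unfolding normal_square_exponential_moment(2)[OF \<sigma> s] by simp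
  finally show "(\<integral>a. exp (- s * (radius I a)\<^sup>2 / \<sigma>\<^sup>2) \<partial>?P) = (1 / sqrt (1 + 2 * s)) ^ card I" .
qed

text \<open>Depending on the sign of \<open>s\<close>, this bounds the lower tail or the upper tail of the radius.\<close>

lemma gaussian_product_radius_chernoff:
  assumes I: "finite I" and \<sigma>: "0 < \<sigma>" and s: "- 1 / 2 < s"
  shows "measure (gaussian_product I \<sigma>) {a \<in> I \<rightarrow>\<^sub>E UNIV. s * (radius I a)\<^sup>2 \<le> s * (\<rho> * real (card I) * \<sigma>\<^sup>2)}
    \<le> (exp (s * \<rho>) / sqrt (1 + 2 * s)) ^ card I"
proof -
  let ?P = "gaussian_product I \<sigma>"
  interpret P: prob_space ?P by (rule prob_space_gaussian_product[OF \<sigma>])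
  note int = gaussian_product_radius_exponential_moment(1)[OF I \<sigma> s]
  note E = gaussian_product_radius_exponential_moment(2)[OF I \<sigma> s]
  define w where "w = exp (- (s * \<rho>) * real (card I))"
  have w: "0 < w" by (simp add: w_def)
  have "{a \<in> I \<rightarrow>\<^sub>E UNIV. s * (radius I a)\<^sup>2 \<le> s * (\<rho> * real (card I) * \<sigma>\<^sup>2)}
      = {a \<in> space ?P. w \<le> exp (- s * (radius I a)\<^sup>2 / \<sigma>\<^sup>2)}"
    using \<sigma> by (auto simp: space_gaussian_product w_def field_simps)
  also have "P.prob \<dots> \<le> (1 / sqrt (1 + 2 * s)) ^ card I / w"
    unfolding E[symmetric] by (rule integral_Markov_inequality_measure[OF int, where A="{}"]) (use w in auto)
  also have "\<dots> = (exp (s * \<rho>) / sqrt (1 + 2 * s)) ^ card I"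
  proof -
    have "1 / w = exp (s * \<rho>) ^ card I" by (simp add: w_def exp_minus exp_of_nat2_mult divide_inverse)
    then show ?thesis by (simp add: power_divide divide_simps)
  qed
  finally show ?thesis .
qed


text \<open>Squared, the claim reads \<open>exp (2 * s * \<rho>) < 1 + 2 * s\<close>. With the given \<open>s\<close>, the estimate
  \<open>exp x \<le> 1 / (1 - x)\<close> reduces it to \<open>4 * \<rho> < (1 + \<rho>)\<^sup>2\<close>, for \<open>\<rho>\<close> on either side of \<open>1\<close>.\<close>

lemma chernoff_base_less_1:
  assumes \<rho>: "0 < \<rho>" "\<rho> \<noteq> 1"
  defines "s \<equiv> (1 - \<rho>) / (4 * \<rho>)"
  shows "- 1 / 2 < s" "exp (s * \<rho>) / sqrt (1 + 2 * s) < 1"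
proof -
  have s: "1 + 2 * s = (1 + \<rho>) / (2 * \<rho>)" using \<rho> by (simp add: s_def field_simps)
  moreover have "0 < (1 + \<rho>) / (2 * \<rho>)" using \<rho> by simp
  ultimately show s2: "- 1 / 2 < s" by linarith
  have "exp (2 * (s * \<rho>)) = exp ((1 - \<rho>) / 2)" using \<rho> by (simp add: s_def field_simps)
  also have "\<dots> \<le> 2 / (1 + \<rho>)"
  proof -
    have "1 - (1 - \<rho>) / 2 \<le> exp (- ((1 - \<rho>) / 2))" using exp_ge_add_one_self[of "- ((1 - \<rho>) / 2)"] by simp
    then have "(1 + \<rho>) / 2 \<le> 1 / exp ((1 - \<rho>) / 2)" by (simp add: exp_minus field_simps)
    then show ?thesis using \<rho> by (simp add: field_simps)
  qed
  also have "\<dots> < (1 + \<rho>) / (2 * \<rho>)"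
  proof -
    have "0 < (1 - \<rho>)\<^sup>2" using \<rho> by simp
    then show ?thesis using \<rho> by (simp add: divide_simps power2_eq_square algebra_simps)
  qed
  finally have "(exp (s * \<rho>))\<^sup>2 < 1 + 2 * s" by (simp add: s exp_double[symmetric])
  then have "exp (s * \<rho>) < sqrt (1 + 2 * s)" by (rule real_less_rsqrt)
  then show "exp (s * \<rho>) / sqrt (1 + 2 * s) < 1" using s2 by (simp add: divide_simps)
qed

text \<open>For \<open>r < 1\<close> the event is that the radius is at most \<open>r\<close>, for \<open>r > 1\<close> that it is at least \<open>r\<close>. In both cases its
  probability is bounded by a constant below \<open>1\<close> that does not depend on the dimension.\<close>

lemma gaussian_radius_concentration:
  assumes r: "0 < r" "r \<noteq> 1"
  shows "\<exists>q<1. \<forall>n\<ge>1. measure (gaussian_product {1..n} (1 / sqrt (real n)))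
      {a \<in> {1..n} \<rightarrow>\<^sub>E UNIV. (1 - r) * radius {1..n} a \<le> (1 - r) * r} \<le> q"
proof -
  define s where "s = (1 - r\<^sup>2) / (4 * r\<^sup>2)"
  define q where "q = exp (s * r\<^sup>2) / sqrt (1 + 2 * s)"
  have r2: "0 < r\<^sup>2" "r\<^sup>2 \<noteq> 1" using r by (auto simp: power2_eq_1_iff)
  note cb = chernoff_base_less_1[OF r2, folded s_def, folded q_def]
  have q0: "0 \<le> q" using cb by (simp add: q_def)
  show ?thesis
  proof (intro exI[of _ q] conjI allI impI)
    show "q < 1" by (rule cb)
    fix n :: nat assume n: "1 \<le> n"
    define I where "I = {1..n}"
    have I: "finite I" "card I = n" by (auto simp: I_def)
    have \<sigma>: "0 < 1 / sqrt (real n)" using n by simp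
    interpret P: prob_space "gaussian_product I (1 / sqrt (real n))" by (rule prob_space_gaussian_product[OF \<sigma>])
    have eq: "r\<^sup>2 * real n * (1 / sqrt (real n))\<^sup>2 = r\<^sup>2" using n by (simp add: power_divide)
    have sg: "(1 - r) * x \<le> (1 - r) * r \<Longrightarrow> s * x\<^sup>2 \<le> s * r\<^sup>2" if "0 \<le> x" for x
    proof (cases "r < 1")
      case True
      assume "(1 - r) * x \<le> (1 - r) * r"
      then have "x \<le> r" using True by simp
      then have "x\<^sup>2 \<le> r\<^sup>2" using that by (intro power_mono) auto
      moreover have "0 \<le> s" using True r by (simp add: s_def power_le_one)
      ultimately show ?thesis by (rule mult_left_mono)
    next
      case False
      assume "(1 - r) * x \<le> (1 - r) * r"
      then have "r \<le> x" using False r by (simp add: mult_le_cancel_left)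
      then have "r\<^sup>2 \<le> x\<^sup>2" using r by (intro power_mono) auto
      moreover have "s \<le> 0" using False r by (simp add: s_def divide_nonpos_nonneg one_le_power)
      ultimately show ?thesis by (rule mult_left_mono_neg)
    qed
    have "{a \<in> I \<rightarrow>\<^sub>E UNIV. s * (radius I a)\<^sup>2 \<le> s * r\<^sup>2}
       = {a \<in> space (gaussian_product I (1 / sqrt (real n))). s * (radius I a)\<^sup>2 \<le> s * r\<^sup>2}"
      by (simp add: space_gaussian_product)
    also have "\<dots> \<in> P.events" by measurable
    finally have ev: "{a \<in> I \<rightarrow>\<^sub>E UNIV. s * (radius I a)\<^sup>2 \<le> s * r\<^sup>2} \<in> P.events" .
    have "P.prob {a \<in> I \<rightarrow>\<^sub>E UNIV. (1 - r) * radius I a \<le> (1 - r) * r}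
      \<le> P.prob {a \<in> I \<rightarrow>\<^sub>E UNIV. s * (radius I a)\<^sup>2 \<le> s * r\<^sup>2}"
    proof (rule P.finite_measure_mono[OF _ ev])
      show "{a \<in> I \<rightarrow>\<^sub>E UNIV. (1 - r) * radius I a \<le> (1 - r) * r} \<subseteq> {a \<in> I \<rightarrow>\<^sub>E UNIV. s * (radius I a)\<^sup>2 \<le> s * r\<^sup>2}"
        using sg[OF radius_nonneg] by blast
    qed
    also have "\<dots> \<le> q ^ n"
      using gaussian_product_radius_chernoff[OF I(1) \<sigma> cb(1), of "r\<^sup>2"] by (simp only: I q_def) (simp only: eq)
    also have "\<dots> \<le> q" using n q0 cb(2) power_decreasing[of 1 n q] by simp
    finally show "measure (gaussian_product {1..n} (1 / sqrt (real n)))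
      {a \<in> {1..n} \<rightarrow>\<^sub>E UNIV. (1 - r) * radius {1..n} a \<le> (1 - r) * r} \<le> q" by (simp only: I_def)
  qed
qed

section \<open>The sup norm as a function of the coefficients\<close>

lemma lincomb_bound:
  fixes Y :: "nat \<Rightarrow> 'a::euclidean_space \<Rightarrow> real"
  assumes Y: "orthonormal_basis_on_sphere n Y (sphere_eigenspace c)" and x: "x \<in> sphere 0 1"
  shows "\<bar>\<Sum>m=1..n. a m * Y m x\<bar> \<le> sqrt (real n) * radius {1..n} a"
proof -
  have "(\<Sum>m=1..n. a m * Y m x)\<^sup>2 \<le> (\<Sum>m=1..n. (a m)\<^sup>2) * (\<Sum>m=1..n. (Y m x)\<^sup>2)"
    by (rule Cauchy_Schwarz_ineq_sum)
  also have "(\<Sum>m=1..n. (Y m x)\<^sup>2) = real n" by (rule orthonormal_basis_sum_squares[OF Y x])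
  also have "(\<Sum>m=1..n. (a m)\<^sup>2) = (radius {1..n} a)\<^sup>2" by (rule sum_squares_eq_radius)
  also have "(radius {1..n} a)\<^sup>2 * real n = (sqrt (real n) * radius {1..n} a)\<^sup>2" by (simp add: power_mult_distrib)
  finally have "\<bar>\<Sum>m=1..n. a m * Y m x\<bar> \<le> \<bar>sqrt (real n) * radius {1..n} a\<bar>"
    by (simp only: abs_le_square_iff)
  then show ?thesis by (simp add: abs_mult)
qed

lemma cosh_le_exp:
  fixes x y :: real
  assumes "\<bar>x\<bar> \<le> y"
  shows "cosh x \<le> exp y"
proof -
  have "(exp x + exp (- x)) / 2 \<le> (exp y + exp y) / 2"
    using assms by (intro divide_right_mono add_mono) auto
  then show ?thesis unfolding cosh_field_def by simp
qed

text \<open>Comparison of power series: only even powers \<open>\<rho> ^ k\<close> occur, and these are at most \<open>\<rho>\<^sup>2\<close> for \<open>k \<ge> 2\<close>.\<close>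

lemma cosh_mult_le:
  fixes t \<rho> :: real
  assumes "\<bar>\<rho>\<bar> \<le> 1" "0 \<le> t"
  shows "cosh (t * \<rho>) \<le> 1 + \<rho>\<^sup>2 * exp t"
proof -
  let ?c = "\<lambda>x k. if even k then x ^ k /\<^sub>R fact k else (0::real)"
  have s1: "?c (t * \<rho>) sums cosh (t * \<rho>)" by (rule cosh_converges)
  have s2: "(\<lambda>k. \<rho>\<^sup>2 * ?c t k + (if k = 0 then 1 - \<rho>\<^sup>2 else 0)) sums (\<rho>\<^sup>2 * cosh t + (1 - \<rho>\<^sup>2))"
    by (intro sums_add sums_mult cosh_converges sums_single)
  have "?c (t * \<rho>) k \<le> \<rho>\<^sup>2 * ?c t k + (if k = 0 then 1 - \<rho>\<^sup>2 else 0)" for k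
  proof (cases "even k \<and> k \<noteq> 0")
    case True
    then have "\<rho> ^ k \<le> \<rho>\<^sup>2"
      using assms(1) power_decreasing[of 2 k "\<bar>\<rho>\<bar>"] dvd_imp_le[of 2 k] by (simp add: power_even_abs)
    then have "\<rho> ^ k * (t ^ k / fact k) \<le> \<rho>\<^sup>2 * (t ^ k / fact k)"
      using assms(2) by (intro mult_right_mono) auto
    then show ?thesis
      using True by (simp add: power_mult_distrib divide_inverse mult_ac)
  qed auto
  then have "cosh (t * \<rho>) \<le> \<rho>\<^sup>2 * cosh t + (1 - \<rho>\<^sup>2)" by (rule sums_le[OF _ s1 s2])
  also have "cosh t \<le> exp t" using assms(2) by (simp add: cosh_field_def)
  then have "\<rho>\<^sup>2 * cosh t + (1 - \<rho>\<^sup>2) \<le> \<rho>\<^sup>2 * exp t + 1"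
    by (intro add_mono mult_left_mono) auto
  finally show ?thesis by simp
qed

context
  fixes n :: nat and c :: real and Y :: "nat \<Rightarrow> 'a::euclidean_space \<Rightarrow> real"
  assumes Y: "orthonormal_basis_on_sphere n Y (sphere_eigenspace c)" and n: "1 \<le> n"
begin

private abbreviation (input) "h a x \<equiv> \<Sum>m=1..n. a m * Y m x"
private abbreviation (input) "N a \<equiv> sphere_norm (\<lambda>x. \<Sum>m=1..n. a m * Y m x)"

lemma bdd_above_lincomb: "bdd_above ((\<lambda>x. \<bar>h a x\<bar>) ` sphere 0 1)"
  using lincomb_bound[OF Y] by (intro bdd_aboveI2) blast

lemma sphere_nonempty: "sphere (0::'a) 1 \<noteq> {}"
  using vector_choose_size[of 1, where 'a='a] by auto

lemma lincomb_le_sphere_norm: "x \<in> sphere 0 1 \<Longrightarrow> \<bar>h a x\<bar> \<le> N a"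
  unfolding sphere_norm_def by (rule cSUP_upper[OF _ bdd_above_lincomb])

lemma sphere_norm_le: "(\<And>x. x \<in> sphere 0 1 \<Longrightarrow> \<bar>h a x\<bar> \<le> B) \<Longrightarrow> N a \<le> B"
  unfolding sphere_norm_def by (rule cSUP_least[OF sphere_nonempty])

lemma sphere_norm_nonneg: "0 \<le> N a"
  using sphere_nonempty lincomb_le_sphere_norm[of _ a] by (meson abs_ge_zero ex_in_conv order_trans)

lemma sphere_norm_le_radius: "N a \<le> sqrt (real n) * radius {1..n} a"
  by (rule sphere_norm_le) (rule lincomb_bound[OF Y])

lemma sphere_norm_lipschitz: "N a - N b \<le> sqrt (real n) * sqrt (\<Sum>m=1..n. (a m - b m)\<^sup>2)"
proof -
  have "N a \<le> N b + sqrt (real n) * radius {1..n} (\<lambda>m. a m - b m)"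
  proof (rule sphere_norm_le)
    fix x :: 'a assume x: "x \<in> sphere 0 1"
    have "h a x = h b x + h (\<lambda>m. a m - b m) x" by (simp add: sum.distrib[symmetric] algebra_simps)
    then have "\<bar>h a x\<bar> \<le> \<bar>h b x\<bar> + \<bar>h (\<lambda>m. a m - b m) x\<bar>" by linarith
    then show "\<bar>h a x\<bar> \<le> N b + sqrt (real n) * radius {1..n} (\<lambda>m. a m - b m)"
      using lincomb_le_sphere_norm[OF x, of b] lincomb_bound[OF Y x, of "\<lambda>m. a m - b m"] by linarith
  qed
  then show ?thesis by (simp add: radius_def)
qed

text \<open>The sup norm is homogeneous. If the radius is zero, both sides vanish.\<close>

lemma sphere_norm_direction:
  "N a = radius {1..n} a * N (\<lambda>m\<in>{1..n}. a m / radius {1..n} a)"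
proof (cases "radius {1..n} a = 0")
  case True
  then show ?thesis using sphere_norm_le_radius[of a] sphere_norm_nonneg[of a] by simp
next
  case False
  let ?r = "radius {1..n} a" and ?u = "\<lambda>m\<in>{1..n}. a m / radius {1..n} a"
  have r: "0 < ?r" using False radius_nonneg[of "{1..n}" a] by linarith
  have hu: "h a x = ?r * h ?u x" for x
    unfolding sum_distrib_left using False by (intro sum.cong) auto
  have "N a \<le> ?r * N ?u"
  proof (rule sphere_norm_le)
    fix x :: 'a assume "x \<in> sphere 0 1"
    then show "\<bar>h a x\<bar> \<le> ?r * N ?u"
      unfolding hu abs_mult using r lincomb_le_sphere_norm[of x ?u] by (simp del: restrict_apply)
  qed
  moreover have "N ?u \<le> N a / ?r"
  proof (rule sphere_norm_le)
    fix x :: 'a assume "x \<in> sphere 0 1"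
    then have "\<bar>?r * h ?u x\<bar> \<le> N a" using lincomb_le_sphere_norm[of x a] by (simp only: hu)
    then have "?r * \<bar>h ?u x\<bar> \<le> N a" using r by (simp only: abs_mult abs_of_pos)
    then show "\<bar>h ?u x\<bar> \<le> N a / ?r" using r by (simp only: pos_le_divide_eq mult.commute)
  qed
  then have "?r * N ?u \<le> N a" using r by (simp only: pos_le_divide_eq mult.commute)
  ultimately show ?thesis by (rule antisym)
qed

text \<open>By continuity the supremum may be taken over a countable dense subset of the sphere.\<close>

lemma borel_measurable_sphere_norm: "(\<lambda>a. N a) \<in> borel_measurable (\<Pi>\<^sub>M m\<in>{1..n}. borel)"
proof -
  obtain D :: "'a set" where D: "countable D" "D \<subseteq> sphere 0 1" "sphere 0 1 \<subseteq> closure D"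
    using separable[of "sphere (0::'a) 1"] by metis
  have Dne: "D \<noteq> {}" using D(3) sphere_nonempty by auto
  have bdd: "bdd_above ((\<lambda>x. \<bar>h a x\<bar>) ` D)" for a
    by (rule bdd_above_mono[OF bdd_above_lincomb[of a] image_mono[OF D(2)]])
  have "N a = (SUP x\<in>D. \<bar>h a x\<bar>)" for a
  proof (rule antisym)
    show "N a \<le> (SUP x\<in>D. \<bar>h a x\<bar>)"
    proof (rule sphere_norm_le)
      fix x :: 'a assume x: "x \<in> sphere 0 1"
      let ?S = "{x \<in> sphere 0 1. \<bar>h a x\<bar> \<le> (SUP x\<in>D. \<bar>h a x\<bar>)}"
      have "continuous_on (sphere 0 1) (\<lambda>x. \<bar>h a x\<bar>)"
        by (intro continuous_intros orthonormal_basis_continuous[OF Y])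
      then have "closed ?S" by (intro continuous_on_closed_Collect_le continuous_on_const) auto
      moreover have "D \<subseteq> ?S" using D(2) bdd by (auto intro!: cSUP_upper)
      ultimately have "closure D \<subseteq> ?S" by (rule closure_minimal[rotated])
      then show "\<bar>h a x\<bar> \<le> (SUP x\<in>D. \<bar>h a x\<bar>)" using x D(3) by blast
    qed
    show "(SUP x\<in>D. \<bar>h a x\<bar>) \<le> N a"
      using D(2) by (intro cSUP_least Dne lincomb_le_sphere_norm) auto
  qed
  moreover have "(\<lambda>a. SUP x\<in>D. \<bar>h a x\<bar>) \<in> borel_measurable (\<Pi>\<^sub>M m\<in>{1..n}. borel)"
    by (rule borel_measurable_cSUP[OF D(1) _ bdd]) measurable
  ultimately show ?thesis by simp
qed

lemma sphere_norm_set_measurable: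
  assumes "S \<in> sets borel"
  shows "{a \<in> {1..n} \<rightarrow>\<^sub>E UNIV. N a \<in> S} \<in> sets (\<Pi>\<^sub>M m\<in>{1..n}. borel)"
    and "{a \<in> coeff_sphere n. N a \<in> S} \<in> sets (\<Pi>\<^sub>M m\<in>{1..n}. borel)"
proof -
  note [measurable] = borel_measurable_sphere_norm assms
  let ?M = "\<Pi>\<^sub>M m\<in>{1..n}. borel :: real measure"
  have "{a \<in> space ?M. N a \<in> S} \<in> sets ?M" "{a \<in> space ?M. (\<Sum>m=1..n. (a m)\<^sup>2) = 1 \<and> N a \<in> S} \<in> sets ?M"
    by measurable
  moreover have "{a \<in> coeff_sphere n. N a \<in> S} = {a \<in> space ?M. (\<Sum>m=1..n. (a m)\<^sup>2) = 1 \<and> N a \<in> S}"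
    unfolding coeff_sphere_def space_PiM space_borel by blast
  ultimately show "{a \<in> {1..n} \<rightarrow>\<^sub>E UNIV. N a \<in> S} \<in> sets ?M" "{a \<in> coeff_sphere n. N a \<in> S} \<in> sets ?M"
    by (simp_all only: space_PiM space_borel)
qed

private abbreviation (input) "\<gamma> \<equiv> gaussian_product {1..n} (1 / sqrt (real n))"

lemma sigma_pos: "0 < 1 / sqrt (real n)" using n by simp

lemma sigma_square: "(1 / sqrt (real n))\<^sup>2 = 1 / real n" by (simp add: power_divide)

lemma sphere_large_norm_le_gaussian:
  assumes t: "0 \<le> t" and r: "0 \<le> r"
  shows "measure (coeff_sphere_measure n) {a \<in> coeff_sphere n. t \<le> N a} *
      measure \<gamma> {a \<in> {1..n} \<rightarrow>\<^sub>E UNIV. r \<le> radius {1..n} a}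
    \<le> measure \<gamma> {a \<in> {1..n} \<rightarrow>\<^sub>E UNIV. t * r \<le> N a}"
proof -
  interpret P: prob_space \<gamma> by (rule prob_space_gaussian_product[OF sigma_pos])
  let ?T = "{a \<in> coeff_sphere n. N a \<in> {t..}}"
  have "measure (coeff_sphere_measure n) ?T * measure \<gamma> {a \<in> {1..n} \<rightarrow>\<^sub>E UNIV. radius {1..n} a \<in> {r..}}
    = measure \<gamma> {a \<in> {1..n} \<rightarrow>\<^sub>E UNIV. (\<lambda>m\<in>{1..n}. a m / radius {1..n} a) \<in> ?T \<and> radius {1..n} a \<in> {r..}}"
    by (rule gaussian_product_polar[symmetric, OF n sigma_pos sphere_norm_set_measurable(2)]) auto
  also have "\<dots> \<le> measure \<gamma> {a \<in> {1..n} \<rightarrow>\<^sub>E UNIV. N a \<in> {t * r..}}"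
  proof (rule P.finite_measure_mono)
    show "{a \<in> {1..n} \<rightarrow>\<^sub>E UNIV. N a \<in> {t * r..}} \<in> P.events"
      unfolding sets_gaussian_product by (rule sphere_norm_set_measurable) simp
    show "{a \<in> {1..n} \<rightarrow>\<^sub>E UNIV. (\<lambda>m\<in>{1..n}. a m / radius {1..n} a) \<in> ?T \<and> radius {1..n} a \<in> {r..}}
      \<subseteq> {a \<in> {1..n} \<rightarrow>\<^sub>E UNIV. N a \<in> {t * r..}}"
    proof
      fix a assume A: "a \<in> {a \<in> {1..n} \<rightarrow>\<^sub>E UNIV. (\<lambda>m\<in>{1..n}. a m / radius {1..n} a) \<in> ?T \<and> radius {1..n} a \<in> {r..}}"
      then have a: "t \<le> N (\<lambda>m\<in>{1..n}. a m / radius {1..n} a)" "r \<le> radius {1..n} a"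
        unfolding mem_Collect_eq atLeast_iff by blast+
      have "r * t \<le> radius {1..n} a * N (\<lambda>m\<in>{1..n}. a m / radius {1..n} a)"
        by (rule mult_mono[OF a(2,1) radius_nonneg t])
      then have "t * r \<le> N a" by (simp only: sphere_norm_direction[symmetric] mult.commute[of t r])
      then show "a \<in> {a \<in> {1..n} \<rightarrow>\<^sub>E UNIV. N a \<in> {t * r..}}"
        using A unfolding mem_Collect_eq atLeast_iff by blast
    qed
  qed
  finally show ?thesis by simp
qed

lemma sphere_small_norm_le_gaussian:
  assumes t: "0 \<le> t"
  shows "measure (coeff_sphere_measure n) {a \<in> coeff_sphere n. N a \<le> t} *
      measure \<gamma> {a \<in> {1..n} \<rightarrow>\<^sub>E UNIV. radius {1..n} a \<le> r}
    \<le> measure \<gamma> {a \<in> {1..n} \<rightarrow>\<^sub>E UNIV. N a \<le> t * r}"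
proof -
  interpret P: prob_space \<gamma> by (rule prob_space_gaussian_product[OF sigma_pos])
  let ?T = "{a \<in> coeff_sphere n. N a \<in> {..t}}"
  have "measure (coeff_sphere_measure n) ?T * measure \<gamma> {a \<in> {1..n} \<rightarrow>\<^sub>E UNIV. radius {1..n} a \<in> {..r}}
    = measure \<gamma> {a \<in> {1..n} \<rightarrow>\<^sub>E UNIV. (\<lambda>m\<in>{1..n}. a m / radius {1..n} a) \<in> ?T \<and> radius {1..n} a \<in> {..r}}"
    by (rule gaussian_product_polar[symmetric, OF n sigma_pos sphere_norm_set_measurable(2)]) auto
  also have "\<dots> \<le> measure \<gamma> {a \<in> {1..n} \<rightarrow>\<^sub>E UNIV. N a \<in> {..t * r}}"
  proof (rule P.finite_measure_mono)
    show "{a \<in> {1..n} \<rightarrow>\<^sub>E UNIV. N a \<in> {..t * r}} \<in> P.events"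
      unfolding sets_gaussian_product by (rule sphere_norm_set_measurable) simp
    show "{a \<in> {1..n} \<rightarrow>\<^sub>E UNIV. (\<lambda>m\<in>{1..n}. a m / radius {1..n} a) \<in> ?T \<and> radius {1..n} a \<in> {..r}}
      \<subseteq> {a \<in> {1..n} \<rightarrow>\<^sub>E UNIV. N a \<in> {..t * r}}"
    proof
      fix a assume A: "a \<in> {a \<in> {1..n} \<rightarrow>\<^sub>E UNIV. (\<lambda>m\<in>{1..n}. a m / radius {1..n} a) \<in> ?T \<and> radius {1..n} a \<in> {..r}}"
      then have a: "N (\<lambda>m\<in>{1..n}. a m / radius {1..n} a) \<le> t" "radius {1..n} a \<le> r"
        unfolding mem_Collect_eq atMost_iff by blast+
      have "radius {1..n} a * N (\<lambda>m\<in>{1..n}. a m / radius {1..n} a) \<le> r * t"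
        by (rule mult_mono[OF a(2,1) order_trans[OF radius_nonneg a(2)] sphere_norm_nonneg])
      then have "N a \<le> t * r" by (simp only: sphere_norm_direction[symmetric] mult.commute[of t r])
      then show "a \<in> {a \<in> {1..n} \<rightarrow>\<^sub>E UNIV. N a \<in> {..t * r}}"
        using A unfolding mem_Collect_eq atMost_iff by blast
    qed
  qed
  finally show ?thesis by simp
qed

text \<open>The sup norm grows at most linearly in the radius, and \<open>exp ((radius {1..n} a)\<^sup>2 / (4 * v))\<close> is integrable for
  variance \<open>v\<close>.\<close>

lemma integrable_sphere_norm: "integrable \<gamma> (\<lambda>a. N a)"
proof -
  define v where "v = (1 / sqrt (real n))\<^sup>2"
  have v: "0 < v" using n by (simp add: v_def)
  let ?e = "\<lambda>a. exp (- (- 1 / 4) * (radius {1..n} a)\<^sup>2 / v)"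
  have int: "integrable \<gamma> ?e"
    unfolding v_def by (rule gaussian_product_radius_exponential_moment(1)[OF _ sigma_pos]) auto
  have le: "norm (N a) \<le> norm (sqrt (real n) * (1 + 4 * v) * ?e a)" for a
  proof -
    let ?r = "radius {1..n} a"
    have "?r \<le> 1 + ?r\<^sup>2"
    proof (cases "?r \<le> 1")
      case False
      then have "?r * 1 \<le> ?r * ?r" by (intro mult_left_mono) auto
      then show ?thesis by (simp add: power2_eq_square)
    qed (simp add: add_increasing2)
    also have "\<dots> \<le> (1 + 4 * v) * (1 + ?r\<^sup>2 / (4 * v))" using v by (simp add: field_simps)
    also have "\<dots> \<le> (1 + 4 * v) * ?e a"
      using v exp_ge_add_one_self[of "?r\<^sup>2 / (4 * v)"] by (intro mult_left_mono) (simp_all add: mult.commute)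
    finally have "sqrt (real n) * ?r \<le> sqrt (real n) * ((1 + 4 * v) * ?e a)" by (intro mult_left_mono) auto
    then show ?thesis using sphere_norm_le_radius[of a] sphere_norm_nonneg[of a] v by (simp add: abs_mult mult.assoc)
  qed
  show ?thesis
  proof (rule Bochner_Integration.integrable_bound)
    show "integrable \<gamma> (\<lambda>a. sqrt (real n) * (1 + 4 * v) * ?e a)" using int by simp
    show "(\<lambda>a. N a) \<in> borel_measurable \<gamma>"
      using borel_measurable_sphere_norm by (simp add: measurable_cong_sets[OF sets_gaussian_product refl])
  qed (rule AE_I2[OF le])
qed

lemma gaussian_norm_upper_tail:
  assumes s: "0 < s" "s < 1" and t: "0 < t" and mean: "(\<integral>a. N a \<partial>\<gamma>) \<le> m"
  shows "measure \<gamma> {a \<in> {1..n} \<rightarrow>\<^sub>E UNIV. m + t \<le> N a} \<le> exp (- (s * t\<^sup>2 / 2))"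
proof -
  have "measure \<gamma> {a \<in> {1..n} \<rightarrow>\<^sub>E UNIV. m + t \<le> N a}
    \<le> exp (- (s * t\<^sup>2 / (2 * (sqrt (real n))\<^sup>2 * (1 / sqrt (real n))\<^sup>2)))"
    by (rule gaussian_lipschitz_tail[OF _ s sigma_pos _ t borel_measurable_sphere_norm integrable_sphere_norm
          sphere_norm_nonneg sphere_norm_lipschitz mean]) (use n in auto)
  also have "2 * (sqrt (real n))\<^sup>2 * (1 / sqrt (real n))\<^sup>2 = 2" using n by (simp add: power_divide)
  finally show ?thesis .
qed

section \<open>Chebyshev bound for small sup norms\<close>

lemma gaussian_cosh_linear:
  fixes b :: "nat \<Rightarrow> real"
  shows "integrable \<gamma> (\<lambda>a. cosh (\<Sum>m=1..n. b m * a m))"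
    and "(\<integral>a. cosh (\<Sum>m=1..n. b m * a m) \<partial>\<gamma>) = exp ((\<Sum>m=1..n. (b m)\<^sup>2) / (2 * real n))"
proof -
  have c: "cosh (\<Sum>m=1..n. b m * a m) = (exp (\<Sum>m=1..n. b m * a m) + exp (\<Sum>m=1..n. (- b m) * a m)) / 2" for a
    unfolding cosh_field_def by (simp add: sum_negf)
  note e = gaussian_product_exponential_moment[OF finite_atLeastAtMost sigma_pos]
  show "integrable \<gamma> (\<lambda>a. cosh (\<Sum>m=1..n. b m * a m))"
    unfolding c by (intro integrable_divide Bochner_Integration.integrable_add e)
  have "(\<integral>a. cosh (\<Sum>m=1..n. b m * a m) \<partial>\<gamma>)
    = ((\<integral>a. exp (\<Sum>m=1..n. b m * a m) \<partial>\<gamma>) + (\<integral>a. exp (\<Sum>m=1..n. (- b m) * a m) \<partial>\<gamma>)) / 2"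
    unfolding c integral_divide_zero by (subst Bochner_Integration.integral_add[OF e(1) e(1)]) simp
  also have "\<dots> = exp ((\<Sum>m=1..n. (b m)\<^sup>2) / (2 * real n))"
    unfolding e(2) sigma_square by simp
  finally show "(\<integral>a. cosh (\<Sum>m=1..n. b m * a m) \<partial>\<gamma>) = exp ((\<Sum>m=1..n. (b m)\<^sup>2) / (2 * real n))" .
qed

text \<open>The correlation at two points of the sphere of the Gaussian field with coefficient variance \<open>1 / n\<close>.\<close>

private definition "corr x y = (\<Sum>m=1..n. Y m x / real n * Y m y)"

lemma abs_corr_le_1:
  assumes "x \<in> sphere 0 1" "y \<in> sphere 0 1"
  shows "\<bar>corr x y\<bar> \<le> 1"
proof -
  have "\<bar>corr x y\<bar> \<le> sqrt (real n) * radius {1..n} (\<lambda>m. Y m x / real n)"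
    unfolding corr_def by (rule lincomb_bound[OF Y assms(2)])
  also have "radius {1..n} (\<lambda>m. Y m x / real n) = sqrt (real n) / real n"
    unfolding radius_def power_divide sum_divide_distrib[symmetric] orthonormal_basis_sum_squares[OF Y assms(1)]
    by (simp add: real_sqrt_divide)
  finally show ?thesis using n by simp
qed

lemma integral_corr_square:
  assumes "x \<in> sphere 0 1"
  shows "(\<integral>y. (corr x y)\<^sup>2 \<partial>sphere_measure) = 1 / real n"
proof -
  have "(\<integral>y. (corr x y)\<^sup>2 \<partial>sphere_measure) = (\<Sum>m=1..n. (Y m x / real n) * (Y m x / real n))"
    unfolding corr_def power2_eq_square by (rule orthonormal_basis_integral_product[OF Y])
  also have "\<dots> = (\<Sum>m=1..n. (Y m x)\<^sup>2) / (real n)\<^sup>2"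
    by (simp add: sum_divide_distrib power2_eq_square)
  also have "\<dots> = 1 / real n"
    unfolding orthonormal_basis_sum_squares[OF Y assms] using n by (simp add: power2_eq_square)
  finally show ?thesis .
qed

lemma gaussian_cosh_moment:
  assumes x: "x \<in> sphere 0 1"
  shows "integrable \<gamma> (\<lambda>a. cosh (l * h a x))" "(\<integral>a. cosh (l * h a x) \<partial>\<gamma>) = exp (l\<^sup>2 / 2)"
proof -
  have eq: "l * h a x = (\<Sum>m=1..n. (l * Y m x) * a m)" for a by (simp add: sum_distrib_left mult_ac)
  show "integrable \<gamma> (\<lambda>a. cosh (l * h a x))" unfolding eq by (rule gaussian_cosh_linear)
  show "(\<integral>a. cosh (l * h a x) \<partial>\<gamma>) = exp (l\<^sup>2 / 2)"
    unfolding eq gaussian_cosh_linear(2) power_mult_distrib sum_distrib_left[symmetric]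
      orthonormal_basis_sum_squares[OF Y x] using n by simp
qed

text \<open>Write the product as the mean of \<open>cosh\<close> at the sum and at the difference of the two normal variables;
  these have variances \<open>2 * l\<^sup>2 * (1 + corr x y)\<close> and \<open>2 * l\<^sup>2 * (1 - corr x y)\<close>.\<close>

lemma gaussian_cosh_product_moment:
  assumes x: "x \<in> sphere 0 1" and y: "y \<in> sphere 0 1"
  shows "integrable \<gamma> (\<lambda>a. cosh (l * h a x) * cosh (l * h a y))"
    "(\<integral>a. cosh (l * h a x) * cosh (l * h a y) \<partial>\<gamma>) = exp (l\<^sup>2) * cosh (l\<^sup>2 * corr x y)"
proof -
  have eq: "cosh (l * h a x) * cosh (l * h a y) =
     (cosh (\<Sum>m=1..n. (l * (Y m x + Y m y)) * a m) + cosh (\<Sum>m=1..n. (l * (Y m x - Y m y)) * a m)) / 2" for a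
  proof -
    have "(\<Sum>m=1..n. (l * (Y m x + Y m y)) * a m) = l * h a x + l * h a y"
      "(\<Sum>m=1..n. (l * (Y m x - Y m y)) * a m) = l * h a x - l * h a y"
      by (simp_all add: sum_distrib_left sum.distrib[symmetric] sum_subtractf[symmetric] algebra_simps)
    then show ?thesis by (simp only: cosh_add cosh_diff) simp
  qed
  have xy: "(\<Sum>m=1..n. Y m x * Y m y) = real n * corr x y"
    unfolding corr_def sum_distrib_left using n by (intro sum.cong) auto
  have sq: "(\<Sum>m=1..n. (l * (Y m x + Y m y))\<^sup>2) = 2 * real n * (l\<^sup>2 + l\<^sup>2 * corr x y)"
    "(\<Sum>m=1..n. (l * (Y m x - Y m y))\<^sup>2) = 2 * real n * (l\<^sup>2 - l\<^sup>2 * corr x y)"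
  proof -
    have "(\<Sum>m=1..n. (l * (Y m x + Y m y))\<^sup>2) =
        l\<^sup>2 * ((\<Sum>m=1..n. (Y m x)\<^sup>2) + (\<Sum>m=1..n. (Y m y)\<^sup>2) + 2 * (\<Sum>m=1..n. Y m x * Y m y))"
      by (simp only: sum_distrib_left sum.distrib[symmetric]) (simp add: power2_eq_square algebra_simps)
    then show "(\<Sum>m=1..n. (l * (Y m x + Y m y))\<^sup>2) = 2 * real n * (l\<^sup>2 + l\<^sup>2 * corr x y)"
      unfolding xy orthonormal_basis_sum_squares[OF Y x] orthonormal_basis_sum_squares[OF Y y]
      by (simp add: algebra_simps)
    have "(\<Sum>m=1..n. (l * (Y m x - Y m y))\<^sup>2) =
        l\<^sup>2 * ((\<Sum>m=1..n. (Y m x)\<^sup>2) + (\<Sum>m=1..n. (Y m y)\<^sup>2) - 2 * (\<Sum>m=1..n. Y m x * Y m y))"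
      by (simp only: sum_distrib_left sum.distrib[symmetric] sum_subtractf[symmetric])
         (simp add: power2_eq_square algebra_simps)
    then show "(\<Sum>m=1..n. (l * (Y m x - Y m y))\<^sup>2) = 2 * real n * (l\<^sup>2 - l\<^sup>2 * corr x y)"
      unfolding xy orthonormal_basis_sum_squares[OF Y x] orthonormal_basis_sum_squares[OF Y y]
      by (simp add: algebra_simps)
  qed
  note i = gaussian_cosh_linear
  show "integrable \<gamma> (\<lambda>a. cosh (l * h a x) * cosh (l * h a y))"
    unfolding eq by (intro integrable_divide Bochner_Integration.integrable_add i)
  have "(\<integral>a. cosh (l * h a x) * cosh (l * h a y) \<partial>\<gamma>) =
    (exp (2 * real n * (l\<^sup>2 + l\<^sup>2 * corr x y) / (2 * real n)) + exp (2 * real n * (l\<^sup>2 - l\<^sup>2 * corr x y) / (2 * real n))) / 2"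
    unfolding eq integral_divide_zero by (subst Bochner_Integration.integral_add[OF i(1) i(1)]) (simp only: i(2) sq)
  also have "\<dots> = (exp (l\<^sup>2 + l\<^sup>2 * corr x y) + exp (l\<^sup>2 - l\<^sup>2 * corr x y)) / 2" using n by simp
  also have "\<dots> = exp (l\<^sup>2) * cosh (l\<^sup>2 * corr x y)"
    by (simp add: cosh_field_def exp_add exp_diff exp_minus field_simps)
  finally show "(\<integral>a. cosh (l * h a x) * cosh (l * h a y) \<partial>\<gamma>) = exp (l\<^sup>2) * cosh (l\<^sup>2 * corr x y)" .
qed

private definition "cosh_mean l a = (\<integral>x. cosh (l * h a x) \<partial>sphere_measure)"

lemma nn_integral_cosh_sphere: "(\<integral>\<^sup>+x. ennreal (cosh (l * h a x)) \<partial>sphere_measure) = ennreal (cosh_mean l a)"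
proof -
  have "continuous_on (sphere 0 1) (\<lambda>x. cosh (l * h a x))"
    by (intro continuous_intros orthonormal_basis_continuous[OF Y])
  then show ?thesis unfolding cosh_mean_def
    by (intro nn_integral_eq_integral integrable_sphere_measure AE_I2) auto
qed

lemma measurable_cosh_joint:
  "(\<lambda>p. cosh (l * h (fst p) (snd p))) \<in> borel_measurable (\<gamma> \<Otimes>\<^sub>M (sphere_measure :: 'a measure))"
proof -
  have [measurable]: "(\<lambda>p. fst p m) \<in> borel_measurable (\<gamma> \<Otimes>\<^sub>M (sphere_measure :: 'a measure))" if "m \<in> {1..n}" for m
  proof -
    have "(\<lambda>a. a m) \<in> borel_measurable \<gamma>"
      unfolding measurable_cong_sets[OF sets_gaussian_product refl] using that by (rule measurable_component_singleton)
    from measurable_compose[OF measurable_fst this] show ?thesis .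
  qed
  have [measurable]: "(\<lambda>p. Y m (snd p)) \<in> borel_measurable (\<gamma> \<Otimes>\<^sub>M sphere_measure)" if "m \<in> {1..n}" for m
    using measurable_compose[OF measurable_snd borel_measurable_sphere_measure[OF orthonormal_basis_continuous[OF Y that]]] .
  have "(\<lambda>p. h (fst p) (snd p)) \<in> borel_measurable (\<gamma> \<Otimes>\<^sub>M (sphere_measure :: 'a measure))"
    by (intro borel_measurable_sum borel_measurable_times) measurable
  then show ?thesis unfolding cosh_field_def by measurable
qed

lemma measurable_cosh_mean: "cosh_mean l \<in> borel_measurable \<gamma>"
proof -
  interpret S: prob_space "sphere_measure :: 'a measure" by (rule prob_space_sphere_measure)
  show ?thesis unfolding cosh_mean_def
    by (rule S.borel_measurable_lebesgue_integral) (use measurable_cosh_joint in \<open>simp add: case_prod_beta'\<close>)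
qed

lemma cosh_mean_nonneg: "0 \<le> cosh_mean l a"
  unfolding cosh_mean_def by (rule integral_nonneg_AE) auto

text \<open>Tonelli's theorem moves the Gaussian expectation inside the integrals over the sphere. For the second
  moment this leaves the integral of \<open>exp (l\<^sup>2) * cosh (l\<^sup>2 * corr x y)\<close>, which is controlled by that of the
  squared correlation.\<close>

lemma cosh_mean_moments:
  shows "(\<integral>\<^sup>+a. ennreal (cosh_mean l a) \<partial>\<gamma>) = ennreal (exp (l\<^sup>2 / 2))"
    and "(\<integral>\<^sup>+a. ennreal ((cosh_mean l a)\<^sup>2) \<partial>\<gamma>) \<le> ennreal (exp (l\<^sup>2) * (1 + exp (l\<^sup>2) / real n))"
proof -
  let ?S = "sphere_measure :: 'a measure"
  interpret S: prob_space ?S by (rule prob_space_sphere_measure)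
  interpret P: prob_space \<gamma> by (rule prob_space_gaussian_product[OF sigma_pos])
  interpret PS: pair_sigma_finite \<gamma> ?S ..
  let ?c = "\<lambda>a x. ennreal (cosh (l * h a x))"
  have cm: "(\<lambda>(a, x). ?c a x) \<in> borel_measurable (\<gamma> \<Otimes>\<^sub>M ?S)"
    using measurable_cosh_joint by (simp add: case_prod_beta')
  have Zm: "(\<lambda>p. ennreal (cosh_mean l (fst p))) \<in> borel_measurable (\<gamma> \<Otimes>\<^sub>M ?S)"
    using measurable_compose[OF measurable_fst measurable_cosh_mean] by measurable
  have cy: "?c a \<in> borel_measurable ?S" for a
    by (intro measurable_compose[OF _ measurable_ennreal] borel_measurable_sphere_measure)
       (intro continuous_intros orthonormal_basis_continuous[OF Y])
  have "(\<integral>\<^sup>+a. ennreal (cosh_mean l a) \<partial>\<gamma>) = (\<integral>\<^sup>+a. \<integral>\<^sup>+x. ?c a x \<partial>?S \<partial>\<gamma>)"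
    by (simp only: nn_integral_cosh_sphere)
  also have "\<dots> = (\<integral>\<^sup>+x. \<integral>\<^sup>+a. ?c a x \<partial>\<gamma> \<partial>?S)" by (rule PS.Fubini'[OF cm, symmetric])
  also have "\<dots> = (\<integral>\<^sup>+x. ennreal (exp (l\<^sup>2 / 2)) \<partial>?S)"
  proof (rule nn_integral_cong)
    fix x assume "x \<in> space ?S"
    then have x: "x \<in> sphere 0 1" by (simp add: space_sphere_measure)
    show "(\<integral>\<^sup>+a. ?c a x \<partial>\<gamma>) = ennreal (exp (l\<^sup>2 / 2))"
      unfolding gaussian_cosh_moment(2)[OF x, symmetric]
      by (rule nn_integral_eq_integral[OF gaussian_cosh_moment(1)[OF x]]) simp
  qed
  finally show "(\<integral>\<^sup>+a. ennreal (cosh_mean l a) \<partial>\<gamma>) = ennreal (exp (l\<^sup>2 / 2))" by (simp add: S.emeasure_space_1)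
  have "(\<integral>\<^sup>+a. ennreal ((cosh_mean l a)\<^sup>2) \<partial>\<gamma>) = (\<integral>\<^sup>+a. \<integral>\<^sup>+x. ?c a x * ennreal (cosh_mean l a) \<partial>?S \<partial>\<gamma>)"
    unfolding nn_integral_multc[OF cy] nn_integral_cosh_sphere power2_eq_square
    by (intro nn_integral_cong ennreal_mult cosh_mean_nonneg)
  also have "\<dots> = (\<integral>\<^sup>+x. \<integral>\<^sup>+a. ?c a x * ennreal (cosh_mean l a) \<partial>\<gamma> \<partial>?S)"
    by (rule PS.Fubini'[symmetric]) (use cm Zm in \<open>simp add: case_prod_beta'\<close>)
  also have "\<dots> = (\<integral>\<^sup>+x. \<integral>\<^sup>+a. \<integral>\<^sup>+y. ?c a x * ?c a y \<partial>?S \<partial>\<gamma> \<partial>?S)"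
    unfolding nn_integral_cmult[OF cy] nn_integral_cosh_sphere ..
  also have "\<dots> = (\<integral>\<^sup>+x. \<integral>\<^sup>+y. \<integral>\<^sup>+a. ?c a x * ?c a y \<partial>\<gamma> \<partial>?S \<partial>?S)"
  proof (rule nn_integral_cong)
    fix x assume "x \<in> space ?S"
    have "(\<lambda>a. ?c a x) \<in> borel_measurable \<gamma>"
      using measurable_compose[OF measurable_Pair2'[OF \<open>x \<in> space ?S\<close>] cm] by simp
    from measurable_compose[OF measurable_fst this]
    have cx: "(\<lambda>p. ?c (fst p) x) \<in> borel_measurable (\<gamma> \<Otimes>\<^sub>M ?S)" .
    show "(\<integral>\<^sup>+a. \<integral>\<^sup>+y. ?c a x * ?c a y \<partial>?S \<partial>\<gamma>) = (\<integral>\<^sup>+y. \<integral>\<^sup>+a. ?c a x * ?c a y \<partial>\<gamma> \<partial>?S)"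
      by (rule PS.Fubini'[symmetric]) (use cx cm in \<open>simp add: case_prod_beta'\<close>)
  qed
  also have "\<dots> \<le> (\<integral>\<^sup>+x. ennreal (exp (l\<^sup>2) * (1 + exp (l\<^sup>2) / real n)) \<partial>?S)"
  proof (rule nn_integral_mono)
    fix x assume "x \<in> space ?S"
    then have x: "x \<in> sphere 0 1" by (simp add: space_sphere_measure)
    have "(\<integral>\<^sup>+y. \<integral>\<^sup>+a. ?c a x * ?c a y \<partial>\<gamma> \<partial>?S) \<le> (\<integral>\<^sup>+y. ennreal (exp (l\<^sup>2) * (1 + (corr x y)\<^sup>2 * exp (l\<^sup>2))) \<partial>?S)"
    proof (rule nn_integral_mono)
      fix y assume "y \<in> space ?S"
      then have y: "y \<in> sphere 0 1" by (simp add: space_sphere_measure)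
      have "(\<integral>\<^sup>+a. ?c a x * ?c a y \<partial>\<gamma>) = (\<integral>\<^sup>+a. ennreal (cosh (l * h a x) * cosh (l * h a y)) \<partial>\<gamma>)"
        by (simp add: ennreal_mult)
      also have "\<dots> = ennreal (exp (l\<^sup>2) * cosh (l\<^sup>2 * corr x y))"
        unfolding gaussian_cosh_product_moment(2)[OF x y, symmetric]
        by (rule nn_integral_eq_integral[OF gaussian_cosh_product_moment(1)[OF x y]]) simp
      also have "\<dots> \<le> ennreal (exp (l\<^sup>2) * (1 + (corr x y)\<^sup>2 * exp (l\<^sup>2)))"
        by (intro ennreal_leI mult_left_mono cosh_mult_le abs_corr_le_1 x y) auto
      finally show "(\<integral>\<^sup>+a. ?c a x * ?c a y \<partial>\<gamma>) \<le> ennreal (exp (l\<^sup>2) * (1 + (corr x y)\<^sup>2 * exp (l\<^sup>2)))" .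
    qed
    also have "\<dots> = ennreal (\<integral>y. exp (l\<^sup>2) * (1 + (corr x y)\<^sup>2 * exp (l\<^sup>2)) \<partial>?S)"
      unfolding corr_def
      by (intro nn_integral_eq_integral integrable_sphere_measure AE_I2)
         (auto intro!: continuous_intros orthonormal_basis_continuous[OF Y] mult_nonneg_nonneg add_nonneg_nonneg)
    also have "(\<integral>y. exp (l\<^sup>2) * (1 + (corr x y)\<^sup>2 * exp (l\<^sup>2)) \<partial>?S) = exp (l\<^sup>2) * (1 + 1 / real n * exp (l\<^sup>2))"
    proof -
      have "integrable ?S (\<lambda>y. (corr x y)\<^sup>2)"
        unfolding corr_def
        by (intro integrable_sphere_measure continuous_intros orthonormal_basis_continuous[OF Y])
      then show ?thesis by (simp add: integral_corr_square[OF x] S.prob_space)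
    qed
    finally show "(\<integral>\<^sup>+y. \<integral>\<^sup>+a. ?c a x * ?c a y \<partial>\<gamma> \<partial>?S) \<le> ennreal (exp (l\<^sup>2) * (1 + exp (l\<^sup>2) / real n))" by simp
  qed
  also have "\<dots> = ennreal (exp (l\<^sup>2) * (1 + exp (l\<^sup>2) / real n))" by (simp add: S.emeasure_space_1)
  finally show "(\<integral>\<^sup>+a. ennreal ((cosh_mean l a)\<^sup>2) \<partial>\<gamma>) \<le> ennreal (exp (l\<^sup>2) * (1 + exp (l\<^sup>2) / real n))" .
qed

text \<open>A small sup norm forces \<open>cosh_mean l\<close> below half of its mean, which Chebyshev's inequality makes unlikely.\<close>

lemma gaussian_norm_lower_tail:
  assumes l: "0 \<le> l" and t: "l * t + ln 2 \<le> l\<^sup>2 / 2"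
  shows "measure \<gamma> {a \<in> {1..n} \<rightarrow>\<^sub>E UNIV. N a \<le> t} \<le> 4 * exp (l\<^sup>2) / real n"
proof -
  let ?S = "sphere_measure :: 'a measure"
  interpret S: prob_space ?S by (rule prob_space_sphere_measure)
  interpret P: prob_space \<gamma> by (rule prob_space_gaussian_product[OF sigma_pos])
  define M where "M = exp (l\<^sup>2 / 2)"
  have M: "0 < M" and M2: "M\<^sup>2 = exp (l\<^sup>2)" by (simp_all add: M_def exp_double[symmetric])
  note [measurable] = measurable_cosh_mean
  have i1: "integrable \<gamma> (cosh_mean l)"
    by (rule integrableI_nonneg[OF measurable_cosh_mean AE_I2[OF cosh_mean_nonneg]]) (simp only: cosh_mean_moments(1), simp)
  have E1: "(\<integral>a. cosh_mean l a \<partial>\<gamma>) = M"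
  proof -
    have "ennreal (\<integral>a. cosh_mean l a \<partial>\<gamma>) = ennreal M"
      unfolding M_def cosh_mean_moments(1)[symmetric]
      by (rule nn_integral_eq_integral[symmetric, OF i1 AE_I2[OF cosh_mean_nonneg]])
    moreover have "0 \<le> (\<integral>a. cosh_mean l a \<partial>\<gamma>)" by (rule integral_nonneg_AE[OF AE_I2[OF cosh_mean_nonneg]])
    ultimately show ?thesis using M by (simp only: ennreal_inj less_imp_le)
  qed
  have i2: "integrable \<gamma> (\<lambda>a. (cosh_mean l a)\<^sup>2)"
    by (rule integrableI_nonneg[OF borel_measurable_power[OF measurable_cosh_mean] AE_I2])
       (simp, simp only: infinity_ennreal_def le_less_trans[OF cosh_mean_moments(2) ennreal_less_top])
  have E2: "(\<integral>a. (cosh_mean l a)\<^sup>2 \<partial>\<gamma>) \<le> M\<^sup>2 * (1 + M\<^sup>2 / real n)"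
  proof -
    have "ennreal (\<integral>a. (cosh_mean l a)\<^sup>2 \<partial>\<gamma>) = (\<integral>\<^sup>+a. ennreal ((cosh_mean l a)\<^sup>2) \<partial>\<gamma>)"
      by (rule nn_integral_eq_integral[symmetric, OF i2 AE_I2]) simp
    also note cosh_mean_moments(2)
    finally show ?thesis unfolding M2 by (rule ennreal_le_iff[THEN iffD1, rotated]) (simp add: add_nonneg_nonneg)
  qed
  have i3: "integrable \<gamma> (\<lambda>a. (cosh_mean l a - M)\<^sup>2)"
    unfolding power2_diff using i1 i2 by (simp del: One_nat_def)
  have "(\<integral>a. (cosh_mean l a - M)\<^sup>2 \<partial>\<gamma>) = (\<integral>a. (cosh_mean l a)\<^sup>2 \<partial>\<gamma>) + M\<^sup>2 - 2 * M * M"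
    unfolding power2_diff using i1 i2 by (simp add: E1 P.prob_space mult_ac del: One_nat_def)
  then have var: "(\<integral>a. (cosh_mean l a - M)\<^sup>2 \<partial>\<gamma>) \<le> M\<^sup>2 * (M\<^sup>2 / real n)"
    using E2 by (simp add: power2_eq_square algebra_simps del: One_nat_def)
  have "measure \<gamma> {a \<in> {1..n} \<rightarrow>\<^sub>E UNIV. N a \<le> t} \<le> measure \<gamma> {a \<in> space \<gamma>. M\<^sup>2 / 4 \<le> (cosh_mean l a - M)\<^sup>2}"
  proof (rule P.finite_measure_mono)
    show "{a \<in> {1..n} \<rightarrow>\<^sub>E UNIV. N a \<le> t} \<subseteq> {a \<in> space \<gamma>. M\<^sup>2 / 4 \<le> (cosh_mean l a - M)\<^sup>2}"
    proof
      fix a assume a: "a \<in> {a \<in> {1..n} \<rightarrow>\<^sub>E UNIV. N a \<le> t}"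
      have "cosh_mean l a \<le> exp (l * t)"
        unfolding cosh_mean_def
      proof (rule S.integral_le_const)
        show "integrable ?S (\<lambda>x. cosh (l * h a x))"
          by (intro integrable_sphere_measure continuous_intros orthonormal_basis_continuous[OF Y])
        show "AE x in ?S. cosh (l * h a x) \<le> exp (l * t)"
        proof (rule AE_I2)
          fix x assume "x \<in> space ?S"
          then have "\<bar>h a x\<bar> \<le> t"
            using a lincomb_le_sphere_norm[of x a] unfolding space_sphere_measure mem_Collect_eq by linarith
          then have "l * \<bar>h a x\<bar> \<le> l * t" using l by (rule mult_left_mono)
          then have "\<bar>l * h a x\<bar> \<le> l * t" unfolding abs_mult abs_of_nonneg[OF l] .
          then show "cosh (l * h a x) \<le> exp (l * t)" by (rule cosh_le_exp)
        qed
      qed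
      also have "\<dots> \<le> exp (l\<^sup>2 / 2 - ln 2)" using t by simp
      also have "\<dots> = M / 2" by (simp add: M_def exp_diff)
      finally have "M / 2 \<le> M - cosh_mean l a" by simp
      then have "(M / 2)\<^sup>2 \<le> (M - cosh_mean l a)\<^sup>2" using M by (intro power_mono) auto
      then have "M\<^sup>2 / 4 \<le> (cosh_mean l a - M)\<^sup>2" by (simp add: power_divide power2_commute)
      then show "a \<in> {a \<in> space \<gamma>. M\<^sup>2 / 4 \<le> (cosh_mean l a - M)\<^sup>2}"
        using a unfolding mem_Collect_eq space_gaussian_product by blast
    qed
  qed measurable
  also have "\<dots> \<le> (\<integral>a. (cosh_mean l a - M)\<^sup>2 \<partial>\<gamma>) / (M\<^sup>2 / 4)"
    by (rule integral_Markov_inequality_measure[OF i3, where A="{}"]) (use M in auto)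
  also have "\<dots> \<le> M\<^sup>2 * (M\<^sup>2 / real n) / (M\<^sup>2 / 4)" by (rule divide_right_mono[OF var]) simp
  also have "\<dots> = 4 * exp (l\<^sup>2) / real n"
  proof -
    have "w * (w / real n) / (w / 4) = 4 * w / real n" if "w \<noteq> 0" for w :: real using that by simp
    from this[of "M\<^sup>2"] show ?thesis using M by (simp only: M2) simp
  qed
  finally show ?thesis .
qed

end

section \<open>Asymptotics along the sequence of eigenvalues\<close>

text \<open>For \<open>d = 2\<close> the dimension is \<open>2 * l + 1\<close>, so linear growth is all that holds for every \<open>d\<close>.\<close>

lemma eigenspace_dim_ge:
  assumes d: "2 \<le> d" and l: "1 \<le> l"
  shows "l \<le> eigenspace_dim d l"
proof -
  have "l = l choose (l - 1)" using l by (metis Suc_diff_1 binomial_Suc_n less_le_trans zero_less_one)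
  also have "\<dots> \<le> (l + d - 2) choose (l - 1)" using d by (intro binomial_right_mono) simp
  finally have b: "real l \<le> real ((l + d - 2) choose (l - 1))" by simp
  have "1 * real l \<le> (2 * real l + real d - 1) / real l * real ((l + d - 2) choose (l - 1))"
    using d l b by (intro mult_mono) (auto simp: field_simps)
  then have "real l \<le> real (eigenspace_dim d l)" by (simp add: real_eigenspace_dim[OF d l])
  then show ?thesis by simp
qed

text \<open>The expectation depends only on the distribution of the vector, which is that of independent normal
  coordinates.\<close>

lemma centered_gaussian_vector_expectation:
  fixes F :: "(nat \<Rightarrow> real) \<Rightarrow> real"
  assumes u: "centered_gaussian_vector \<Omega> n (1 / real n) u" and n: "1 \<le> n"
    and F: "F \<in> borel_measurable (\<Pi>\<^sub>M m\<in>{1..n}. borel)"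
  shows "(\<integral>\<omega>. F (\<lambda>m\<in>{1..n}. u m \<omega>) \<partial>\<Omega>) = (\<integral>a. F a \<partial>gaussian_product {1..n} (1 / sqrt (real n)))"
proof -
  let ?L = "\<Pi>\<^sub>M m\<in>{1..n}. lborel :: real measure"
  let ?X = "\<lambda>\<omega>. \<lambda>m\<in>{1..n}. u m \<omega>"
  have \<sigma>: "0 < 1 / sqrt (real n)" using n by simp
  note D = u[unfolded centered_gaussian_vector_def]
  have "distr \<Omega> ?L ?X = gaussian_product {1..n} (1 / sqrt (real n))"
    unfolding distributed_distr_eq_density[OF D] gaussian_product_eq_density[OF finite_atLeastAtMost \<sigma>]
    by (simp add: power_divide)
  then have "(\<integral>a. F a \<partial>gaussian_product {1..n} (1 / sqrt (real n))) = (\<integral>a. F a \<partial>distr \<Omega> ?L ?X)" by simp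
  also have "\<dots> = (\<integral>\<omega>. F (?X \<omega>) \<partial>\<Omega>)"
    by (rule integral_distr[OF distributed_measurable[OF D]])
       (use F in \<open>simp only: measurable_cong_sets[OF sets_PiM_lborel refl]\<close>)
  finally show ?thesis by simp
qed

text \<open>With \<open>s = sqrt (\<beta>' / \<beta>)\<close> the exponent \<open>\<beta>1 = s * \<beta>\<close> lies strictly between \<open>\<beta>'\<close> and \<open>\<beta>\<close>. Lowering \<open>\<beta>\<close> to \<open>\<beta>1\<close> in the
  threshold leaves room for a radius \<open>r < 1\<close>, and the concentration inequality with parameter \<open>s\<close> turns the
  remaining exponent \<open>\<beta>1\<close> into \<open>s * \<beta>1 = \<beta>'\<close>.\<close>

lemma large_sup_norm_bigo:
  fixes Y :: "nat \<Rightarrow> nat \<Rightarrow> 'a::euclidean_space \<Rightarrow> real" and dim :: "nat \<Rightarrow> nat"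
  assumes Y: "\<And>l. 1 \<le> l \<Longrightarrow> orthonormal_basis_on_sphere (dim l) (Y l) (sphere_eigenspace (c l))"
    and dim: "\<And>l. 1 \<le> l \<Longrightarrow> l \<le> dim l"
    and M: "0 < M"
    and mean: "\<And>l. 2 \<le> l \<Longrightarrow> (\<integral>a. sphere_norm (\<lambda>x. \<Sum>m=1..dim l. a m * Y l m x)
        \<partial>gaussian_product {1..dim l} (1 / sqrt (real (dim l)))) \<le> M * sqrt (ln (real l))"
    and \<beta>: "0 < \<beta>'" "\<beta>' < \<beta>"
  shows "(\<lambda>l. measure (coeff_sphere_measure (dim l)) {a \<in> coeff_sphere (dim l).
      sphere_norm (\<lambda>x. \<Sum>m=1..dim l. a m * Y l m x) \<ge> (M + sqrt (2 * \<beta>)) * sqrt (ln (real l))})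
    \<in> O(\<lambda>l. 1 / real l powr \<beta>')"
proof -
  define s where "s = sqrt (\<beta>' / \<beta>)"
  have s: "0 < s" "s < 1" using \<beta> by (auto simp: s_def)
  have s2: "s * (s * \<beta>) = \<beta>'"
  proof -
    have "s * s = \<beta>' / \<beta>" using \<beta> by (simp add: s_def)
    then show ?thesis using \<beta> by (simp add: mult.assoc[symmetric])
  qed
  define \<beta>1 where "\<beta>1 = s * \<beta>"
  have \<beta>1: "0 < \<beta>1" "\<beta>1 < \<beta>" using s \<beta> by (auto simp: \<beta>1_def)
  define r where "r = (M + sqrt (2 * \<beta>1)) / (M + sqrt (2 * \<beta>))"
  have den: "0 < M + sqrt (2 * \<beta>)" using M \<beta> by (simp add: add_pos_nonneg)
  have r: "0 < r" "r < 1" using M \<beta>1 \<beta> den by (auto simp: r_def add_pos_pos divide_less_eq)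
  obtain q where q: "q < 1" "\<And>n. 1 \<le> n \<Longrightarrow> measure (gaussian_product {1..n} (1 / sqrt (real n)))
      {a \<in> {1..n} \<rightarrow>\<^sub>E UNIV. (1 - r) * radius {1..n} a \<le> (1 - r) * r} \<le> q"
    using gaussian_radius_concentration[OF r(1) less_imp_neq[OF r(2)]] by blast
  show ?thesis
  proof (rule bigoI[where c="1 / (1 - q)"], rule eventually_mono[OF eventually_ge_at_top[of 2]])
    fix l :: nat assume l: "2 \<le> l"
    define n where "n = dim l"
    have n: "1 \<le> n" using dim[of l] l by (simp add: n_def)
    let ?G = "gaussian_product {1..n} (1 / sqrt (real n))"
    let ?N = "\<lambda>a. sphere_norm (\<lambda>x. \<Sum>m=1..n. a m * Y l m x)"
    let ?t = "(M + sqrt (2 * \<beta>)) * sqrt (ln (real l))"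
    let ?\<mu> = "measure (coeff_sphere_measure n) {a \<in> coeff_sphere n. ?t \<le> ?N a}"
    have \<sigma>: "0 < 1 / sqrt (real n)" using n by simp
    interpret P: prob_space ?G by (rule prob_space_gaussian_product[OF \<sigma>])
    have Yl: "orthonormal_basis_on_sphere n (Y l) (sphere_eigenspace (c l))" using Y l by (simp add: n_def)
    have lnl: "0 < ln (real l)" using l by simp
    have t0: "0 \<le> ?t" using den lnl by simp
    have "?\<mu> * measure ?G {a \<in> {1..n} \<rightarrow>\<^sub>E UNIV. r \<le> radius {1..n} a} \<le> measure ?G {a \<in> {1..n} \<rightarrow>\<^sub>E UNIV. ?t * r \<le> ?N a}"
      by (rule sphere_large_norm_le_gaussian[OF Yl n t0]) (use r in simp)
    also have "?t * r = M * sqrt (ln (real l)) + sqrt (2 * \<beta>1) * sqrt (ln (real l))"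
    proof -
      have "(D * x) * (R / D) = R * x" if "D \<noteq> 0" for D x R :: real using that by simp
      then show ?thesis unfolding r_def using den by (metis distrib_right less_irrefl)
    qed
    also have "measure ?G {a \<in> {1..n} \<rightarrow>\<^sub>E UNIV. M * sqrt (ln (real l)) + sqrt (2 * \<beta>1) * sqrt (ln (real l)) \<le> ?N a}
      \<le> exp (- (s * (sqrt (2 * \<beta>1) * sqrt (ln (real l)))\<^sup>2 / 2))"
      by (rule gaussian_norm_upper_tail[OF Yl n s]) (use mean[OF l] \<beta>1 lnl in \<open>simp_all only: n_def, auto\<close>)
    also have "- (s * (sqrt (2 * \<beta>1) * sqrt (ln (real l)))\<^sup>2 / 2) = - \<beta>' * ln (real l)"
      using \<beta>1 lnl s2 by (simp add: power_mult_distrib \<beta>1_def)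
    also have "exp (- \<beta>' * ln (real l)) = 1 / real l powr \<beta>'"
      using l by (simp add: powr_def exp_minus divide_inverse)
    finally have up: "?\<mu> * measure ?G {a \<in> {1..n} \<rightarrow>\<^sub>E UNIV. r \<le> radius {1..n} a} \<le> 1 / real l powr \<beta>'" .
    have "1 - q \<le> measure ?G {a \<in> {1..n} \<rightarrow>\<^sub>E UNIV. r \<le> radius {1..n} a}"
    proof -
      have sp: "space ?G = {1..n} \<rightarrow>\<^sub>E UNIV" by (rule space_gaussian_product)
      have m1: "{a \<in> space ?G. (1 - r) * radius {1..n} a \<le> (1 - r) * r} \<in> sets ?G" by measurable
      have m2: "{a \<in> space ?G. r \<le> radius {1..n} a} \<in> sets ?G" by measurable
      have "1 - q \<le> 1 - measure ?G {a \<in> space ?G. (1 - r) * radius {1..n} a \<le> (1 - r) * r}"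
        using q(2)[OF n] by (simp only: sp) 
      also have "\<dots> = measure ?G (space ?G - {a \<in> space ?G. (1 - r) * radius {1..n} a \<le> (1 - r) * r})"
        using m1 by (rule P.prob_compl[symmetric])
      also have "\<dots> \<le> measure ?G {a \<in> space ?G. r \<le> radius {1..n} a}"
        by (rule P.finite_measure_mono[OF _ m2]) (use r in \<open>auto simp: not_le\<close>)
      finally show ?thesis by (simp only: sp)
    qed
    then have "?\<mu> * (1 - q) \<le> 1 / real l powr \<beta>'"
      by (rule order_trans[OF mult_left_mono[OF _ measure_nonneg] up])
    then have "?\<mu> \<le> 1 / real l powr \<beta>' / (1 - q)"
      using q(1) by (simp only: pos_le_divide_eq diff_gt_0_iff_gt)
    also have "\<dots> = 1 / (1 - q) * norm (1 / real l powr \<beta>')"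
    proof -
      have "x / D = 1 / D * x" for x D :: real by simp
      moreover have "norm (1 / real l powr \<beta>') = 1 / real l powr \<beta>'" by simp
      ultimately show ?thesis by metis
    qed
    finally show "norm (measure (coeff_sphere_measure (dim l)) {a \<in> coeff_sphere (dim l).
        ?t \<le> sphere_norm (\<lambda>x. \<Sum>m=1..dim l. a m * Y l m x)}) \<le> 1 / (1 - q) * norm (1 / real l powr \<beta>')"
      by (simp only: n_def real_norm_def abs_of_nonneg[OF measure_nonneg])
  qed
qed

text \<open>The radius is kept below \<open>6 / 5\<close>, and \<open>exp (k\<^sup>2) = sqrt l\<close> for the parameter \<open>k\<close> of the lower tail bound. As
  \<open>K\<^sup>2 < 1 / 12\<close>, the product of \<open>k\<close> and the threshold \<open>6 / 5 * K * sqrt (ln l)\<close> is then at most \<open>49 / 200 * ln l\<close>, while \<open>k\<^sup>2 / 2 = ln l / 4\<close>; the difference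
  exceeds \<open>ln 2\<close> for large \<open>l\<close>.\<close>

lemma small_sup_norm_bigo:
  fixes Y :: "nat \<Rightarrow> nat \<Rightarrow> 'a::euclidean_space \<Rightarrow> real" and dim :: "nat \<Rightarrow> nat"
  assumes Y: "\<And>l. 1 \<le> l \<Longrightarrow> orthonormal_basis_on_sphere (dim l) (Y l) (sphere_eigenspace (c l))"
    and dim: "\<And>l. 1 \<le> l \<Longrightarrow> l \<le> dim l"
    and K: "0 < K" "K\<^sup>2 < 1 / 12"
  shows "(\<lambda>l. measure (coeff_sphere_measure (dim l)) {a \<in> coeff_sphere (dim l).
      sphere_norm (\<lambda>x. \<Sum>m=1..dim l. a m * Y l m x) \<le> K * sqrt (ln (real l))})
    \<in> O(\<lambda>l. real l powr (- 1 / 2))"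
proof -
  define r where "r = (6 / 5 :: real)"
  have r: "0 < r" "r \<noteq> 1" by (simp_all add: r_def)
  obtain q where q: "q < 1" "\<And>n. 1 \<le> n \<Longrightarrow> measure (gaussian_product {1..n} (1 / sqrt (real n)))
      {a \<in> {1..n} \<rightarrow>\<^sub>E UNIV. (1 - r) * radius {1..n} a \<le> (1 - r) * r} \<le> q"
    using gaussian_radius_concentration[OF r] by blast
  have Ks: "K * r / sqrt 2 \<le> 49 / 200"
  proof -
    have "(K * r / sqrt 2)\<^sup>2 \<le> (49 / 200)\<^sup>2"
      using K by (simp add: power_mult_distrib power_divide r_def)
    then show ?thesis by (rule power2_le_imp_le) simp
  qed
  have "eventually (\<lambda>l. exp (200 * ln 2) \<le> real l) sequentially"
    using filterlim_real_sequentially by (rule filterlim_at_top[THEN iffD1, rule_format])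
  then show ?thesis
  proof (intro bigoI[where c="4 / (1 - q)"], elim eventually_mono)
    fix l :: nat assume l': "exp (200 * ln 2) \<le> real l"
    have "(1::real) < exp (200 * ln 2)" by simp
    then have l: "1 < real l" using l' by linarith
    then have l1: "1 \<le> l" by simp
    have lnl: "200 * ln 2 \<le> ln (real l)" using l' l by (subst ln_ge_iff) auto
    have lnl0: "0 < ln (real l)" using l by simp
    define n where "n = dim l"
    have nl: "l \<le> n" using dim[OF l1] by (simp add: n_def)
    have n: "1 \<le> n" using nl l1 by simp
    let ?G = "gaussian_product {1..n} (1 / sqrt (real n))"
    let ?N = "\<lambda>a. sphere_norm (\<lambda>x. \<Sum>m=1..n. a m * Y l m x)"
    let ?t = "K * sqrt (ln (real l))"
    let ?\<mu> = "measure (coeff_sphere_measure n) {a \<in> coeff_sphere n. ?N a \<le> ?t}"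
    have \<sigma>: "0 < 1 / sqrt (real n)" using n by simp
    interpret P: prob_space ?G by (rule prob_space_gaussian_product[OF \<sigma>])
    have Yl: "orthonormal_basis_on_sphere n (Y l) (sphere_eigenspace (c l))" using Y l1 by (simp add: n_def)
    have t0: "0 \<le> ?t" using K lnl0 by simp
    define k where "k = sqrt (ln (real l) / 2)"
    have k2: "k\<^sup>2 = ln (real l) / 2" using lnl0 by (simp add: k_def)
    have "k * (?t * r) = (K * r / sqrt 2) * ln (real l)"
      using lnl0 by (simp add: k_def real_sqrt_divide)
    also have "\<dots> \<le> 49 / 200 * ln (real l)" using Ks lnl0 by (intro mult_right_mono) auto
    finally have cond: "k * (?t * r) + ln 2 \<le> k\<^sup>2 / 2" using lnl by (simp add: k2)
    have "?\<mu> * measure ?G {a \<in> {1..n} \<rightarrow>\<^sub>E UNIV. radius {1..n} a \<le> r} \<le> measure ?G {a \<in> {1..n} \<rightarrow>\<^sub>E UNIV. ?N a \<le> ?t * r}"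
      by (rule sphere_small_norm_le_gaussian[OF Yl n t0])
    also have "\<dots> \<le> 4 * exp (k\<^sup>2) / real n"
      by (rule gaussian_norm_lower_tail[OF Yl n _ cond]) (use lnl0 in \<open>simp add: k_def\<close>)
    also have "\<dots> \<le> 4 * exp (k\<^sup>2) / real l" using nl l by (intro divide_left_mono) auto
    also have "\<dots> = 4 * real l powr (- 1 / 2)"
    proof -
      have "exp (k\<^sup>2) / real l = exp (ln (real l) / 2) / exp (ln (real l))"
        using l by (simp add: k2)
      also have "\<dots> = exp (ln (real l) / 2 - ln (real l))" by (simp only: exp_diff)
      also have "\<dots> = real l powr (- 1 / 2)" using l by (simp add: powr_def)
      finally show ?thesis by simp
    qed
    finally have up: "?\<mu> * measure ?G {a \<in> {1..n} \<rightarrow>\<^sub>E UNIV. radius {1..n} a \<le> r} \<le> 4 * real l powr (- 1 / 2)" .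
    have "1 - q \<le> measure ?G {a \<in> {1..n} \<rightarrow>\<^sub>E UNIV. radius {1..n} a \<le> r}"
    proof -
      have sp: "space ?G = {1..n} \<rightarrow>\<^sub>E UNIV" by (rule space_gaussian_product)
      have m1: "{a \<in> space ?G. (1 - r) * radius {1..n} a \<le> (1 - r) * r} \<in> sets ?G" by measurable
      have m2: "{a \<in> space ?G. radius {1..n} a \<le> r} \<in> sets ?G" by measurable
      have "1 - q \<le> 1 - measure ?G {a \<in> space ?G. (1 - r) * radius {1..n} a \<le> (1 - r) * r}"
        using q(2)[OF n] by (simp only: sp)
      also have "\<dots> = measure ?G (space ?G - {a \<in> space ?G. (1 - r) * radius {1..n} a \<le> (1 - r) * r})"
        using m1 by (rule P.prob_compl[symmetric])
      also have "\<dots> \<le> measure ?G {a \<in> space ?G. radius {1..n} a \<le> r}"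
        by (rule P.finite_measure_mono[OF _ m2]) (auto simp: not_le r_def)
      finally show ?thesis by (simp only: sp)
    qed
    then have "?\<mu> * (1 - q) \<le> 4 * real l powr (- 1 / 2)"
      by (rule order_trans[OF mult_left_mono[OF _ measure_nonneg] up])
    then have "?\<mu> \<le> 4 / (1 - q) * real l powr (- 1 / 2)" using q(1) by (simp add: field_simps)
    then show "norm (measure (coeff_sphere_measure (dim l)) {a \<in> coeff_sphere (dim l).
        sphere_norm (\<lambda>x. \<Sum>m=1..dim l. a m * Y l m x) \<le> ?t}) \<le> 4 / (1 - q) * norm (real l powr (- 1 / 2))"
      by (simp only: n_def real_norm_def abs_of_nonneg[OF measure_nonneg] abs_of_nonneg[OF powr_ge_zero])
  qed
qed

lemma powr_minus_half_bigo:
  fixes e :: real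
  assumes e: "e < 1 / 2"
  shows "(\<lambda>l::nat. real l powr (- 1 / 2)) \<in> O(\<lambda>l. 1 / (real l powr e * ln (real l)))"
proof (rule bigoI[where c="1 / (1 / 2 - e)"], rule eventually_mono[OF eventually_ge_at_top[of 2]])
  fix l :: nat assume l: "2 \<le> l"
  have lnl: "0 < ln (real l)" using l by simp
  have p: "0 < real l powr e" using l by simp
  have "real l powr (- 1 / 2) * (real l powr e * ln (real l)) \<le> real l powr (- 1 / 2) * (real l powr e * (real l powr (1 / 2 - e) / (1 / 2 - e)))"
    using l e by (intro mult_left_mono ln_powr_bound) auto
  also have "\<dots> = (real l powr (- 1 / 2) * real l powr e * real l powr (1 / 2 - e)) / (1 / 2 - e)" by simp
  also have "real l powr (- 1 / 2) * real l powr e * real l powr (1 / 2 - e) = 1"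
    using l by (simp add: powr_add[symmetric])
  finally have "real l powr (- 1 / 2) \<le> 1 / (1 / 2 - e) / (real l powr e * ln (real l))"
    by (simp only: pos_le_divide_eq[OF mult_pos_pos[OF p lnl]])
  then have "real l powr (- 1 / 2) \<le> 1 / (1 / 2 - e) * (1 / (real l powr e * ln (real l)))"
    by (simp only: times_divide_eq_right mult_1_right)
  then show "norm (real l powr (- 1 / 2)) \<le> 1 / (1 / 2 - e) * norm (1 / (real l powr e * ln (real l)))"
    using lnl p by (simp add: abs_mult)
qed

theorem theorem12:
  fixes d :: nat
    and Y :: "nat \<Rightarrow> nat \<Rightarrow> 'a::euclidean_space \<Rightarrow> real"
  assumes "DIM('a) = d + 1" and "d \<ge> 2"
    and "\<And>l. l \<ge> 1 \<Longrightarrow>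
      orthonormal_basis_on_sphere (eigenspace_dim d l) (Y l)
        (sphere_eigenspace (- (real l * (real l + real d - 1))))"
  shows
    "(\<forall>(\<Omega> :: 'w measure) (u :: nat \<Rightarrow> nat \<Rightarrow> 'w \<Rightarrow> real) (M :: real).
        prob_space \<Omega> \<longrightarrow>
        (\<forall>l\<ge>1. centered_gaussian_vector \<Omega> (eigenspace_dim d l)
                  (1 / real (eigenspace_dim d l)) (u l)) \<longrightarrow>
        M > 0 \<longrightarrow>
        (\<forall>l\<ge>2. prob_space.expectation \<Omega>
              (\<lambda>\<omega>. sphere_norm (\<lambda>x. \<Sum>m=1..eigenspace_dim d l. u l m \<omega> * Y l m x))
            \<le> M * sqrt (ln (real l))) \<longrightarrow>
        (\<forall>\<beta> \<beta>' :: real. 0 < \<beta>' \<longrightarrow> \<beta>' < \<beta> \<longrightarrow>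
          (\<lambda>l. measure (coeff_sphere_measure (eigenspace_dim d l))
              {a \<in> coeff_sphere (eigenspace_dim d l).
                 sphere_norm (\<lambda>x. \<Sum>m=1..eigenspace_dim d l. a m * Y l m x)
                   \<ge> (M + sqrt (2 * \<beta>)) * sqrt (ln (real l))})
            \<in> O(\<lambda>l. 1 / real l powr \<beta>')))
     \<and>
     (\<forall>K \<alpha> :: real.
        0 < K \<longrightarrow> K < sqrt (real d / (12 * real d + 2)) \<longrightarrow>
        2 * K\<^sup>2 / real d < \<alpha> \<longrightarrow> \<alpha> < 1 / (6 * real d + 1) \<longrightarrow>
          (\<lambda>l. measure (coeff_sphere_measure (eigenspace_dim d l))
              {a \<in> coeff_sphere (eigenspace_dim d l).
                 sphere_norm (\<lambda>x. \<Sum>m=1..eigenspace_dim d l. a m * Y l m x)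
                   \<le> K * sqrt (ln (real l))})
            \<in> O(\<lambda>l. 1 / (real l powr ((1 - (6 * real d + 1) * \<alpha>) / 2) * ln (real l))))"
proof (intro conjI allI impI)
  note Y = assms(3)
  note dim = eigenspace_dim_ge[OF assms(2)]
  {
    fix \<Omega> :: "'w measure" and u :: "nat \<Rightarrow> nat \<Rightarrow> 'w \<Rightarrow> real" and M \<beta> \<beta>' :: real
    assume "prob_space \<Omega>"
      and u: "\<forall>l\<ge>1. centered_gaussian_vector \<Omega> (eigenspace_dim d l) (1 / real (eigenspace_dim d l)) (u l)"
      and M: "0 < M"
      and mean: "\<forall>l\<ge>2. prob_space.expectation \<Omega>
              (\<lambda>\<omega>. sphere_norm (\<lambda>x. \<Sum>m=1..eigenspace_dim d l. u l m \<omega> * Y l m x))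
            \<le> M * sqrt (ln (real l))"
      and \<beta>: "0 < \<beta>'" "\<beta>' < \<beta>"
    show "(\<lambda>l. measure (coeff_sphere_measure (eigenspace_dim d l))
              {a \<in> coeff_sphere (eigenspace_dim d l).
                 sphere_norm (\<lambda>x. \<Sum>m=1..eigenspace_dim d l. a m * Y l m x)
                   \<ge> (M + sqrt (2 * \<beta>)) * sqrt (ln (real l))})
            \<in> O(\<lambda>l. 1 / real l powr \<beta>')"
    proof (rule large_sup_norm_bigo[OF Y dim M _ \<beta>])
      fix l :: nat assume l: "2 \<le> l"
      then have l1: "1 \<le> l" by simp
      define n where "n = eigenspace_dim d l"
      have n: "1 \<le> n" using dim[OF l1] l1 by (simp add: n_def)
      have "(\<integral>a. sphere_norm (\<lambda>x. \<Sum>m=1..n. a m * Y l m x) \<partial>gaussian_product {1..n} (1 / sqrt (real n)))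
        = (\<integral>\<omega>. sphere_norm (\<lambda>x. \<Sum>m=1..n. (\<lambda>m\<in>{1..n}. u l m \<omega>) m * Y l m x) \<partial>\<Omega>)"
        by (rule centered_gaussian_vector_expectation[symmetric])
           (use u l1 n borel_measurable_sphere_norm[OF Y[OF l1]] in \<open>simp_all only: n_def\<close>)
      also have "\<dots> = (\<integral>\<omega>. sphere_norm (\<lambda>x. \<Sum>m=1..n. u l m \<omega> * Y l m x) \<partial>\<Omega>)" by simp
      also have "\<dots> \<le> M * sqrt (ln (real l))" using mean l by (simp only: n_def)
      finally show "(\<integral>a. sphere_norm (\<lambda>x. \<Sum>m=1..eigenspace_dim d l. a m * Y l m x)
          \<partial>gaussian_product {1..eigenspace_dim d l} (1 / sqrt (real (eigenspace_dim d l)))) \<le> M * sqrt (ln (real l))"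
        by (simp only: n_def)
    qed
  next
    fix K \<alpha> :: real
    assume K: "0 < K" "K < sqrt (real d / (12 * real d + 2))" and \<alpha>: "2 * K\<^sup>2 / real d < \<alpha>" "\<alpha> < 1 / (6 * real d + 1)"
    have "K\<^sup>2 < (sqrt (real d / (12 * real d + 2)))\<^sup>2" using K by (intro power_strict_mono) auto
    also have "\<dots> = real d / (12 * real d + 2)" by simp
    also have "\<dots> < 1 / 12" using assms(2) by (simp add: field_simps)
    finally have K2: "K\<^sup>2 < 1 / 12" .
    have "0 < \<alpha>" using \<alpha>(1) by (rule le_less_trans[rotated]) simp
    then have "0 < (6 * real d + 1) * \<alpha>" by (intro mult_pos_pos) auto
    then have e: "(1 - (6 * real d + 1) * \<alpha>) / 2 < 1 / 2" by simp
    show "(\<lambda>l. measure (coeff_sphere_measure (eigenspace_dim d l))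
              {a \<in> coeff_sphere (eigenspace_dim d l).
                 sphere_norm (\<lambda>x. \<Sum>m=1..eigenspace_dim d l. a m * Y l m x)
                   \<le> K * sqrt (ln (real l))})
            \<in> O(\<lambda>l. 1 / (real l powr ((1 - (6 * real d + 1) * \<alpha>) / 2) * ln (real l)))"
      by (rule landau_o.big_trans[OF small_sup_norm_bigo[OF Y dim K(1) K2] powr_minus_half_bigo[OF e]])
  }
qed

end
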